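(* Let $p\ge 0$ be an integer, $z'>p-1$, $w'>-1$ real numbers, and let $J_{p,z',w'}(t)$, $t\ge0$, be the stationary Markov process described in the context, with space-time correlation functions $\rho_n$. For any $n\ge1$ and any $n$ distinct points $(x_1,t_1),\dots,(x_n,t_n)$ with $x_i\in(0,1)$, $t_i\ge0$, $$\rho_n(x_1,t_1;x_2,t_2;\dots;x_n,t_n)=\det\left[\mathrm{Ker}_{p,z',w'}(x_i,t_i;x_j,t_j)\right]_{i,j=1,\dots,n},$$ where $$\mathrm{Ker}_{p,z',w'}(x,t;y,s)=\begin{cases}\displaystyle\sum_{i=0}^{p-1}e^{(t-s)K_{p,z',w'}(i)}\,j^i_{p,z',w'}(x)\,j^i_{p,z',w'}(y),& t\ge s,\\[2mm] \displaystyle-\sum_{i=p}^{\infty}e^{(t-s)K_{p,z',w'}(i)}\,j^i_{p,z',w'}(x)\,j^i_{p,z',w'}(y),& t<s.\end{cases}$$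
   Context: Notation. $w_{p,z',w'}(x)=x^{w'}(1-x)^{z'-p}$ for $0<x<1$; the Jacobi polynomials on $(0,1)$ are $Jac^n_{\alpha,\beta}(x)=\frac{(\alpha+1)_n}{n!}\,{}_2F_1(-n,n+\alpha+\beta+1;\alpha+1;1-x)$, and $Jac^k_{z'-p,w'}$, $k\ge0$, are orthogonal with respect to $w_{p,z',w'}$; $$j^k_{p,z',w'}(x)=\frac{Jac^k_{z'-p,w'}(x)\sqrt{w_{p,z',w'}(x)}}{\sqrt{(Jac^k_{z'-p,w'},Jac^k_{z'-p,w'})}},$$ with $(\cdot,\cdot)$ the inner product of $L_2([0,1],w_{p,z',w'}(x)\,dx)$; $K_{p,z',w'}(i)=i(i+w'+z'+1-p)$ and $K_{p,z',w'}=\sum_{i=0}^{p-1}K_{p,z',w'}(i)$. The process. $J_{p,z',w'}(t)$, $t\ge0$, is the stationary Markov process on $\{0<x_1<\dots<x_p<1\}$ whose one-dimensional distributions have the Lebesgue density $\rho_{p,z',w'}(X)=B_{p,z',w'}\prod_{i<j}(x_i-x_j)^2\prod_{i=1}^pw_{p,z',w'}(x_i)$ ($B_{p,z',w'}$ the normalization constant) and whose transition probabilities over time $t>0$ from $X$ have the Lebesgue density in $Y$ $$\mathcal P^t_{p,z',w'}(Y\mid X)=\frac{\sqrt{\rho_{p,z',w'}(Y)}}{\sqrt{\rho_{p,z',w'}(X)}}\,e^{tK_{p,z',w'}}\det\left[\sum_{k=0}^\infty e^{-tK_{p,z',w'}(k)}j^k_{p,z',w'}(x_i)j^k_{p,z',w'}(y_j)\right]_{i,j=1,\dots,p}.$$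 Correlation functions. Identify $J_{p,z',w'}(t)$ with the $p$-point set of its coordinates. For fixed times $t_1,\dots,t_n\ge0$ (not necessarily distinct) the $n$-th correlation function is the density defined informally by $\mathrm{Prob}\{J_{p,z',w'}(t_i)\text{ has a point in }[x_i,x_i+dx_i],\ i=1,\dots,n\}=\rho_n(x_1,t_1;\dots;x_n,t_n)\,dx_1\cdots dx_n$; precisely, for every bounded measurable $f$ on $(0,1)^n$, $\mathbb E\sum f(a_1,\dots,a_n)=\int_{(0,1)^n}f(x_1,\dots,x_n)\rho_n(x_1,t_1;\dots;x_n,t_n)\,dx_1\cdots dx_n$, the sum being over all $(a_1,\dots,a_n)$ with $a_i\in J_{p,z',w'}(t_i)$ and the pairs $(a_i,t_i)$ pairwise distinct. The assertion is that the density $\rho_n$ is given by the stated formula. *)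

theory Defs
  imports "HOL-Probability.Probability" "Jordan_Normal_Form.Determinant"
begin

section \<open>Normalized Jacobi functions on the unit interval\<close>

text \<open>The Gauss function \<open>\<^sub>2F\<^sub>1(-k, k+\<alpha>+\<beta>+1; \<alpha>+1; \<cdot>)\<close> is the evaluation of
  the library's formal hypergeometric series (here a terminating one).\<close>

definition Jac :: "real \<Rightarrow> real \<Rightarrow> nat \<Rightarrow> real \<Rightarrow> real" where
  "Jac \<alpha> \<beta> k x = pochhammer (\<alpha> + 1) k / fact k *
     eval_fps (fps_hypergeo [- real k, real k + \<alpha> + \<beta> + 1] [\<alpha> + 1] 1) (1 - x)"

definition jac_weight :: "nat \<Rightarrow> real \<Rightarrow> real \<Rightarrow> real \<Rightarrow> real" where
  "jac_weight p z' w' x = x powr w' * (1 - x) powr (z' - real p)"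

definition jac_inner :: "nat \<Rightarrow> real \<Rightarrow> real \<Rightarrow> (real \<Rightarrow> real) \<Rightarrow> (real \<Rightarrow> real) \<Rightarrow> real" where
  "jac_inner p z' w' f g = (LINT x:{0..1}|lborel. f x * g x * jac_weight p z' w' x)"

definition jac_fun :: "nat \<Rightarrow> real \<Rightarrow> real \<Rightarrow> nat \<Rightarrow> real \<Rightarrow> real" where
  "jac_fun p z' w' k x =
     Jac (z' - real p) w' k x * sqrt (jac_weight p z' w' x) /
     sqrt (jac_inner p z' w' (Jac (z' - real p) w' k) (Jac (z' - real p) w' k))"

definition jac_eig :: "nat \<Rightarrow> real \<Rightarrow> real \<Rightarrow> nat \<Rightarrow> real" where
  "jac_eig p z' w' i = real i * (real i + w' + z' + 1 - real p)"

definition jac_eig_total :: "nat \<Rightarrow> real \<Rightarrow> real \<Rightarrow> real" where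
  "jac_eig_total p z' w' = (\<Sum>i<p. jac_eig p z' w' i)"


section \<open>The stationary Markov process\<close>

text \<open>Points of \<open>n\<close>-dimensional space are extensional functions on \<open>{..<n}\<close>, so coordinates
  are numbered from \<open>0\<close>. For \<open>n = 0\<close> the space is a single point of mass \<open>1\<close>.\<close>

definition lborel_on :: "nat \<Rightarrow> (nat \<Rightarrow> real) set \<Rightarrow> (nat \<Rightarrow> real) measure" where
  "lborel_on n S = restrict_space (\<Pi>\<^sub>M i\<in>{..<n}. lborel) S"

definition chamber :: "nat \<Rightarrow> (nat \<Rightarrow> real) set" where
  "chamber p = {X \<in> {..<p} \<rightarrow>\<^sub>E {0<..<1}. strict_mono_on {..<p} X}"

definition unnormalized_density :: "nat \<Rightarrow> real \<Rightarrow> real \<Rightarrow> (nat \<Rightarrow> real) \<Rightarrow> real" where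
  "unnormalized_density p z' w' X =
     (\<Prod>j<p. \<Prod>i<j. (X i - X j)\<^sup>2) * (\<Prod>i<p. jac_weight p z' w' (X i))"

definition stationary_density :: "nat \<Rightarrow> real \<Rightarrow> real \<Rightarrow> (nat \<Rightarrow> real) \<Rightarrow> real" where
  "stationary_density p z' w' X =
     unnormalized_density p z' w' X /
     (LINT Y|lborel_on p (chamber p). unnormalized_density p z' w' Y)"

definition transition_density ::
    "nat \<Rightarrow> real \<Rightarrow> real \<Rightarrow> real \<Rightarrow> (nat \<Rightarrow> real) \<Rightarrow> (nat \<Rightarrow> real) \<Rightarrow> real" where
  "transition_density p z' w' t Y X =
     sqrt (stationary_density p z' w' Y) / sqrt (stationary_density p z' w' X) *
     exp (t * jac_eig_total p z' w') *
     Determinant.det (Matrix.mat p p (\<lambda>(i, j).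
       \<Sum>k. exp (- t * jac_eig p z' w' k) * jac_fun p z' w' k (X i) * jac_fun p z' w' k (Y j)))"

definition past ::
    "'a measure \<Rightarrow> 'b measure \<Rightarrow> (real \<Rightarrow> 'a \<Rightarrow> 'b) \<Rightarrow> real \<Rightarrow> 'a measure" where
  "past M N X s =
     sigma (space M) (\<Union>u\<in>{0..s}. {X u -` A \<inter> space M |A. A \<in> sets N})"

text \<open>The last condition is the Markov property together with the form of the transition
  probabilities: the conditional law of \<open>J (s + t)\<close> given the process up to time \<open>s\<close> has the
  density \<open>transition_density p z' w' t Y (J s)\<close> in \<open>Y\<close>.\<close>

definition jacobi_process ::
    "nat \<Rightarrow> real \<Rightarrow> real \<Rightarrow> 'a measure \<Rightarrow> (real \<Rightarrow> 'a \<Rightarrow> nat \<Rightarrow> real) \<Rightarrow> bool" where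
  "jacobi_process p z' w' M J \<longleftrightarrow>
     prob_space M \<and>
     (\<forall>t\<ge>0. distributed M (lborel_on p (chamber p)) (J t)
              (\<lambda>X. ennreal (stationary_density p z' w' X))) \<and>
     (\<forall>s\<ge>0. \<forall>t>0. \<forall>A\<in>sets (lborel_on p (chamber p)).
        AE \<omega> in M.
          real_cond_exp M (past M (lborel_on p (chamber p)) J s)
            (\<lambda>\<omega>'. indicator A (J (s + t) \<omega>')) \<omega> =
          (LINT Y:A|lborel_on p (chamber p). transition_density p z' w' t Y (J s \<omega>)))"


section \<open>Space-time correlation functions\<close>

definition point_set :: "nat \<Rightarrow> (nat \<Rightarrow> real) \<Rightarrow> real set" where
  "point_set p X = X ` {..<p}"

definition cube :: "nat \<Rightarrow> (nat \<Rightarrow> real) set" where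
  "cube n = {..<n} \<rightarrow>\<^sub>E {0<..<1}"

definition correlation_sum ::
    "nat \<Rightarrow> (real \<Rightarrow> 'a \<Rightarrow> nat \<Rightarrow> real) \<Rightarrow> nat \<Rightarrow> (nat \<Rightarrow> real) \<Rightarrow> ((nat \<Rightarrow> real) \<Rightarrow> real) \<Rightarrow> 'a \<Rightarrow> real" where
  "correlation_sum p J n t f \<omega> =
     (\<Sum>a | a \<in> (\<Pi>\<^sub>E i\<in>{..<n}. point_set p (J (t i) \<omega>)) \<and> inj_on (\<lambda>i. (a i, t i)) {..<n}. f a)"

text \<open>Correlation functions are densities, hence determined only up to null sets: the predicate
  says that \<open>\<rho>\<close> is (a version of) the \<open>n\<close>-th correlation function at the times
  \<open>t 0, \<dots>, t (n - 1)\<close>. The integrability requirements exclude the default value \<open>0\<close> of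
  the Bochner integral.\<close>

definition is_correlation_function ::
    "nat \<Rightarrow> 'a measure \<Rightarrow> (real \<Rightarrow> 'a \<Rightarrow> nat \<Rightarrow> real) \<Rightarrow> nat \<Rightarrow> (nat \<Rightarrow> real) \<Rightarrow>
     ((nat \<Rightarrow> real) \<Rightarrow> real) \<Rightarrow> bool" where
  "is_correlation_function p M J n t \<rho> \<longleftrightarrow>
     \<rho> \<in> borel_measurable (lborel_on n (cube n)) \<and>
     (\<forall>f\<in>borel_measurable (lborel_on n (cube n)). bounded (f ` cube n) \<longrightarrow>
        integrable M (correlation_sum p J n t f) \<and>
        integrable (lborel_on n (cube n)) (\<lambda>x. f x * \<rho> x) \<and>
        (LINT \<omega>|M. correlation_sum p J n t f \<omega>) = (LINT x|lborel_on n (cube n). f x * \<rho> x))"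

definition jac_Ker :: "nat \<Rightarrow> real \<Rightarrow> real \<Rightarrow> real \<Rightarrow> real \<Rightarrow> real \<Rightarrow> real \<Rightarrow> real" where
  "jac_Ker p z' w' x t y s =
     (if t \<ge> s
      then \<Sum>i<p. exp ((t - s) * jac_eig p z' w' i) * jac_fun p z' w' i x * jac_fun p z' w' i y
      else - (\<Sum>i. exp ((t - s) * jac_eig p z' w' (i + p)) *
                     jac_fun p z' w' (i + p) x * jac_fun p z' w' (i + p) y))"

end

theory Submission
  imports Defs "HOL-Real_Asymp.Real_Asymp"
begin

text \<open>On configurations, the stationary density is the square of the determinant \<open>D\<close> of the first \<open>p\<close>
  Jacobi functions, and the Markov property turns the joint density at times \<open>s\<^sub>0 < \<dots> < s\<^sub>m\<^sub>-\<^sub>1\<close> into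
  \<open>D(X\<^sub>0) \<cdot> (product of transition determinants) \<cdot> D(X\<^sub>m\<^sub>-\<^sub>1)\<close>. A block elimination shows that this
  product is the determinant of \<open>Ker\<close> over all \<open>m p\<close> space-time points. The kernels compose as
  \<open>\<integral> Ker(x,t;y,s) Ker(y,s;z,u) dy = ([s \<le> t] - [s < u]) Ker(x,t;z,u)\<close>, so integrating out one of
  the points at time \<open>s\<close> from a determinant of \<open>Ker\<close> gives the smaller determinant times the number of
  free points at time \<open>s\<close>; all correlation functions follow from the top one in this way. Only crude
  bounds on the Jacobi polynomials are needed, because the eigenvalues grow quadratically.\<close>

section \<open>Determinants as sums over permutations\<close>

text \<open>The points of a correlation function carry arbitrary, possibly repeated times, while the
  Markov property describes whole configurations at increasing times. Labellings bridge the two: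
  choosing points means choosing coordinates, and with exactly \<open>p\<close> points at each time
  the ordered regions of the labellings fill the cube up to coincidences, where the determinant
  vanishes. The kernel suits block elimination because its negative tail is a sum of
  \<open>p\<close> terms minus the full heat series. So it has the form \<open>U V^T - R\<close>,
  with \<open>R\<close> nonzero only from an earlier to a later time. Two facts about the joint
  density are obtained indirectly. Its nonnegativity is not read off the determinants: it follows
  because its integrals over boxes are probabilities. The normalization of the stationary law stays
  an unknown \<open>Z > 0\<close> until the correlation identity with zero points shows
  \<open>Z = 1\<close>.\<close>

definition pdet :: "'i set \<Rightarrow> ('i \<Rightarrow> 'i \<Rightarrow> real) \<Rightarrow> real" where
  "pdet S A = (\<Sum>\<sigma> | \<sigma> permutes S. of_int (sign \<sigma>) * (\<Prod>i\<in>S. A i (\<sigma> i)))"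

text \<open>Block elimination works with matrices, whereas inserting or relabelling points works
  with a permutation sum over an arbitrary finite index set. This is the passage between the two
  forms.\<close>

lemma det_eq_pdet: "Determinant.det (Matrix.mat n n (\<lambda>(i, j). A i j)) = pdet {..<n} A"
proof -
  have "(\<Prod>i<n. Matrix.mat n n (\<lambda>(i, j). A i j) $$ (i, \<sigma> i)) = (\<Prod>i<n. A i (\<sigma> i))"
    if "\<sigma> permutes {..<n}" for \<sigma>
    using permutes_in_image[OF that] by (intro prod.cong) auto
  then show ?thesis
    unfolding det_def pdet_def by (simp add: atLeast0LessThan)
qed

lemma pdet_cong: "(\<And>i j. i \<in> S \<Longrightarrow> j \<in> S \<Longrightarrow> A i j = B i j) \<Longrightarrow> pdet S A = pdet S B"
  unfolding pdet_def by (intro sum.cong refl arg_cong2[of _ _ _ _ "(*)"] prod.cong)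
    (auto simp: permutes_in_image)

text \<open>Conjugating permutations by \<open>e\<close> preserves the sign. It lets points be put
  into a time-ordered enumeration without tracking row and column swaps.\<close>

lemma pdet_reindex:
  assumes e: "bij_betw e S T" and fin: "finite S"
  shows "pdet T A = pdet S (\<lambda>i j. A (e i) (e j))"
proof -
  let ?e' = "inv_into S e"
  have inj: "inj_on e S" and im: "e ` S = T" using e by (auto simp: bij_betw_def)
  have e': "bij_betw ?e' T S" by (rule bij_betw_inv_into[OF e])
  have "pdet S (\<lambda>i j. A (e i) (e j)) = pdet T A"
    unfolding pdet_def
  proof (rule sum.reindex_bij_witness[of _ "map_permutation T ?e'" "map_permutation S e"])
    fix \<sigma> assume "\<sigma> \<in> {\<sigma>. \<sigma> permutes S}"
    then have \<sigma>: "\<sigma> permutes S" by simp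
    have "map_permutation T ?e' (map_permutation S e \<sigma>) = map_permutation S (?e' \<circ> e) \<sigma>"
      by (rule map_permutation_compose[OF e]) (use e' in \<open>auto simp: bij_betw_def\<close>)
    also have "\<dots> = map_permutation S id \<sigma>"
      by (rule map_permutation_cong) (use \<sigma> inj in \<open>auto simp: inj_on_def\<close>)
    finally show "map_permutation T ?e' (map_permutation S e \<sigma>) = \<sigma>" using \<sigma> by simp
    show "map_permutation S e \<sigma> \<in> {\<sigma>. \<sigma> permutes T}"
      using map_permutation_permutes[OF e \<sigma>] by simp
    have "(\<Prod>i\<in>T. A i (map_permutation S e \<sigma> i)) = (\<Prod>i\<in>S. A (e i) (map_permutation S e \<sigma> (e i)))"
      using prod.reindex[OF inj, of "\<lambda>i. A i (map_permutation S e \<sigma> i)"] im by simp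
    also have "\<dots> = (\<Prod>i\<in>S. A (e i) (e (\<sigma> i)))"
      by (intro prod.cong refl) (simp add: map_permutation_apply inj)
    finally show "of_int (sign (map_permutation S e \<sigma>)) * (\<Prod>i\<in>T. A i (map_permutation S e \<sigma> i)) =
        of_int (sign \<sigma>) * (\<Prod>i\<in>S. A (e i) (e (\<sigma> i)))"
      by (simp add: sign_map_permutation[OF inj \<sigma> fin])
  next
    fix \<sigma> assume "\<sigma> \<in> {\<sigma>. \<sigma> permutes T}"
    then have \<sigma>: "\<sigma> permutes T" by simp
    have "map_permutation S e (map_permutation T ?e' \<sigma>) = map_permutation T (e \<circ> ?e') \<sigma>"
      by (rule map_permutation_compose[OF e' inj])
    also have "\<dots> = map_permutation T id \<sigma>"
    proof (rule map_permutation_cong)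
      show "inj_on (e \<circ> ?e') T"
        using comp_inj_on[of ?e' T e] e' inj by (auto simp: bij_betw_def)
    qed (use \<sigma> im in \<open>auto simp: f_inv_into_f\<close>)
    finally show "map_permutation S e (map_permutation T ?e' \<sigma>) = \<sigma>" using \<sigma> by simp
    show "map_permutation T ?e' \<sigma> \<in> {\<sigma>. \<sigma> permutes S}"
      using map_permutation_permutes[OF e' \<sigma>] by simp
  qed
  then show ?thesis by simp
qed

text \<open>A permutation of \<open>insert a S\<close> is uniquely \<open>transpose a b\<close>
  after a permutation \<open>\<sigma>\<close> of \<open>S\<close>. For \<open>b = a\<close> the
  element \<open>a\<close> is fixed. For \<open>b = \<sigma> i\<close> it is spliced into the arrow
  from \<open>i\<close> to \<open>\<sigma> i\<close>, which replaces the entry at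
  \<open>(i, \<sigma> i)\<close> by those at \<open>(i, a)\<close> and
  \<open>(a, \<sigma> i)\<close> and flips the sign.\<close>

lemma pdet_insert:
  assumes fin: "finite S" and a: "a \<notin> S"
  shows "pdet (insert a S) A = A a a * pdet S A -
    (\<Sum>\<sigma> | \<sigma> permutes S. of_int (sign \<sigma>) *
       (\<Sum>i\<in>S. A a (\<sigma> i) * A i a * (\<Prod>k\<in>S - {i}. A k (\<sigma> k))))"
proof -
  let ?P = "{\<sigma>. \<sigma> permutes S}"
  define g where "g = (\<lambda>\<sigma>. of_int (sign \<sigma>) * (\<Prod>i\<in>insert a S. A i (\<sigma> i)))"
  have inj: "inj_on (\<lambda>(b, \<sigma>). Transposition.transpose a b \<circ> \<sigma>) (insert a S \<times> ?P)"
  proof (rule inj_onI, clarify)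
    fix b \<sigma> c \<tau> assume \<sigma>: "\<sigma> permutes S" and \<tau>: "\<tau> permutes S"
      and eq: "Transposition.transpose a b \<circ> \<sigma> = Transposition.transpose a c \<circ> \<tau>"
    from fun_cong[OF eq, of a] have bc: "b = c"
      using permutes_not_in[OF \<sigma> a] permutes_not_in[OF \<tau> a] by simp
    from eq have "Transposition.transpose a b \<circ> (Transposition.transpose a b \<circ> \<sigma>) = Transposition.transpose a b \<circ> (Transposition.transpose a b \<circ> \<tau>)"
      using bc by simp
    then show "b = c \<and> \<sigma> = \<tau>" using bc by (simp add: comp_assoc[symmetric])
  qed
  have finP: "finite ?P" using fin by (simp add: finite_permutations)
  have "pdet (insert a S) A = (\<Sum>\<sigma>\<in>(\<lambda>(b, \<sigma>). Transposition.transpose a b \<circ> \<sigma>) ` (insert a S \<times> ?P). g \<sigma>)"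
    unfolding pdet_def g_def by (rule sum.cong) (auto simp: permutes_insert[of a S])
  also have "\<dots> = (\<Sum>(b, \<sigma>)\<in>insert a S \<times> ?P. g (Transposition.transpose a b \<circ> \<sigma>))"
    by (subst sum.reindex[OF inj]) (simp add: case_prod_unfold)
  also have "\<dots> = (\<Sum>\<sigma>\<in>?P. \<Sum>b\<in>insert a S. g (Transposition.transpose a b \<circ> \<sigma>))"
    by (subst sum.cartesian_product[symmetric], rule sum.swap)
  also have "\<dots> = (\<Sum>\<sigma>\<in>?P. of_int (sign \<sigma>) * (A a a * (\<Prod>i\<in>S. A i (\<sigma> i)) -
       (\<Sum>i\<in>S. A a (\<sigma> i) * A i a * (\<Prod>k\<in>S - {i}. A k (\<sigma> k)))))"
  proof (rule sum.cong[OF refl])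
    fix \<sigma> assume "\<sigma> \<in> ?P"
    then have \<sigma>: "\<sigma> permutes S" by simp
    have \<sigma>a: "\<sigma> a = a" by (rule permutes_not_in[OF \<sigma> a])
    have ga: "g (Transposition.transpose a a \<circ> \<sigma>) = of_int (sign \<sigma>) * (A a a * (\<Prod>i\<in>S. A i (\<sigma> i)))"
      using fin a \<sigma>a by (simp add: g_def)
    have gi: "g (Transposition.transpose a (\<sigma> i) \<circ> \<sigma>) =
        - (of_int (sign \<sigma>) * (A a (\<sigma> i) * A i a * (\<Prod>k\<in>S - {i}. A k (\<sigma> k))))"
      if i: "i \<in> S" for i
    proof -
      have \<sigma>i: "\<sigma> i \<in> S" using i permutes_in_image[OF \<sigma>] by simp
      have "sign (Transposition.transpose a (\<sigma> i) \<circ> \<sigma>) = - sign \<sigma>"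
        using \<sigma>i a fin \<sigma> by (subst sign_compose)
          (auto simp: sign_swap_id permutation_swap_id intro: permutation_permutes[THEN iffD2])
      moreover have "(\<Prod>k\<in>S. A k ((Transposition.transpose a (\<sigma> i) \<circ> \<sigma>) k)) =
          A i a * (\<Prod>k\<in>S - {i}. A k (\<sigma> k))"
      proof -
        have "Transposition.transpose a (\<sigma> i) (\<sigma> k) = \<sigma> k" if "k \<in> S - {i}" for k
        proof (rule transpose_apply_other)
          show "\<sigma> k \<noteq> a" using that a permutes_in_image[OF \<sigma>, of k] by auto
          show "\<sigma> k \<noteq> \<sigma> i" using that permutes_inj[OF \<sigma>] by (auto simp: inj_eq)
        qed
        then show ?thesis
          by (subst prod.remove[OF fin i]) (auto intro!: prod.cong)
      qed
      ultimately show ?thesis using fin a \<sigma>a by (simp add: g_def)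
    qed
    have "(\<Sum>b\<in>S. g (Transposition.transpose a b \<circ> \<sigma>)) = (\<Sum>i\<in>S. g (Transposition.transpose a (\<sigma> i) \<circ> \<sigma>))"
      using sum.permute[OF \<sigma>, of "\<lambda>b. g (Transposition.transpose a b \<circ> \<sigma>)"] by (simp add: o_def)
    also have "\<dots> = - (of_int (sign \<sigma>) * (\<Sum>i\<in>S. A a (\<sigma> i) * A i a * (\<Prod>k\<in>S - {i}. A k (\<sigma> k))))"
      using gi by (simp add: sum_negf sum_distrib_left)
    finally show "(\<Sum>b\<in>insert a S. g (Transposition.transpose a b \<circ> \<sigma>)) = of_int (sign \<sigma>) *
       (A a a * (\<Prod>i\<in>S. A i (\<sigma> i)) - (\<Sum>i\<in>S. A a (\<sigma> i) * A i a * (\<Prod>k\<in>S - {i}. A k (\<sigma> k))))"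
      using fin a ga by (simp add: algebra_simps)
  qed
  finally show ?thesis
    by (simp add: pdet_def sum_subtractf right_diff_distrib sum_distrib_left mult.left_commute)
qed

text \<open>The hypothesis \<open>comp\<close> restores the entry \<open>A\<^sub>0 i (\<sigma> i)\<close> that the transposition with \<open>a\<close> removed
  from the product over \<open>\<sigma>\<close>, so every permutation of \<open>S\<close> gets the same scalar factor.\<close>

lemma integral_pdet_insert:
  fixes A :: "'b \<Rightarrow> 'i \<Rightarrow> 'i \<Rightarrow> real"
  assumes fin: "finite S" and a: "a \<notin> S"
    and A0: "\<And>y i j. i \<in> S \<Longrightarrow> j \<in> S \<Longrightarrow> A y i j = A0 i j"
    and diag_int: "integrable M (\<lambda>y. A y a a)" and diag: "(LINT y|M. A y a a) = d"
    and comp_int: "\<And>i j. i \<in> S \<Longrightarrow> j \<in> S \<Longrightarrow> integrable M (\<lambda>y. A y a j * A y i a)"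
    and comp: "\<And>i j. i \<in> S \<Longrightarrow> j \<in> S \<Longrightarrow> (LINT y|M. A y a j * A y i a) = (\<alpha> i - \<beta> j) * A0 i j"
  shows "(LINT y|M. pdet (insert a S) (A y)) = (d - (\<Sum>i\<in>S. \<alpha> i - \<beta> i)) * pdet S A0"
proof -
  let ?P = "{\<sigma>. \<sigma> permutes S}"
  have eq: "pdet (insert a S) (A y) = A y a a * pdet S A0 -
    (\<Sum>\<sigma>\<in>?P. of_int (sign \<sigma>) *
       (\<Sum>i\<in>S. (A y a (\<sigma> i) * A y i a) * (\<Prod>k\<in>S - {i}. A0 k (\<sigma> k))))" for y
    unfolding pdet_insert[OF fin a]
    using pdet_cong[of S "A y" A0] A0
    by (intro arg_cong2[of _ _ _ _ "(-)"] sum.cong refl arg_cong2[of _ _ _ _ "(*)"] prod.cong)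
      (auto simp: permutes_in_image)
  have ci: "integrable M (\<lambda>y. (A y a (\<sigma> i) * A y i a) * c)" if "\<sigma> \<in> ?P" "i \<in> S" for \<sigma> i c
    using comp_int[of i "\<sigma> i"] that by (auto simp: permutes_in_image)
  have "(LINT y|M. pdet (insert a S) (A y)) = d * pdet S A0 - (\<Sum>\<sigma>\<in>?P. of_int (sign \<sigma>) *
       (\<Sum>i\<in>S. (LINT y|M. A y a (\<sigma> i) * A y i a) * (\<Prod>k\<in>S - {i}. A0 k (\<sigma> k))))"
    unfolding eq using ci diag_int
    by (subst Bochner_Integration.integral_diff,
        auto intro!: Bochner_Integration.integrable_sum integrable_mult_right simp: diag integral_sum')
  also have "(\<Sum>\<sigma>\<in>?P. of_int (sign \<sigma>) *
       (\<Sum>i\<in>S. (LINT y|M. A y a (\<sigma> i) * A y i a) * (\<Prod>k\<in>S - {i}. A0 k (\<sigma> k)))) =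
     (\<Sum>\<sigma>\<in>?P. of_int (sign \<sigma>) * ((\<Sum>i\<in>S. \<alpha> i - \<beta> i) * (\<Prod>k\<in>S. A0 k (\<sigma> k))))"
  proof (rule sum.cong[OF refl], rule arg_cong2[of _ _ _ _ "(*)", OF refl])
    fix \<sigma> assume "\<sigma> \<in> ?P"
    then have \<sigma>: "\<sigma> permutes S" by simp
    have "(\<Sum>i\<in>S. (LINT y|M. A y a (\<sigma> i) * A y i a) * (\<Prod>k\<in>S - {i}. A0 k (\<sigma> k))) =
        (\<Sum>i\<in>S. (\<alpha> i - \<beta> (\<sigma> i)) * (\<Prod>k\<in>S. A0 k (\<sigma> k)))"
    proof (rule sum.cong[OF refl])
      fix i assume i: "i \<in> S"
      have "(LINT y|M. A y a (\<sigma> i) * A y i a) = (\<alpha> i - \<beta> (\<sigma> i)) * A0 i (\<sigma> i)"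
        using comp[OF i, of "\<sigma> i"] i permutes_in_image[OF \<sigma>] by simp
      then show "(LINT y|M. A y a (\<sigma> i) * A y i a) * (\<Prod>k\<in>S - {i}. A0 k (\<sigma> k)) =
          (\<alpha> i - \<beta> (\<sigma> i)) * (\<Prod>k\<in>S. A0 k (\<sigma> k))"
        by (subst prod.remove[OF fin i]) simp
    qed
    also have "\<dots> = ((\<Sum>i\<in>S. \<alpha> i) - (\<Sum>i\<in>S. \<beta> (\<sigma> i))) * (\<Prod>k\<in>S. A0 k (\<sigma> k))"
      by (simp add: sum_distrib_right[symmetric] sum_subtractf)
    \<comment> \<open>The dependence of the factor on \<open>\<sigma>\<close> disappears here, since
      permuting \<open>S\<close> does not change a sum over \<open>S\<close>. This is why the scalar
      in \<open>comp\<close> has to split into a function of the row minus a function of the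
      column.\<close>
    also have "(\<Sum>i\<in>S. \<beta> (\<sigma> i)) = (\<Sum>i\<in>S. \<beta> i)"
      using sum.permute[OF \<sigma>, of \<beta>] by (simp add: o_def)
    finally show "(\<Sum>i\<in>S. (LINT y|M. A y a (\<sigma> i) * A y i a) * (\<Prod>k\<in>S - {i}. A0 k (\<sigma> k))) =
        (\<Sum>i\<in>S. \<alpha> i - \<beta> i) * (\<Prod>k\<in>S. A0 k (\<sigma> k))"
      by (simp add: sum_subtractf)
  qed
  also have "\<dots> = (\<Sum>i\<in>S. \<alpha> i - \<beta> i) * pdet S A0"
    by (simp add: pdet_def sum_distrib_left mult.left_commute)
  finally show ?thesis by (simp add: left_diff_distrib)
qed

text \<open>The matrix on the left is the Schur complement of the identity block. Bordering trades
  the product of rank at most \<open>p\<close>, which fills the whole matrix, for \<open>p\<close>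
  additional rows and columns, so that only \<open>R\<close> with its zero pattern in time stays in
  the main block.\<close>

lemma det_schur_bordered:
  fixes U V R :: "nat \<Rightarrow> nat \<Rightarrow> real"
  shows "det (mat N N (\<lambda>(i, j). (\<Sum>q<p. U i q * V j q) - R i j)) =
    det (four_block_mat (mat N N (\<lambda>(i, j). - R i j)) (mat N p (\<lambda>(i, q). U i q))
      (mat p N (\<lambda>(q, j). - V j q)) (1\<^sub>m p))" (is "det ?K = det ?B")
proof -
  let ?V = "mat p N (\<lambda>(q, j). V j q)" and ?U = "mat N p (\<lambda>(i, q). U i q)"
  \<comment> \<open>Multiplication by this unipotent matrix adds border columns to the others so as
    to clear the lower left block.\<close>
  let ?L = "four_block_mat (1\<^sub>m N) (0\<^sub>m N p) ?V (1\<^sub>m p)"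
  have 1: "?B * ?L = four_block_mat ?K ?U (0\<^sub>m p N) (1\<^sub>m p)"
  proof -
    let ?R = "mat N N (\<lambda>(i, j). - R i j)" and ?W = "mat p N (\<lambda>(q, j). - V j q)"
    have "?B * ?L = four_block_mat (?R * 1\<^sub>m N + ?U * ?V) (?R * 0\<^sub>m N p + ?U * 1\<^sub>m p)
        (?W * 1\<^sub>m N + 1\<^sub>m p * ?V) (?W * 0\<^sub>m N p + 1\<^sub>m p * 1\<^sub>m p)"
      by (rule mult_four_block_mat) auto
    also have "?R * 1\<^sub>m N + ?U * ?V = ?K"
      by (rule eq_matI) (simp_all add: scalar_prod_def atLeast0LessThan)
    also have "?R * 0\<^sub>m N p + ?U * 1\<^sub>m p = ?U"
      by (rule eq_matI) simp_all
    also have "?W * 1\<^sub>m N + 1\<^sub>m p * ?V = 0\<^sub>m p N"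
      by (rule eq_matI) simp_all
    also have "?W * 0\<^sub>m N p + 1\<^sub>m p * 1\<^sub>m p = 1\<^sub>m p"
      by (rule eq_matI) simp_all
    finally show ?thesis .
  qed
  have 2: "det (?B * ?L) = det ?B * det ?L"
    by (rule det_mult[of _ "N + p"]) auto
  have 3: "det ?L = det (1\<^sub>m N) * det (1\<^sub>m p)"
    by (rule det_four_block_mat_upper_right_zero) auto
  have 4: "det (four_block_mat ?K ?U (0\<^sub>m p N) (1\<^sub>m p)) = det ?K * det (1\<^sub>m p)"
    by (rule det_four_block_mat_lower_left_zero) auto
  show ?thesis using 2 unfolding 1 3 4 det_one mult_1_right .
qed

lemma det_block_upper_triangular:
  fixes T :: "nat \<Rightarrow> nat \<Rightarrow> real"
  assumes "\<And>i j. i < m * p \<Longrightarrow> j div p < i div p \<Longrightarrow> T i j = 0"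
  shows "det (mat (m * p) (m * p) (\<lambda>(i, j). T i j)) =
    (\<Prod>k<m. det (mat p p (\<lambda>(a, b). T (k * p + a) (k * p + b))))"
  using assms
proof (induction m)
  case 0
  then show ?case by simp
next
  case (Suc m)
  let ?A = "mat (m * p) (m * p) (\<lambda>(i, j). T i j)"
  let ?D = "mat p p (\<lambda>(a, b). T (m * p + a) (m * p + b))"
  let ?B = "mat (m * p) p (\<lambda>(a, b). T a (m * p + b))"
  have z: "T i j = 0" if "\<not> i < m * p" "i < p + m * p" "j < m * p" for i j
  proof (rule Suc.prems)
    have p: "p > 0" using that(3) by (cases p) auto
    have "j div p < m" using that(3) by (rule less_mult_imp_div_less)
    moreover have "m \<le> i div p" using that(1) p by (simp add: less_eq_div_iff_mult_less_eq)
    ultimately show "j div p < i div p" by simp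
  qed (use that in simp)
  have "mat (Suc m * p) (Suc m * p) (\<lambda>(i, j). T i j) = four_block_mat ?A ?B (0\<^sub>m p (m * p)) ?D"
    by (rule eq_matI) (auto simp: z)
  then have "det (mat (Suc m * p) (Suc m * p) (\<lambda>(i, j). T i j)) = det ?A * det ?D"
    by (simp, intro det_four_block_mat_lower_left_zero) auto
  also have "det ?A = (\<Prod>k<m. det (mat p p (\<lambda>(a, b). T (k * p + a) (k * p + b))))"
    using Suc.prems by (intro Suc.IH) auto
  finally show ?case by (simp add: mult.commute)
qed

text \<open>Moving the first block column of the bordered matrix behind all others makes it block
  triangular; the sign of this move cancels the signs of the blocks.\<close>

lemma det_time_ordered:
  fixes U V R :: "nat \<Rightarrow> nat \<Rightarrow> real"
  assumes R: "\<And>i j. i < m * p \<Longrightarrow> j div p \<le> i div p \<Longrightarrow> R i j = 0" and m: "m > 0"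
  shows "det (mat (m * p) (m * p) (\<lambda>(i, j). (\<Sum>q<p. U i q * V j q) - R i j)) =
    det (mat p p (\<lambda>(a, q). U ((m - 1) * p + a) q)) *
    (\<Prod>k<m - 1. det (mat p p (\<lambda>(a, b). R (k * p + a) (Suc k * p + b)))) *
    det (mat p p (\<lambda>(b, q). V b q))"
proof -
  let ?N = "m * p"
  let ?B = "four_block_mat (mat ?N ?N (\<lambda>(i, j). - R i j)) (mat ?N p (\<lambda>(i, q). U i q))
      (mat p ?N (\<lambda>(q, j). - V j q)) (1\<^sub>m p)"
  \<comment> \<open>The main block after the move: column \<open>j\<close> is the former column
    \<open>j + p\<close>. Its diagonal blocks are therefore \<open>- R\<close> from one time to the
    next, and \<open>U\<close> in the last place. Below them stand entries of \<open>R\<close> from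
    a time to the same or an earlier one, which are zero.\<close>
  define T where "T i j = (if j + p < ?N then - R i (j + p) else U i (j + p - ?N))" for i j
  let ?C = "mat p ?N (\<lambda>(q, j). ?B $$ (q + ?N, j + p))"
  let ?D = "mat p p (\<lambda>(q, b). - V b q)"
  have pN: "p \<le> ?N" using m by simp
  have "det ?B = (-1) ^ (?N * p) * det (mat (?N + p) (?N + p) (\<lambda>(i, j).
     ?B $$ (i, if j < ?N then j + p else j - ?N)))"
    by (rule det_swap_cols) auto
  also have "mat (?N + p) (?N + p) (\<lambda>(i, j). ?B $$ (i, if j < ?N then j + p else j - ?N)) =
     four_block_mat (mat ?N ?N (\<lambda>(i, j). T i j)) (0\<^sub>m ?N p) ?C ?D"
  proof -
    have "j - ?N < ?N" if "j < ?N + p" "\<not> j < ?N" for j using that pN by linarith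
    then show ?thesis using pN by (intro eq_matI) (auto simp: T_def R)
  qed
  also have "det \<dots> = det (mat ?N ?N (\<lambda>(i, j). T i j)) * det ?D"
    by (rule det_four_block_mat_upper_right_zero) auto
  also have "det (mat ?N ?N (\<lambda>(i, j). T i j)) =
      (\<Prod>k<m. det (mat p p (\<lambda>(a, b). T (k * p + a) (k * p + b))))"
  proof (rule det_block_upper_triangular)
    fix i j assume i: "i < ?N" and ji: "j div p < i div p"
    have p: "p > 0" using i by (cases p) auto
    have "i div p < m" using i by (simp add: less_mult_imp_div_less)
    with ji have "j div p < m - 1" by simp
    then have "(j + p) div p < m" using p by simp
    then have "j + p < ?N" using p by (metis div_less_iff_less_mult)
    moreover have "R i (j + p) = 0" using R[OF i, of "j + p"] ji p by simp
    ultimately show "T i j = 0" by (simp add: T_def)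
  qed
  also have "\<dots> = (\<Prod>k<Suc (m - 1). det (mat p p (\<lambda>(a, b). T (k * p + a) (k * p + b))))"
    using m by simp
  also have "\<dots> = (\<Prod>k<m - 1. det (mat p p (\<lambda>(a, b). - R (k * p + a) (Suc k * p + b)))) *
      det (mat p p (\<lambda>(a, q). U ((m - 1) * p + a) q))"
  proof -
    have "det (mat p p (\<lambda>(a, b). T (k * p + a) (k * p + b))) =
        det (mat p p (\<lambda>(a, b). - R (k * p + a) (Suc k * p + b)))" if k: "k < m - 1" for k
    proof -
      have "k * p + b + p < ?N" if "b < p" for b
      proof -
        have "Suc (Suc k) * p \<le> ?N" using k by (intro mult_le_mono1) simp
        then show ?thesis using that by simp
      qed
      then show ?thesis
        by (intro arg_cong[of _ _ det] eq_matI) (auto simp: T_def algebra_simps)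
    qed
    moreover have "det (mat p p (\<lambda>(a, b). T ((m - 1) * p + a) ((m - 1) * p + b))) =
        det (mat p p (\<lambda>(a, q). U ((m - 1) * p + a) q))"
      using m by (cases m) (auto intro!: arg_cong[of _ _ det] eq_matI simp: T_def)
    ultimately show ?thesis by simp
  qed
  also have "(\<Prod>k<m - 1. det (mat p p (\<lambda>(a, b). - R (k * p + a) (Suc k * p + b)))) =
      (\<Prod>k<m - 1. (-1) ^ p * det (mat p p (\<lambda>(a, b). R (k * p + a) (Suc k * p + b))))"
  proof (intro prod.cong refl)
    fix k
    have "mat p p (\<lambda>(a, b). - R (k * p + a) (Suc k * p + b)) =
        (-1) \<cdot>\<^sub>m mat p p (\<lambda>(a, b). R (k * p + a) (Suc k * p + b))"
      by (rule eq_matI) auto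
    then show "det (mat p p (\<lambda>(a, b). - R (k * p + a) (Suc k * p + b))) =
        (-1) ^ p * det (mat p p (\<lambda>(a, b). R (k * p + a) (Suc k * p + b)))"
      by (simp only: det_smult dim_col_mat)
  qed
  also have "det ?D = (-1) ^ p * det (mat p p (\<lambda>(b, q). V b q))"
  proof -
    have "?D = (-1) \<cdot>\<^sub>m transpose_mat (mat p p (\<lambda>(b, q). V b q))"
      by (rule eq_matI) auto
    then show ?thesis by (simp only: det_smult det_transpose[OF mat_carrier] dim_col_mat index_transpose_mat dim_row_mat)
  qed
  finally have "det ?B = ((-1) ^ (?N * p) * ((-1) ^ p) ^ (m - 1) * (-1) ^ p) * (det (mat p p (\<lambda>(a, q). U ((m - 1) * p + a) q)) *
    (\<Prod>k<m - 1. det (mat p p (\<lambda>(a, b). R (k * p + a) (Suc k * p + b)))) *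
    det (mat p p (\<lambda>(b, q). V b q)))"
    by (simp add: prod.distrib)
  also have "(-1) ^ (?N * p) * ((-1) ^ p) ^ (m - 1) * (-1) ^ p = (1::real)"
  proof -
    have "((-1) ^ p) ^ (m - 1) * (-1) ^ p = ((-1::real) ^ p) ^ m"
      using m by (cases m) auto
    also have "\<dots> = (-1) ^ (m * p)" by (simp add: power_mult[symmetric] mult.commute)
    finally have "(-1) ^ (?N * p) * ((-1) ^ p) ^ (m - 1) * (-1) ^ p = (-1::real) ^ (?N * p + m * p)"
      by (simp add: power_add mult.assoc)
    moreover have "even (?N * p + m * p)" by simp
    ultimately show ?thesis by simp
  qed
  finally show ?thesis by (simp add: det_schur_bordered)
qed

text \<open>Pigeonhole, the easy direction of the Frobenius-Koenig theorem: no permutation maps the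
  rows in \<open>A\<close> into the smaller set \<open>C\<close>, so every product contains a zero
  entry.\<close>

lemma det_zero_block:
  fixes F :: "nat \<Rightarrow> nat \<Rightarrow> real"
  assumes A: "A \<subseteq> {..<N}" and C: "finite C" and card: "card C < card A"
    and z: "\<And>i j. i \<in> A \<Longrightarrow> j < N \<Longrightarrow> j \<notin> C \<Longrightarrow> F i j = 0"
  shows "pdet {..<N} F = 0"
  unfolding pdet_def
proof (rule sum.neutral, rule ballI)
  fix \<sigma> assume "\<sigma> \<in> {\<sigma>. \<sigma> permutes {..<N}}"
  then have \<sigma>: "\<sigma> permutes {..<N}" by simp
  have "card (\<sigma> ` A) = card A"
    using permutes_inj[OF \<sigma>] by (intro card_image) (auto simp: inj_on_def)
  with card have "\<not> \<sigma> ` A \<subseteq> C" using card_mono[OF C, of "\<sigma> ` A"] by linarith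
  then obtain i where i: "i \<in> A" "\<sigma> i \<notin> C" by auto
  then have iN: "i < N" using A by auto
  then have "\<sigma> i < N" using permutes_in_image[OF \<sigma>] by auto
  then have "F i (\<sigma> i) = 0" using z i by auto
  then show "of_int (sign \<sigma>) * (\<Prod>i<N. F i (\<sigma> i)) = 0"
    using iN by auto
qed

text \<open>In the bordered matrix, the rows at time at least \<open>s\<close> are supported on the columns at time
  greater than \<open>s\<close> and the \<open>p\<close> additional ones.\<close>

lemma pdet_too_many_points:
  fixes U V R :: "nat \<Rightarrow> nat \<Rightarrow> real" and t :: "nat \<Rightarrow> real"
  assumes R: "\<And>i j. t j \<le> t i \<Longrightarrow> R i j = 0" and s: "card {i. i < N \<and> t i = s} > p"
  shows "pdet {..<N} (\<lambda>i j. (\<Sum>q<p. U i q * V j q) - R i j) = 0"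
proof -
  let ?B = "four_block_mat (mat N N (\<lambda>(i, j). - R i j)) (mat N p (\<lambda>(i, q). U i q))
      (mat p N (\<lambda>(q, j). - V j q)) (1\<^sub>m p)"
  define F where "F i j = ?B $$ (i, j)" for i j
  define A where "A = {i. i < N \<and> t i \<ge> s}"
  define C where "C = {j. j < N \<and> t j > s} \<union> {N..<N + p}"
  have "pdet {..<N} (\<lambda>i j. (\<Sum>q<p. U i q * V j q) - R i j) = det ?B"
    by (simp add: det_schur_bordered[symmetric] det_eq_pdet[symmetric])
  also have "?B = mat (N + p) (N + p) (\<lambda>(i, j). F i j)"
    by (rule eq_matI) (auto simp: F_def)
  also have "det \<dots> = pdet {..<N + p} F" by (rule det_eq_pdet)
  also have "\<dots> = 0"
  proof (rule det_zero_block[of A _ C])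
    show "A \<subseteq> {..<N + p}" "finite C" by (auto simp: A_def C_def)
    have "card C \<le> card {j. j < N \<and> t j > s} + p"
      unfolding C_def by (rule order_trans[OF card_Un_le]) simp
    moreover have "card A = card {j. j < N \<and> t j > s} + card {i. i < N \<and> t i = s}"
      unfolding A_def by (subst card_Un_disjoint[symmetric]) (auto intro!: arg_cong[of _ _ card])
    ultimately show "card C < card A" using s by simp
    fix i j assume "i \<in> A" "j < N + p" "j \<notin> C"
    then have "i < N" "j < N" "t j \<le> t i" by (auto simp: A_def C_def)
    then show "F i j = 0" using R by (simp add: F_def)
  qed
  finally show ?thesis .
qed

section \<open>Lebesgue measure on the open unit interval\<close>

definition unit_lborel :: "real measure" where
  "unit_lborel = restrict_space lborel {0<..<1}"

lemma space_unit_lborel [simp]: "space unit_lborel = {0<..<1}"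
  by (simp add: unit_lborel_def space_restrict_space)

lemma prob_space_unit_lborel: "prob_space unit_lborel"
  by (rule prob_spaceI) (simp add: unit_lborel_def emeasure_restrict_space space_restrict_space)

lemma measurable_unit_lborelI: "f \<in> borel_measurable borel \<Longrightarrow> f \<in> borel_measurable unit_lborel"
  unfolding unit_lborel_def by (intro measurable_restrict_space1) simp

text \<open>The endpoints are null. The open interval keeps \<open>x\<close> and
  \<open>1 - x\<close> positive, while \<open>jac_inner\<close> and the Beta integral live on the
  closed one.\<close>

lemma unit_lborel_eq_Icc:
  fixes f :: "real \<Rightarrow> real"
  assumes [measurable]: "f \<in> borel_measurable borel"
  shows "integral\<^sup>L unit_lborel f = (LINT x:{0..1}|lborel. f x)"
    and "integrable unit_lborel f \<longleftrightarrow> set_integrable lborel {0..1} f"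
proof -
  have ae: "AE x in lborel. indicator {0<..<1} x *\<^sub>R f x = indicator {0..1} x *\<^sub>R f x"
    using AE_lborel_singleton[of "0::real"] AE_lborel_singleton[of "1::real"]
    by eventually_elim (auto simp: indicator_def)
  show "integral\<^sup>L unit_lborel f = (LINT x:{0..1}|lborel. f x)"
    unfolding unit_lborel_def set_lebesgue_integral_def
    by (subst integral_restrict_space, simp, rule integral_cong_AE, simp, simp, rule ae)
  show "integrable unit_lborel f \<longleftrightarrow> set_integrable lborel {0..1} f"
    unfolding unit_lborel_def set_integrable_def
    by (subst integrable_restrict_space, simp, rule integrable_cong_AE, simp, simp, rule ae)
qed

section \<open>Jacobi polynomials\<close>

lemma Beta_add_right:
  fixes a b :: real
  assumes "a > 0" "b > 0"
  shows "Beta a (b + real j) = Beta a b * pochhammer b j / pochhammer (a + b) j"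
proof (induction j)
  case (Suc j)
  have "(a + (b + real j)) * Beta a (b + real j + 1) = (b + real j) * Beta a (b + real j)"
    using assms by (intro Beta_plus1_right) (auto dest: nonpos_Ints_nonpos)
  moreover have "a + (b + real j) > 0" "pochhammer (a + b) j > 0"
    using assms by (auto intro: pochhammer_pos)
  ultimately have "Beta a (b + real j + 1) = (b + real j) / (a + b + real j) * Beta a (b + real j)"
    by (simp add: field_simps)
  moreover have "b + real (Suc j) = b + real j + 1" by simp
  ultimately have "Beta a (b + real (Suc j)) =
      (b + real j) / (a + b + real j) * (Beta a b * pochhammer b j / pochhammer (a + b) j)"
    using Suc by metis
  then show ?case by (simp add: pochhammer_Suc mult_ac add_ac)
qed simp

lemma Beta_real_pos: "a > 0 \<Longrightarrow> b > 0 \<Longrightarrow> Beta a b > (0::real)"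
  by (simp add: Beta_def rGamma_inverse_Gamma Gamma_real_pos)

lemma abs_pochhammer_le:
  fixes x X :: real
  assumes "\<And>i. i < n \<Longrightarrow> \<bar>x + real i\<bar> \<le> X" "n \<le> k" "1 \<le> X"
  shows "\<bar>pochhammer x n\<bar> \<le> X ^ k"
  unfolding pochhammer_prod abs_prod using assms by (intro prod_le_power) auto

text \<open>Every factor after the first is at least 1, so only the first can make the product
  small.\<close>

lemma pochhammer_ge_min:
  fixes x :: real
  assumes "x > 0"
  shows "min x 1 \<le> pochhammer x n"
proof (cases n)
  case (Suc m)
  have "min x 1 \<le> pochhammer x (Suc m)" 
  proof (induction m)
    case (Suc m)
    have "1 * min x 1 \<le> (x + real (Suc m)) * pochhammer x (Suc m)"
      using Suc assms by (intro mult_mono) auto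
    then show ?case by (subst pochhammer_rec') simp
  qed simp
  then show ?thesis using Suc by simp
qed simp

lemma integral_unit_Beta:
  assumes a: "a > -1" and b: "b > (-1::real)"
  shows "(LINT x|unit_lborel. x powr a * (1 - x) powr b) = Beta (a + 1) (b + 1)"
    and "integrable unit_lborel (\<lambda>x. x powr a * (1 - x) powr b)"
proof -
  have i: "set_integrable lborel {0..1} (\<lambda>x. x powr a * (1 - x) powr b)"
    using integrable_Beta[of "a + 1" "b + 1"] a b by simp
  then show "integrable unit_lborel (\<lambda>x. x powr a * (1 - x) powr b)"
    by (subst unit_lborel_eq_Icc) auto
  have "(LINT x|unit_lborel. x powr a * (1 - x) powr b) = (LINT x:{0..1}|lborel. x powr a * (1 - x) powr b)"
    by (rule unit_lborel_eq_Icc) auto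
  also have "\<dots> = integral {0..1} (\<lambda>x. x powr a * (1 - x) powr b)"
    by (rule set_borel_integral_eq_integral(2)[OF i])
  also have "\<dots> = Beta (a + 1) (b + 1)"
    using has_integral_Beta_real[of "a + 1" "b + 1"] a b by (intro integral_unique) simp
  finally show "(LINT x|unit_lborel. x powr a * (1 - x) powr b) = Beta (a + 1) (b + 1)" .
qed

definition jac_coeff :: "real \<Rightarrow> real \<Rightarrow> nat \<Rightarrow> nat \<Rightarrow> real" where
  "jac_coeff \<alpha> \<beta> k j = pochhammer (\<alpha> + 1) k / fact k *
     (pochhammer (- real k) j * pochhammer (real k + \<alpha> + \<beta> + 1) j /
       (pochhammer (\<alpha> + 1) j * fact j))"

definition jac_poly :: "real \<Rightarrow> real \<Rightarrow> nat \<Rightarrow> real poly" where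
  "jac_poly \<alpha> \<beta> k = (\<Sum>j\<le>k. Polynomial.smult (jac_coeff \<alpha> \<beta> k j) ([:1, -1:] ^ j))"

lemma Jac_eq_sum: "Jac \<alpha> \<beta> k x = (\<Sum>j\<le>k. jac_coeff \<alpha> \<beta> k j * (1 - x) ^ j)"
proof -
  have "eval_fps (fps_hypergeo [- real k, real k + \<alpha> + \<beta> + 1] [\<alpha> + 1] 1) (1 - x) =
      (\<Sum>j\<le>k. fps_nth (fps_hypergeo [- real k, real k + \<alpha> + \<beta> + 1] [\<alpha> + 1] 1) j * (1 - x) ^ j)"
    unfolding eval_fps_def
    by (rule suminf_finite) (auto simp: not_le pochhammer_of_nat_eq_0_iff)
  then show ?thesis
    by (simp add: Jac_def jac_coeff_def sum_distrib_left mult.assoc)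
qed

lemma poly_jac_poly: "poly (jac_poly \<alpha> \<beta> k) x = Jac \<alpha> \<beta> k x"
  by (simp add: jac_poly_def Jac_eq_sum poly_sum)

lemma degree_jac_poly_le: "degree (jac_poly \<alpha> \<beta> k) \<le> k"
  unfolding jac_poly_def
proof (rule degree_sum_le)
  fix j assume "j \<in> {..k}"
  then show "degree (Polynomial.smult (jac_coeff \<alpha> \<beta> k j) ([:1, -1:] ^ j)) \<le> k"
    by (intro order_trans[OF degree_smult_le] order_trans[OF degree_power_le]) auto
qed simp

text \<open>\<open>\<alpha>\<close> is the exponent at the endpoint 1, around which the
  hypergeometric polynomial is expanded, and \<open>\<beta>\<close> the one at 0. The process has
  \<open>\<alpha> = z' - p\<close> and \<open>\<beta> = w'\<close>.\<close>

locale jacobi_weight =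
  fixes \<alpha> \<beta> :: real
  assumes \<alpha>: "\<alpha> > -1" and \<beta>: "\<beta> > -1"
begin

abbreviation "w x \<equiv> x powr \<beta> * (1 - x) powr \<alpha>"

definition jac_lead :: "nat \<Rightarrow> real" where
  "jac_lead k = pochhammer (real k + \<alpha> + \<beta> + 1) k / fact k"

text \<open>The squared norm, in the form in which it arises: lower powers of \<open>x\<close> are
  orthogonal to the polynomial of degree \<open>k\<close>, so the norm is the leading coefficient
  times the moment of \<open>x ^ k\<close>, and the second factor is that moment.\<close>

definition jac_norm2 :: "nat \<Rightarrow> real" where
  "jac_norm2 k = jac_lead k *
     (pochhammer (\<alpha> + 1) k * Beta (\<beta> + 1 + real k) (\<alpha> + 1) / pochhammer (\<alpha> + \<beta> + 2 + real k) k)"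

text \<open>For \<open>k = 0\<close> the base \<alpha> + \<beta> + 1 may be negative, but the
  Pochhammer symbol is empty. For larger \<open>k\<close> the base is at least \<alpha> + \<beta> +
  2, which is positive.\<close>

lemma jac_lead_ge: "jac_lead k \<ge> min (\<alpha> + \<beta> + 2) 1 / fact k"
proof (cases k)
  case 0
  then show ?thesis by (simp add: jac_lead_def)
next
  case (Suc m)
  have "min (\<alpha> + \<beta> + 2) 1 \<le> min (real k + \<alpha> + \<beta> + 1) 1" using Suc by simp
  also have "\<dots> \<le> pochhammer (real k + \<alpha> + \<beta> + 1) k"
    using \<alpha> \<beta> Suc by (intro pochhammer_ge_min) simp
  finally show ?thesis unfolding jac_lead_def by (intro divide_right_mono) auto
qed

lemma jac_lead_pos: "jac_lead k > 0"
  by (rule less_le_trans[OF _ jac_lead_ge]) (use \<alpha> \<beta> in auto)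

lemma coeff_jac_poly: "coeff (jac_poly \<alpha> \<beta> k) k = jac_lead k"
proof -
  have z: "coeff ([:1, -1:] ^ j) k = (0::real)" if "j < k" for j
    by (rule coeff_eq_0) (use that in \<open>auto intro: le_less_trans[OF degree_power_le]\<close>)
  have "coeff ([:1, -1::real:] ^ k) k = (-1) ^ k"
    using lead_coeff_power[of "[:1, -1::real:]" k] degree_power_eq[of "[:1, -1::real:]" k] by simp
  then have "coeff (jac_poly \<alpha> \<beta> k) k = jac_coeff \<alpha> \<beta> k k * (-1) ^ k"
    by (simp add: jac_poly_def coeff_sum lessThan_Suc_atMost[symmetric] z)
  also have "\<dots> = jac_lead k"
  proof -
    have "pochhammer (\<alpha> + 1) k > 0" using \<alpha> by (intro pochhammer_pos) simp
    moreover have "(-1) ^ k * (-1) ^ k = (1::real)" by (simp flip: power_mult_distrib)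
    ultimately show ?thesis
      by (simp add: jac_coeff_def jac_lead_def pochhammer_same mult_ac)
  qed
  finally show ?thesis .
qed

lemma degree_jac_poly: "degree (jac_poly \<alpha> \<beta> k) = k"
  using degree_jac_poly_le[of \<alpha> \<beta> k] le_degree[of "jac_poly \<alpha> \<beta> k" k] coeff_jac_poly[of k] jac_lead_pos[of k]
  by auto

lemma integral_monomials:
  "(LINT x|unit_lborel. x ^ m * (1 - x) ^ j * w x) = Beta (\<beta> + 1 + real m) (\<alpha> + 1 + real j)"
  "integrable unit_lborel (\<lambda>x. x ^ m * (1 - x) ^ j * w x)"
proof -
  have eq: "x ^ m * (1 - x) ^ j * w x = x powr (\<beta> + real m) * (1 - x) powr (\<alpha> + real j)"
    if "x \<in> space unit_lborel" for x
    using that by (simp add: powr_add powr_realpow)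
  have ab: "\<beta> + real m > -1" "\<alpha> + real j > -1" using \<alpha> \<beta> by auto
  show "(LINT x|unit_lborel. x ^ m * (1 - x) ^ j * w x) = Beta (\<beta> + 1 + real m) (\<alpha> + 1 + real j)"
    using integral_unit_Beta(1)[OF ab] by (subst Bochner_Integration.integral_cong[OF refl eq]) (simp_all add: algebra_simps)
  show "integrable unit_lborel (\<lambda>x. x ^ m * (1 - x) ^ j * w x)"
    using integral_unit_Beta(2)[OF ab] by (subst Bochner_Integration.integrable_cong[OF refl eq]) simp_all
qed

lemma integrable_poly_weight: "integrable unit_lborel (\<lambda>x. poly q x * w x)"
proof -
  have "integrable unit_lborel (\<lambda>x. \<Sum>i\<le>degree q. coeff q i * (x ^ i * w x))"
    using integral_monomials(2)[of _ 0] by (intro Bochner_Integration.integrable_sum integrable_mult_right) simp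
  then show ?thesis by (simp add: poly_altdef sum_distrib_right mult.assoc)
qed

text \<open>Expanding in powers of \<open>1 - x\<close> turns the moment into a terminating
  hypergeometric sum, which the Chu-Vandermonde identity evaluates. Orthogonality is then visible in
  closed form: for \<open>m < k\<close> the Pochhammer symbol starting at \<open>1 + m - k\<close>
  runs through zero.\<close>

lemma integral_power_Jac:
  "(LINT x|unit_lborel. x ^ m * Jac \<alpha> \<beta> k x * w x) =
    pochhammer (\<alpha> + 1) k / fact k * Beta (\<beta> + 1 + real m) (\<alpha> + 1) *
      (pochhammer (1 + real m - real k) k / pochhammer (\<alpha> + \<beta> + 2 + real m) k)"
proof -
  have pos: "pochhammer (\<alpha> + 1) j > 0" for j using \<alpha> by (intro pochhammer_pos) simp
  have "(LINT x|unit_lborel. x ^ m * Jac \<alpha> \<beta> k x * w x) =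
      (LINT x|unit_lborel. (\<Sum>j\<le>k. jac_coeff \<alpha> \<beta> k j * (x ^ m * (1 - x) ^ j * w x)))"
    by (simp add: Jac_eq_sum sum_distrib_left sum_distrib_right mult_ac)
  also have "\<dots> = (\<Sum>j\<le>k. jac_coeff \<alpha> \<beta> k j * Beta (\<beta> + 1 + real m) (\<alpha> + 1 + real j))"
    using integral_monomials by (subst Bochner_Integration.integral_sum) auto
  also have "\<dots> = (\<Sum>j\<le>k. pochhammer (\<alpha> + 1) k / fact k * Beta (\<beta> + 1 + real m) (\<alpha> + 1) *
      (pochhammer (real k + \<alpha> + \<beta> + 1) j * pochhammer (- real k) j /
        (fact j * pochhammer (\<alpha> + \<beta> + 2 + real m) j)))"
  proof (rule sum.cong[OF refl])
    fix j
    have "Beta (\<beta> + 1 + real m) (\<alpha> + 1 + real j) =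
       Beta (\<beta> + 1 + real m) (\<alpha> + 1) * pochhammer (\<alpha> + 1) j / pochhammer (\<beta> + 1 + real m + (\<alpha> + 1)) j"
      using \<alpha> \<beta> by (intro Beta_add_right) auto
    moreover have "\<beta> + 1 + real m + (\<alpha> + 1) = \<alpha> + \<beta> + 2 + real m" by simp
    ultimately show "jac_coeff \<alpha> \<beta> k j * Beta (\<beta> + 1 + real m) (\<alpha> + 1 + real j) =
      pochhammer (\<alpha> + 1) k / fact k * Beta (\<beta> + 1 + real m) (\<alpha> + 1) *
      (pochhammer (real k + \<alpha> + \<beta> + 1) j * pochhammer (- real k) j /
        (fact j * pochhammer (\<alpha> + \<beta> + 2 + real m) j))"
      using pos[of j] by (simp add: jac_coeff_def mult_ac)
  qed
  also have "\<dots> = pochhammer (\<alpha> + 1) k / fact k * Beta (\<beta> + 1 + real m) (\<alpha> + 1) *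
      (\<Sum>j=0..k. pochhammer (real k + \<alpha> + \<beta> + 1) j * pochhammer (- real k) j /
        (fact j * pochhammer (\<alpha> + \<beta> + 2 + real m) j))"
    by (simp add: sum_distrib_left atMost_atLeast0)
  also have "(\<Sum>j=0..k. pochhammer (real k + \<alpha> + \<beta> + 1) j * pochhammer (- real k) j /
        (fact j * pochhammer (\<alpha> + \<beta> + 2 + real m) j)) =
      pochhammer (\<alpha> + \<beta> + 2 + real m - (real k + \<alpha> + \<beta> + 1)) k / pochhammer (\<alpha> + \<beta> + 2 + real m) k"
    using Vandermonde_pochhammer[of k "\<alpha> + \<beta> + 2 + real m" "real k + \<alpha> + \<beta> + 1"] \<alpha> \<beta> by force
  also have "\<alpha> + \<beta> + 2 + real m - (real k + \<alpha> + \<beta> + 1) = 1 + real m - real k" by simp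
  finally show ?thesis .
qed

lemma integral_power_Jac_less:
  assumes "m < k"
  shows "(LINT x|unit_lborel. x ^ m * Jac \<alpha> \<beta> k x * w x) = 0"
proof -
  have "pochhammer (1 + real m - real k) k = 0"
    unfolding pochhammer_eq_0_iff using assms by (intro exI[of _ "k - Suc m"]) (simp add: of_nat_diff)
  then show ?thesis by (simp add: integral_power_Jac)
qed

lemma integral_power_Jac_same:
  "(LINT x|unit_lborel. x ^ k * Jac \<alpha> \<beta> k x * w x) = jac_norm2 k / jac_lead k"
  using jac_lead_pos[of k] unfolding integral_power_Jac jac_norm2_def
  by (simp add: pochhammer_fact[symmetric])

text \<open>All powers below \<open>k\<close> integrate to zero, so only the coefficient of
  \<open>x ^ k\<close> survives. With \<open>q\<close> a Jacobi polynomial this gives orthogonality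
  and the norm at once.\<close>

lemma integral_poly_Jac:
  assumes "degree q \<le> k"
  shows "(LINT x|unit_lborel. poly q x * Jac \<alpha> \<beta> k x * w x) = coeff q k * (jac_norm2 k / jac_lead k)"
proof -
  have q: "poly q x = (\<Sum>i\<le>k. coeff q i * x ^ i)" for x
    unfolding poly_altdef using assms
    by (intro sum.mono_neutral_left) (auto simp: coeff_eq_0)
  have "(LINT x|unit_lborel. poly q x * Jac \<alpha> \<beta> k x * w x) =
     (LINT x|unit_lborel. (\<Sum>i\<le>k. coeff q i * (x ^ i * Jac \<alpha> \<beta> k x * w x)))"
    by (simp add: q sum_distrib_left sum_distrib_right mult_ac)
  also have "\<dots> = (\<Sum>i\<le>k. coeff q i * (LINT x|unit_lborel. x ^ i * Jac \<alpha> \<beta> k x * w x))"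
  proof (subst Bochner_Integration.integral_sum)
    fix i
    have "integrable unit_lborel (\<lambda>x. x ^ i * Jac \<alpha> \<beta> k x * w x)"
      using integrable_poly_weight[of "[:0, 1:] ^ i * jac_poly \<alpha> \<beta> k"] by (simp add: poly_jac_poly)
    then show "integrable unit_lborel (\<lambda>x. coeff q i * (x ^ i * Jac \<alpha> \<beta> k x * w x))" by simp
  qed simp
  also have "\<dots> = (\<Sum>i<Suc k. coeff q i * (LINT x|unit_lborel. x ^ i * Jac \<alpha> \<beta> k x * w x))"
    by (simp add: lessThan_Suc_atMost)
  also have "\<dots> = coeff q k * (jac_norm2 k / jac_lead k)"
    by (simp add: integral_power_Jac_less integral_power_Jac_same)
  finally show ?thesis .
qed

lemma integral_Jac_Jac:
  "(LINT x|unit_lborel. Jac \<alpha> \<beta> i x * Jac \<alpha> \<beta> k x * w x) = (if i = k then jac_norm2 k else 0)"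
proof (induction i k rule: linorder_wlog)
  case (le i k)
  show ?case
    using integral_poly_Jac[of "jac_poly \<alpha> \<beta> i" k] le jac_lead_pos[of k]
    by (auto simp: poly_jac_poly degree_jac_poly coeff_jac_poly coeff_eq_0)
next
  case (sym i k)
  then show ?case by (simp add: mult_ac)
qed

section \<open>Crude growth bounds for Jacobi polynomials and their norms\<close>

definition jac_size :: "nat \<Rightarrow> real" where
  "jac_size k = 2 * real k + \<bar>\<alpha>\<bar> + \<bar>\<beta>\<bar> + 3"

lemma jac_size_ge: "jac_size k \<ge> 1"
  by (simp add: jac_size_def)

text \<open>The numerator has three Pochhammer symbols of length at most \<open>k\<close>, and
  \<open>jac_size k\<close> dominates each of their factors; hence the exponent
  \<open>3 * k\<close>. The denominators are kept away from zero by \<open>pochhammer_ge_min\<close>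
  and \<open>fact_ge_1\<close>.\<close>

lemma jac_coeff_bound:
  assumes "j \<le> k"
  shows "\<bar>jac_coeff \<alpha> \<beta> k j\<bar> \<le> jac_size k ^ (3 * k) / min (\<alpha> + 1) 1"
proof -
  let ?X = "jac_size k"
  have 1: "\<bar>pochhammer (\<alpha> + 1) k\<bar> \<le> ?X ^ k" "\<bar>pochhammer (- real k) j\<bar> \<le> ?X ^ k"
    "\<bar>pochhammer (real k + \<alpha> + \<beta> + 1) j\<bar> \<le> ?X ^ k"
    using assms jac_size_ge[of k] by (auto intro!: abs_pochhammer_le simp: jac_size_def)
  have 2: "min (\<alpha> + 1) 1 * 1 \<le> pochhammer (\<alpha> + 1) j * fact j"
    using \<alpha> by (intro mult_mono pochhammer_ge_min fact_ge_1 less_imp_le[OF pochhammer_pos]) auto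
  have "\<bar>pochhammer (\<alpha> + 1) k / fact k\<bar> \<le> ?X ^ k / 1"
    unfolding abs_divide using 1(1) by (intro frac_le) (auto simp: fact_ge_1)
  moreover have "\<bar>pochhammer (- real k) j * pochhammer (real k + \<alpha> + \<beta> + 1) j /
       (pochhammer (\<alpha> + 1) j * fact j)\<bar> \<le> (?X ^ k * ?X ^ k) / min (\<alpha> + 1) 1"
    unfolding abs_divide abs_mult[of "pochhammer (- real k) j"]
    using 1(2,3) 2 \<alpha> by (intro frac_le mult_mono) auto
  ultimately have "\<bar>jac_coeff \<alpha> \<beta> k j\<bar> \<le> (?X ^ k / 1) * ((?X ^ k * ?X ^ k) / min (\<alpha> + 1) 1)"
    unfolding jac_coeff_def abs_mult[of "_ / fact k"]
    using jac_size_ge[of k] by (intro mult_mono) auto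
  also have "\<dots> = ?X ^ (3 * k) / min (\<alpha> + 1) 1"
    by (simp add: power_mult power3_eq_cube power_mult_distrib mult.commute[of 3])
  finally show ?thesis .
qed

text \<open>The extra power of \<open>jac_size k\<close> pays for the number \<open>k + 1\<close> of
  terms.\<close>

lemma Jac_bound:
  assumes "x \<in> {0<..<1}"
  shows "\<bar>Jac \<alpha> \<beta> k x\<bar> \<le> jac_size k ^ (3 * k + 1) / min (\<alpha> + 1) 1"
proof -
  have "\<bar>Jac \<alpha> \<beta> k x\<bar> \<le> (\<Sum>j\<le>k. \<bar>jac_coeff \<alpha> \<beta> k j * (1 - x) ^ j\<bar>)"
    unfolding Jac_eq_sum by (rule sum_abs)
  also have "\<dots> \<le> (\<Sum>j\<le>k. jac_size k ^ (3 * k) / min (\<alpha> + 1) 1)"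
  proof (rule sum_mono)
    fix j assume "j \<in> {..k}"
    then have "\<bar>jac_coeff \<alpha> \<beta> k j\<bar> * \<bar>(1 - x) ^ j\<bar> \<le> jac_size k ^ (3 * k) / min (\<alpha> + 1) 1 * 1"
      using assms \<alpha> jac_size_ge[of k] by (intro mult_mono jac_coeff_bound) (auto simp: power_abs power_le_one)
    then show "\<bar>jac_coeff \<alpha> \<beta> k j * (1 - x) ^ j\<bar> \<le> jac_size k ^ (3 * k) / min (\<alpha> + 1) 1"
      by (simp add: abs_mult)
  qed
  also have "\<dots> = (real k + 1) * (jac_size k ^ (3 * k) / min (\<alpha> + 1) 1)" by simp
  also have "\<dots> \<le> jac_size k * (jac_size k ^ (3 * k) / min (\<alpha> + 1) 1)"
    using \<alpha> jac_size_ge[of k] by (intro mult_right_mono) (auto simp: jac_size_def)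
  finally show ?thesis by simp
qed

definition jac_norm_const :: real where
  "jac_norm_const = min (\<alpha> + \<beta> + 2) 1 * min (\<alpha> + 1) 1 * min (\<beta> + 1) 1 * Beta (\<alpha> + 1) (\<beta> + 1)"

lemma jac_norm_const_pos: "jac_norm_const > 0"
  using \<alpha> \<beta> by (auto simp: jac_norm_const_def intro!: mult_pos_pos Beta_real_pos)

text \<open>The three powers of \<open>jac_size k\<close> pay for \<open>fact k\<close> in
  \<open>jac_lead\<close>, for the denominator of the Beta value and for the denominator of the
  moment. The Pochhammer symbols in the numerators are bounded below by constants, which together
  with a Beta value make up \<open>jac_norm_const\<close>.\<close>

lemma jac_norm2_ge: "jac_norm2 k \<ge> jac_norm_const / jac_size k ^ (3 * k)"
proof -
  let ?X = "jac_size k"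
  have "fact k = \<bar>pochhammer (1::real) k\<bar>" by (simp add: pochhammer_fact[symmetric])
  also have "\<dots> \<le> ?X ^ k" using jac_size_ge[of k] by (intro abs_pochhammer_le) (auto simp: jac_size_def)
  finally have f: "fact k \<le> ?X ^ k" .
  have X: "?X ^ k > 0" using jac_size_ge[of k] by auto
  have "\<bar>pochhammer (\<alpha> + \<beta> + 2) k\<bar> \<le> ?X ^ k" "\<bar>pochhammer (\<alpha> + \<beta> + 2 + real k) k\<bar> \<le> ?X ^ k"
    using jac_size_ge[of k] by (auto intro!: abs_pochhammer_le simp: jac_size_def)
  moreover have pos: "pochhammer (\<alpha> + \<beta> + 2) k > 0" "pochhammer (\<alpha> + \<beta> + 2 + real k) k > 0"
      "pochhammer (\<alpha> + 1) k > 0" "pochhammer (\<beta> + 1) k > 0"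
    using \<alpha> \<beta> by (auto intro!: pochhammer_pos)
  ultimately have p: "pochhammer (\<alpha> + \<beta> + 2) k \<le> ?X ^ k" "pochhammer (\<alpha> + \<beta> + 2 + real k) k \<le> ?X ^ k"
    by auto
  have B: "Beta (\<beta> + 1 + real k) (\<alpha> + 1) =
      Beta (\<alpha> + 1) (\<beta> + 1) * pochhammer (\<beta> + 1) k / pochhammer (\<alpha> + \<beta> + 2) k"
    using Beta_add_right[of "\<alpha> + 1" "\<beta> + 1" k] \<alpha> \<beta> by (subst Beta_commute) (simp add: algebra_simps)
  have Bpos: "Beta (\<alpha> + 1) (\<beta> + 1) > 0" using \<alpha> \<beta> by (intro Beta_real_pos) auto
  have Bge: "Beta (\<beta> + 1 + real k) (\<alpha> + 1) \<ge> Beta (\<alpha> + 1) (\<beta> + 1) * min (\<beta> + 1) 1 / ?X ^ k"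
    unfolding B using Bpos pos p \<beta> by (intro frac_le mult_left_mono pochhammer_ge_min) auto
  have L: "jac_lead k \<ge> min (\<alpha> + \<beta> + 2) 1 / ?X ^ k"
    using f \<alpha> \<beta> X by (intro order_trans[OF _ jac_lead_ge] divide_left_mono) auto
  let ?D = "pochhammer (\<alpha> + 1) k * Beta (\<beta> + 1 + real k) (\<alpha> + 1)"
  have D: "min (\<alpha> + 1) 1 * (Beta (\<alpha> + 1) (\<beta> + 1) * min (\<beta> + 1) 1 / ?X ^ k) \<le> ?D"
    using \<alpha> \<beta> pos Bpos X by (intro mult_mono pochhammer_ge_min Bge) auto
  have D0: "0 \<le> ?D"
    using pos Beta_real_pos[of "\<beta> + 1 + real k" "\<alpha> + 1"] \<alpha> \<beta> by simp
  have "min (\<alpha> + 1) 1 * (Beta (\<alpha> + 1) (\<beta> + 1) * min (\<beta> + 1) 1 / ?X ^ k) / ?X ^ k \<le>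
      ?D / pochhammer (\<alpha> + \<beta> + 2 + real k) k"
    by (rule frac_le[OF D0 D pos(2) p(2)])
  then have "min (\<alpha> + \<beta> + 2) 1 / ?X ^ k * (min (\<alpha> + 1) 1 * (Beta (\<alpha> + 1) (\<beta> + 1) * min (\<beta> + 1) 1 / ?X ^ k) / ?X ^ k)
      \<le> jac_norm2 k"
    unfolding jac_norm2_def using \<alpha> \<beta> Bpos X less_imp_le[OF jac_lead_pos]
    by (intro mult_mono L) auto
  moreover have "?X ^ (3 * k) = ?X ^ k * ?X ^ k * ?X ^ k"
    by (simp add: power_add[symmetric] mult_2[symmetric])
  ultimately show ?thesis by (simp add: jac_norm_const_def mult_ac)
qed

lemma jac_norm2_pos: "jac_norm2 k > 0"
  using jac_norm_const_pos jac_size_ge[of k]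
  by (intro less_le_trans[OF divide_pos_pos jac_norm2_ge]) auto

definition jac_bound :: "nat \<Rightarrow> real" where
  "jac_bound k = jac_size k ^ (3 * k + 1) / min (\<alpha> + 1) 1 / sqrt (jac_norm2 k)"

lemma jac_bound_nonneg: "jac_bound k \<ge> 0"
  using \<alpha> jac_size_ge[of k] jac_norm2_pos[of k] unfolding jac_bound_def by (intro divide_nonneg_nonneg) auto

text \<open>The square of \<open>jac_bound k\<close> is at most a constant times
  \<open>jac_size k ^ (9 * k + 2)\<close>: twice \<open>3 * k + 1\<close> from the polynomial and
  \<open>3 * k\<close> from the norm. This is the exponential of a quantity of order
  \<open>k log k\<close>, whereas the eigenvalue grows like the square of \<open>k\<close>.\<close>

lemma summable_jac_bound:
  assumes \<tau>: "\<tau> > 0"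
  shows "summable (\<lambda>k. exp (- \<tau> * (real k * (real k + \<alpha> + \<beta> + 1))) * (jac_bound k)\<^sup>2)"
proof -
  define s where "s = \<alpha> + \<beta> + 1"
  define b where "b = \<bar>\<alpha>\<bar> + \<bar>\<beta>\<bar> + 3"
  define C where "C = 1 / (min (\<alpha> + 1) 1)\<^sup>2 / jac_norm_const"
  have b: "b > 0" by (simp add: b_def)
  have le: "norm (exp (- \<tau> * (real k * (real k + \<alpha> + \<beta> + 1))) * (jac_bound k)\<^sup>2) \<le>
      C * (exp (- \<tau> * (real k * (real k + s))) * (2 * real k + b) powr (9 * real k + 2))" for k
  proof -
    let ?X = "jac_size k"
    have X: "?X > 0" using jac_size_ge[of k] by simp
    have "(jac_bound k)\<^sup>2 = ?X ^ (6 * k + 2) / (min (\<alpha> + 1) 1)\<^sup>2 / jac_norm2 k"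
    proof -
      have "(?X ^ (3 * k + 1))\<^sup>2 = ?X ^ (6 * k + 2)"
        unfolding power_mult[symmetric] by (rule arg_cong[of _ _ "(^) ?X"]) simp
      then show ?thesis
        unfolding jac_bound_def power_divide
        using jac_norm2_pos[of k] by (simp only: real_sqrt_pow2[OF less_imp_le])
    qed
    also have "\<dots> \<le> ?X ^ (6 * k + 2) / (min (\<alpha> + 1) 1)\<^sup>2 / (jac_norm_const / ?X ^ (3 * k))"
      using X jac_norm_const_pos jac_norm2_ge[of k] \<alpha> by (intro divide_left_mono) (auto intro!: divide_nonneg_nonneg mult_pos_pos jac_norm2_pos divide_pos_pos)
    also have "\<dots> = C * ?X ^ (9 * k + 2)"
      by (simp add: C_def power_add[symmetric] )
    also have "?X ^ (9 * k + 2) = ?X powr (9 * real k + 2)"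
      using X powr_realpow[of ?X "9 * k + 2"] by (simp add: add.commute)
    also have "?X = 2 * real k + b" by (simp add: jac_size_def b_def)
    finally have "exp (- \<tau> * (real k * (real k + s))) * (jac_bound k)\<^sup>2 \<le>
        exp (- \<tau> * (real k * (real k + s))) * (C * (2 * real k + b) powr (9 * real k + 2))"
      by (intro mult_left_mono) auto
    then show ?thesis by (simp add: s_def mult_ac add_ac)
  qed
  have "(\<lambda>k. exp (- \<tau> * (real k * (real k + s))) * (2 * real k + b) powr (9 * real k + 2)) \<in>
      O(\<lambda>k. 1 / real k ^ 2)"
    using \<tau> b by real_asymp
  moreover have "summable (\<lambda>k. norm (1 / real k ^ 2))"
    using inverse_power_summable[of 2, where ?'a = real] by (simp add: field_simps)
  ultimately have "summable (\<lambda>k. exp (- \<tau> * (real k * (real k + s))) * (2 * real k + b) powr (9 * real k + 2))"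
    by (rule summable_comparison_test_bigo[rotated])
  then have "summable (\<lambda>k. C * (exp (- \<tau> * (real k * (real k + s))) * (2 * real k + b) powr (9 * real k + 2)))"
    by (rule summable_mult)
  then show ?thesis
    by (rule summable_comparison_test'[where N = 0]) (use le in auto)
qed

end

section \<open>Determinants of polynomials\<close>

lemma pdet_identical_columns:
  fixes i j n :: nat
  assumes "i < n" "j < n" "i \<noteq> j" "\<And>k. k < n \<Longrightarrow> A k i = A k j"
  shows "pdet {..<n} A = 0"
  unfolding det_eq_pdet[symmetric]
  by (rule det_identical_columns[of _ n i j]) (use assms in \<open>auto simp: col_def\<close>)

text \<open>A Vandermonde determinant for an arbitrary basis of polynomials of increasing degree. As
  a function of the last point, the determinant is a polynomial of degree at most \<open>n\<close>
  that vanishes at the other \<open>n\<close> points, hence a multiple of \<open>v\<close>. Its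
  coefficient at \<open>n\<close> is the smaller determinant times
  \<open>lead_coeff (q n)\<close>.\<close>

lemma pdet_poly:
  fixes q :: "nat \<Rightarrow> real poly"
  assumes deg: "\<And>k. degree (q k) = k" and inj: "inj_on x {..<n}"
  shows "pdet {..<n} (\<lambda>i j. poly (q i) (x j)) =
    (\<Prod>i<n. lead_coeff (q i)) * (\<Prod>j<n. \<Prod>i<j. x j - x i)"
  using inj
proof (induction n)
  case 0
  then show ?case by (simp add: pdet_def)
next
  case (Suc n)
  define A where "A y = mat (Suc n) (Suc n) (\<lambda>(i, j). poly (q i) (if j = n then y else x j))" for y
  define c where "c i = cofactor (A 0) i n" for i
  have cof: "cofactor (A y) i n = c i" if "i < Suc n" for y i
    unfolding c_def cofactor_def
    by (rule arg_cong[of _ _ "\<lambda>M. _ * det M"], rule eq_matI)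
      (use that in \<open>auto simp: mat_delete_def A_def\<close>)
  define r where "r = (\<Sum>i<Suc n. Polynomial.smult (c i) (q i))"
  have r: "poly r y = det (A y)" for y
  proof -
    have "det (A y) = (\<Sum>i<Suc n. A y $$ (i, n) * cofactor (A y) i n)"
      by (rule laplace_expansion_column) (auto simp: A_def)
    also have "\<dots> = poly r y"
      unfolding r_def poly_sum by (rule sum.cong) (use cof in \<open>auto simp: A_def\<close>)
    finally show ?thesis ..
  qed
  have deg_r: "degree r \<le> n"
    unfolding r_def by (rule degree_sum_le) (auto intro: order_trans[OF degree_smult_le] simp: deg)
  have "mat_delete (A 0) n n = mat n n (\<lambda>(i, j). poly (q i) (x j))"
    by (rule eq_matI) (auto simp: mat_delete_def A_def)
  then have "c n = (\<Prod>i<n. lead_coeff (q i)) * (\<Prod>j<n. \<Prod>i<j. x j - x i)"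
    using Suc by (simp add: c_def cofactor_def det_eq_pdet inj_on_subset[OF Suc.prems] lessThan_Suc)
  moreover have "coeff r n = c n * lead_coeff (q n)"
    unfolding r_def by (simp add: coeff_sum coeff_eq_0 deg)
  ultimately have lead: "coeff r n = (\<Prod>i<Suc n. lead_coeff (q i)) * (\<Prod>j<n. \<Prod>i<j. x j - x i)"
    by simp
  define v where "v = (\<Prod>l<n. [:- x l, 1:])"
  have deg_v: "degree v = n" unfolding v_def by (subst degree_prod_eq_sum_degree) auto
  have lead_v: "coeff v n = 1"
    using lead_coeff_prod[of "\<lambda>l. [:- x l, 1:]" "{..<n}"] deg_v by (simp add: v_def)
  define d where "d = r - Polynomial.smult (coeff r n) v"
  \<comment> \<open>Subtracting the multiple of \<open>v\<close> cancels the coefficient at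
    \<open>n\<close>, which leaves a polynomial of degree below \<open>n\<close> with
    \<open>n\<close> distinct roots.\<close>
  have "d = 0"
  proof (rule ccontr)
    assume d: "d \<noteq> 0"
    have "degree d \<le> n" unfolding d_def
      by (rule degree_diff_le[OF deg_r order_trans[OF degree_smult_le]]) (simp add: deg_v)
    moreover have "coeff d n = 0" by (simp add: d_def lead_v)
    ultimately have "degree d < n"
      using d by (metis leading_coeff_0_iff order_le_less)
    moreover have "x ` {..<n} \<subseteq> {y. poly d y = 0}"
    proof clarify
      fix l assume l: "l < n"
      have "det (A (x l)) = 0"
        unfolding A_def det_eq_pdet by (rule pdet_identical_columns[of l _ n]) (use l in auto)
      moreover have "poly v (x l) = 0" using l by (auto simp: v_def poly_prod)
      ultimately show "poly d (x l) = 0" by (simp add: d_def r)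
    qed
    moreover have "card (x ` {..<n}) = n"
      using Suc.prems by (subst card_image) (auto simp: lessThan_Suc)
    ultimately have "n \<le> card {y. poly d y = 0}" "card {y. poly d y = 0} < n"
      using card_mono[OF poly_roots_finite[OF d], of "x ` {..<n}"] card_poly_roots_bound[OF d] by auto
    then show False by simp
  qed
  have "pdet {..<Suc n} (\<lambda>i j. poly (q i) (x j)) = det (A (x n))"
    unfolding det_eq_pdet[symmetric] A_def by (rule arg_cong[of _ _ det], rule eq_matI) auto
  also have "\<dots> = coeff r n * poly v (x n)"
    using \<open>d = 0\<close> unfolding r[symmetric] d_def by (metis eq_iff_diff_eq_0 poly_smult)
  also have "poly v (x n) = (\<Prod>i<n. x n - x i)" by (simp add: v_def poly_prod)
  finally show ?case by (simp add: lead)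
qed

section \<open>Product measures\<close>

lemma PiM_restrict_space:
  assumes I: "finite I" and S: "\<And>i. i \<in> I \<Longrightarrow> S i \<in> sets (M i)"
    and sfM: "product_sigma_finite M"
    and sf: "product_sigma_finite (\<lambda>i. restrict_space (M i) (S i))"
  shows "PiM I (\<lambda>i. restrict_space (M i) (S i)) = restrict_space (PiM I M) (\<Pi>\<^sub>E i\<in>I. S i)"
proof -
  let ?R = "\<lambda>i. restrict_space (M i) (S i)"
  let ?\<Omega> = "\<Pi>\<^sub>E i\<in>I. S i"
  interpret M: product_sigma_finite M by (rule sfM)
  interpret R: product_sigma_finite ?R by (rule sf)
  have sp: "space (?R i) = S i" if "i \<in> I" for i
    using sets.sets_into_space[OF S[OF that]] by (auto simp: space_restrict_space)
  have \<Omega>: "?\<Omega> \<in> sets (PiM I M)" using S I by (intro sets_PiM_I_finite) auto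
  have sets_eq: "sets (restrict_space (PiM I M) ?\<Omega>) = sets (PiM I ?R)"
  proof (intro equalityI subsetI)
    fix A assume A: "A \<in> sets (PiM I ?R)"
    have "(\<lambda>x. x) \<in> measurable (restrict_space (PiM I M) ?\<Omega>) (PiM I ?R)"
    proof (rule measurable_PiM_single')
      fix i assume i: "i \<in> I"
      show "(\<lambda>x. x i) \<in> measurable (restrict_space (PiM I M) ?\<Omega>) (?R i)"
        by (rule measurable_restrict_space2)
          (use i in \<open>auto simp: space_restrict_space intro!: measurable_restrict_space1\<close>)
    next
      show "(\<lambda>\<omega>. \<omega>) \<in> space (restrict_space (PiM I M) ?\<Omega>) \<rightarrow> (\<Pi>\<^sub>E i\<in>I. space (?R i))"
        using sp by (auto simp: space_restrict_space PiE_iff)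
    qed
    from measurable_sets[OF this A]
    have "A \<inter> space (restrict_space (PiM I M) ?\<Omega>) \<in> sets (restrict_space (PiM I M) ?\<Omega>)" by simp
    moreover have "A \<subseteq> space (restrict_space (PiM I M) ?\<Omega>)"
    proof
      fix x assume "x \<in> A"
      then have "x \<in> (\<Pi>\<^sub>E i\<in>I. space (?R i))"
        using sets.sets_into_space[OF A] by (auto simp: space_PiM)
      then show "x \<in> space (restrict_space (PiM I M) ?\<Omega>)"
        by (auto simp: space_restrict_space space_PiM PiE_iff)
    qed
    ultimately show "A \<in> sets (restrict_space (PiM I M) ?\<Omega>)" by (simp add: Int_absorb2)
  next
    fix A assume "A \<in> sets (restrict_space (PiM I M) ?\<Omega>)"
    then obtain B where B: "B \<in> sets (PiM I M)" and A: "A = ?\<Omega> \<inter> B"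
      by (auto simp: sets_restrict_space)
    have "(\<lambda>x. x) \<in> measurable (PiM I ?R) (PiM I M)"
    proof (rule measurable_PiM_single')
      fix i assume i: "i \<in> I"
      show "(\<lambda>x. x i) \<in> measurable (PiM I ?R) (M i)"
        by (rule measurable_compose[OF measurable_component_singleton[OF i] measurable_restrict_space1])
          simp
    next
      show "(\<lambda>\<omega>. \<omega>) \<in> space (PiM I ?R) \<rightarrow> (\<Pi>\<^sub>E i\<in>I. space (M i))"
        by (auto simp: space_PiM space_restrict_space PiE_iff)
    qed
    from measurable_sets[OF this B] have "B \<inter> space (PiM I ?R) \<in> sets (PiM I ?R)" by simp
    moreover have "space (PiM I ?R) = ?\<Omega>" using sp by (auto simp: space_PiM intro!: PiE_cong)
    ultimately show "A \<in> sets (PiM I ?R)" by (simp add: A Int_commute)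
  qed
  show ?thesis
  proof (rule R.PiM_eqI[OF I sets_eq, symmetric])
    fix A assume A: "\<And>i. i \<in> I \<Longrightarrow> A i \<in> sets (?R i)"
    then have A': "A i \<in> sets (M i)" "A i \<subseteq> S i" if "i \<in> I" for i
      using that S[OF that] sets.sets_into_space[OF A[OF that]] sp[OF that] A[OF that]
      by (auto simp: sets_restrict_space_iff[of "S i" "M i"])
    have "emeasure (restrict_space (PiM I M) ?\<Omega>) (Pi\<^sub>E I A) = emeasure (PiM I M) (Pi\<^sub>E I A)"
      by (rule emeasure_restrict_space) (use \<Omega> A' in \<open>auto intro!: PiE_mono\<close>)
    also have "\<dots> = (\<Prod>i\<in>I. emeasure (M i) (A i))" using A' I by (intro M.emeasure_PiM) auto
    also have "\<dots> = (\<Prod>i\<in>I. emeasure (?R i) (A i))"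
      using A' S by (intro prod.cong refl emeasure_restrict_space[symmetric]) auto
    finally show "emeasure (restrict_space (PiM I M) ?\<Omega>) (Pi\<^sub>E I A) = (\<Prod>i\<in>I. emeasure (?R i) (A i))" .
  qed
qed

text \<open>The function \<open>h\<close> may be signed at first. Agreement on the generator extends
  to all measurable sets by a Dynkin argument; tested on the set where \<open>h\<close> is negative,
  it gives a measure equal to a nonpositive integral, so that set is null. In this way nonnegativity
  of the joint densities comes from their being laws.\<close>

lemma density_eqI_generator:
  fixes h :: "'a \<Rightarrow> real"
  assumes fin: "finite_measure \<mu>" and sets: "sets \<mu> = sets N" and h: "integrable N h"
    and G: "Int_stable G" "G \<subseteq> Pow (space N)" "sets N = sigma_sets (space N) G" "space N \<in> G"
    and eq: "\<And>A. A \<in> G \<Longrightarrow> measure \<mu> A = (LINT x|N. indicator A x * h x)"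
  shows "\<mu> = density N (\<lambda>x. ennreal (h x))" and "AE x in N. 0 \<le> h x"
proof -
  interpret \<mu>: finite_measure \<mu> by (rule fin)
  have [measurable]: "h \<in> borel_measurable N" using h by simp
  have spc: "space \<mu> = space N" using sets by (rule sets_eq_imp_space_eq)
  have ih: "integrable N (\<lambda>x. indicator A x * h x)" if "A \<in> sets N" for A
    using integrable_mult_indicator[OF that h] by simp
  have all: "measure \<mu> A = (LINT x|N. indicator A x * h x)" if "A \<in> sets N" for A
  proof -
    from that have "A \<in> sigma_sets (space N) G" by (simp add: G)
    with G(1,2) show ?thesis
    proof (induction rule: sigma_sets_induct_disjoint)
      case (basic A) then show ?case by (rule eq)
    next
      case empty then show ?case by simp
    next
      case (compl A)
      then have A: "A \<in> sets N" by (simp add: G)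
      have "measure \<mu> (space N - A) = measure \<mu> (space N) - measure \<mu> A"
        using \<mu>.finite_measure_compl[of A] A sets spc by simp
      also have "\<dots> = (LINT x|N. indicator (space N) x * h x - indicator A x * h x)"
        using compl eq[OF G(4)] ih A by simp
      also have "\<dots> = (LINT x|N. indicator (space N - A) x * h x)"
        by (rule Bochner_Integration.integral_cong) (auto simp: indicator_def)
      finally show ?case .
    next
      case (union A)
      then have A: "A i \<in> sets N" for i by (auto simp: G)
      then have U: "(\<Union>i. A i) \<in> sets N" by auto
      have "(\<lambda>i. measure \<mu> (A i)) sums measure \<mu> (\<Union>i. A i)"
        using A sets union by (intro \<mu>.finite_measure_UNION) auto
      then have "measure \<mu> (\<Union>i. A i) = (\<Sum>i. measure \<mu> (A i))" by (rule sums_unique)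
      also have "\<dots> = (\<Sum>i. LINT x:A i|N. h x)"
        using union by (simp add: set_lebesgue_integral_def)
      also have "\<dots> = (LINT x:(\<Union>i. A i)|N. h x)"
        using A union(1) ih[OF U]
        by (intro lebesgue_integral_countable_add[symmetric])
          (auto simp: disjoint_family_on_def set_integrable_def)
      finally show ?case by (simp add: set_lebesgue_integral_def)
    qed
  qed
  show ae: "AE x in N. 0 \<le> h x"
  proof -
    let ?A = "{x \<in> space N. h x < 0}"
    have A: "?A \<in> sets N" by measurable
    have "0 \<le> (LINT x|N. indicator ?A x * h x)" using all[OF A] measure_nonneg[of \<mu> ?A] by simp
    moreover have "0 \<le> (LINT x|N. - (indicator ?A x * h x))"
      by (rule integral_nonneg_AE) (auto simp: indicator_def)
    ultimately have "(LINT x|N. - (indicator ?A x * h x)) = 0" by simp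
    moreover have "integrable N (\<lambda>x. - (indicator ?A x * h x))" using ih[OF A] by simp
    moreover have "AE x in N. 0 \<le> - (indicator ?A x * h x)" by (auto simp: indicator_def)
    ultimately have "AE x in N. - (indicator ?A x * h x) = 0"
      using integral_nonneg_eq_0_iff_AE by blast
    then show ?thesis by (rule AE_mp) (auto simp: indicator_def)
  qed
  show "\<mu> = density N (\<lambda>x. ennreal (h x))"
  proof (rule measure_eqI)
    show "sets \<mu> = sets (density N (\<lambda>x. ennreal (h x)))" by (simp add: sets)
    fix A assume "A \<in> sets \<mu>"
    then have A: "A \<in> sets N" by (simp add: sets)
    have "emeasure (density N (\<lambda>x. ennreal (h x))) A = (\<integral>\<^sup>+x. ennreal (indicator A x * h x) \<partial>N)"
      using A by (simp add: emeasure_density) (auto intro!: nn_integral_cong simp: indicator_def)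
    also have "\<dots> = ennreal (LINT x|N. indicator A x * h x)"
      using ae by (intro nn_integral_eq_integral ih A) (auto simp: indicator_def elim: AE_mp)
    also have "\<dots> = emeasure \<mu> A" by (simp add: all[OF A, symmetric] \<mu>.emeasure_eq_measure)
    finally show "emeasure \<mu> A = emeasure (density N (\<lambda>x. ennreal (h x))) A" ..
  qed
qed

section \<open>Series kernels of an orthonormal system\<close>

lemma borel_measurable_pdet:
  assumes "\<And>i j. i \<in> S \<Longrightarrow> j \<in> S \<Longrightarrow> (\<lambda>x. A x i j) \<in> borel_measurable M"
  shows "(\<lambda>x. pdet S (A x)) \<in> borel_measurable M"
  unfolding pdet_def
  by (intro borel_measurable_sum borel_measurable_times borel_measurable_const borel_measurable_prod assms)
    (auto simp: permutes_in_image)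

text \<open>Each product uses every row and every column exactly once, so the bound takes the same
  factored form for all permutations.\<close>

lemma abs_pdet_le:
  assumes fin: "finite S" and A: "\<And>i j. i \<in> S \<Longrightarrow> j \<in> S \<Longrightarrow> \<bar>A i j\<bar> \<le> c * (u i * v j)"
    and c: "c \<ge> 0"
  shows "\<bar>pdet S A\<bar> \<le> fact (card S) * c ^ card S * ((\<Prod>i\<in>S. u i) * (\<Prod>i\<in>S. v i))"
proof -
  let ?P = "{\<sigma>. \<sigma> permutes S}"
  have "\<bar>pdet S A\<bar> \<le> (\<Sum>\<sigma>\<in>?P. \<bar>of_int (sign \<sigma>) * (\<Prod>i\<in>S. A i (\<sigma> i))\<bar>)"
    unfolding pdet_def by (rule sum_abs)
  also have "\<dots> \<le> (\<Sum>\<sigma>\<in>?P. c ^ card S * ((\<Prod>i\<in>S. u i) * (\<Prod>i\<in>S. v i)))"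
  proof (rule sum_mono)
    fix \<sigma> assume "\<sigma> \<in> ?P"
    then have \<sigma>: "\<sigma> permutes S" by simp
    have "\<bar>of_int (sign \<sigma>) * (\<Prod>i\<in>S. A i (\<sigma> i))\<bar> = (\<Prod>i\<in>S. \<bar>A i (\<sigma> i)\<bar>)"
      by (simp add: abs_mult abs_prod flip: of_int_abs)
    also have "\<dots> \<le> (\<Prod>i\<in>S. c * (u i * v (\<sigma> i)))"
      using A permutes_in_image[OF \<sigma>] by (intro prod_mono) auto
    also have "\<dots> = c ^ card S * ((\<Prod>i\<in>S. u i) * (\<Prod>i\<in>S. v (\<sigma> i)))"
      by (simp add: prod.distrib)
    also have "(\<Prod>i\<in>S. v (\<sigma> i)) = (\<Prod>i\<in>S. v i)"
      using prod.permute[OF \<sigma>, of v] by (simp add: o_def)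
    finally show "\<bar>of_int (sign \<sigma>) * (\<Prod>i\<in>S. A i (\<sigma> i))\<bar> \<le>
        c ^ card S * ((\<Prod>i\<in>S. u i) * (\<Prod>i\<in>S. v i))" .
  qed
  also have "\<dots> = fact (card S) * c ^ card S * ((\<Prod>i\<in>S. u i) * (\<Prod>i\<in>S. v i))"
    by (simp add: card_permutations[OF refl fin])
  finally show ?thesis .
qed

lemma abs_mult_le: "\<bar>a\<bar> \<le> c \<Longrightarrow> \<bar>b\<bar> \<le> d \<Longrightarrow> \<bar>a * b\<bar> \<le> c * (d::real)"
  by (simp add: abs_mult mult_mono')

lemma unit_measurable_id: "(\<lambda>x. x) \<in> measurable unit_lborel borel"
  by (rule measurable_unit_lborelI) simp

abbreviation cube_lborel :: "nat \<Rightarrow> (nat \<Rightarrow> real) measure" where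
  "cube_lborel n \<equiv> PiM {..<n} (\<lambda>_. unit_lborel)"

lemma cube_component: "i < n \<Longrightarrow> (\<lambda>x. x i) \<in> borel_measurable (cube_lborel n)"
  by (rule measurable_compose[OF measurable_component_singleton[of i _ "\<lambda>_. unit_lborel"] unit_measurable_id])
    simp

text \<open>The weight may blow up at the endpoints, so the functions \<open>\<phi> k\<close> need
  not be bounded. Splitting their bound into a number \<open>B k\<close> and one square-integrable
  function \<open>g\<close> reduces convergence of the series to summability of numbers, and
  integrability of the products to that of the square of \<open>g\<close>.\<close>

locale spectral_kernel =
  fixes p :: nat and \<phi> :: "nat \<Rightarrow> real \<Rightarrow> real" and B :: "nat \<Rightarrow> real" and g :: "real \<Rightarrow> real"
    and E :: "nat \<Rightarrow> real"
  assumes \<phi>_borel [measurable]: "\<And>k. \<phi> k \<in> borel_measurable borel"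
    and g_borel [measurable]: "g \<in> borel_measurable borel"
    and g_nonneg: "\<And>x. 0 \<le> g x"
    and g_int: "integrable unit_lborel (\<lambda>x. (g x)\<^sup>2)"
    and \<phi>_bound: "\<And>k x. x \<in> {0<..<1} \<Longrightarrow> \<bar>\<phi> k x\<bar> \<le> B k * g x"
    and B_nonneg: "\<And>k. 0 \<le> B k"
    and \<phi>_ortho: "\<And>i k. (LINT x|unit_lborel. \<phi> i x * \<phi> k x) = of_bool (i = k)"
    and exp_summable: "\<And>\<tau>. \<tau> > 0 \<Longrightarrow> summable (\<lambda>k. exp (- \<tau> * E k) * (B k)\<^sup>2)"
begin

lemma unit_measurable [measurable]:
  "\<phi> k \<in> borel_measurable unit_lborel" "g \<in> borel_measurable unit_lborel"
  by (auto intro: measurable_unit_lborelI)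

definition kser :: "(nat \<Rightarrow> real) \<Rightarrow> real \<Rightarrow> real \<Rightarrow> real" where
  "kser a x y = (\<Sum>k. a k * \<phi> k x * \<phi> k y)"

text \<open>The condition under which \<open>kser a\<close> converges absolutely at interior points
  and is dominated by a multiple of \<open>g x * g y\<close>; \<open>asum a\<close> is that
  multiple.\<close>

definition adm :: "(nat \<Rightarrow> real) \<Rightarrow> bool" where
  "adm a \<longleftrightarrow> summable (\<lambda>k. \<bar>a k\<bar> * (B k)\<^sup>2)"

definition asum :: "(nat \<Rightarrow> real) \<Rightarrow> real" where
  "asum a = (\<Sum>k. \<bar>a k\<bar> * (B k)\<^sup>2)"

lemma kser_term_bound:
  assumes "x \<in> {0<..<1}" "y \<in> {0<..<1}"
  shows "\<bar>a k * \<phi> k x * \<phi> k y\<bar> \<le> (\<bar>a k\<bar> * (B k)\<^sup>2) * (g x * g y)"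
proof -
  have "\<bar>\<phi> k x\<bar> * \<bar>\<phi> k y\<bar> \<le> (B k * g x) * (B k * g y)"
    using assms by (intro mult_mono' \<phi>_bound) auto
  then have "\<bar>a k\<bar> * (\<bar>\<phi> k x\<bar> * \<bar>\<phi> k y\<bar>) \<le> \<bar>a k\<bar> * ((B k * g x) * (B k * g y))"
    by (rule mult_left_mono) simp
  then show ?thesis by (simp add: abs_mult power2_eq_square mult_ac)
qed

lemma summable_kser:
  assumes "adm a" "x \<in> {0<..<1}" "y \<in> {0<..<1}"
  shows "summable (\<lambda>k. a k * \<phi> k x * \<phi> k y)" "summable (\<lambda>k. \<bar>a k * \<phi> k x * \<phi> k y\<bar>)"
proof -
  have s: "summable (\<lambda>k. (\<bar>a k\<bar> * (B k)\<^sup>2) * (g x * g y))"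
    using assms(1) unfolding adm_def by (rule summable_mult2)
  show *: "summable (\<lambda>k. \<bar>a k * \<phi> k x * \<phi> k y\<bar>)"
    by (rule summable_comparison_test'[OF s, of 0]) (use kser_term_bound[OF assms(2,3)] in auto)
  then show "summable (\<lambda>k. a k * \<phi> k x * \<phi> k y)" by (rule summable_rabs_cancel)
qed

lemma abs_kser_le:
  assumes "adm a" "x \<in> {0<..<1}" "y \<in> {0<..<1}"
  shows "\<bar>kser a x y\<bar> \<le> asum a * (g x * g y)"
proof -
  have "\<bar>kser a x y\<bar> \<le> (\<Sum>k. \<bar>a k * \<phi> k x * \<phi> k y\<bar>)"
    unfolding kser_def by (rule summable_rabs[OF summable_kser(2)[OF assms]])
  also have "\<dots> \<le> (\<Sum>k. (\<bar>a k\<bar> * (B k)\<^sup>2) * (g x * g y))"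
    using assms(1) unfolding adm_def
    by (intro suminf_le kser_term_bound assms summable_kser summable_mult2)
  also have "\<dots> = asum a * (g x * g y)"
    using assms(1) unfolding adm_def asum_def by (rule suminf_mult2[symmetric])
  finally show ?thesis .
qed

lemma asum_nonneg: "adm a \<Longrightarrow> 0 \<le> asum a"
  unfolding asum_def adm_def by (rule suminf_nonneg) auto

lemma kser_measurable:
  assumes [measurable]: "u \<in> borel_measurable M" "v \<in> borel_measurable M"
  shows "(\<lambda>x. kser a (u x) (v x)) \<in> borel_measurable M"
  unfolding kser_def by measurable

lemma kser_unit_measurable [measurable]:
  "(\<lambda>y. kser a y z) \<in> borel_measurable unit_lborel" "(\<lambda>y. kser a x y) \<in> borel_measurable unit_lborel"
  by (rule kser_measurable[OF unit_measurable_id borel_measurable_const],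
      rule kser_measurable[OF borel_measurable_const unit_measurable_id])

lemma integrable_if_dominated:
  assumes [measurable]: "f \<in> borel_measurable unit_lborel"
    and "\<And>x. x \<in> {0<..<1} \<Longrightarrow> \<bar>f x\<bar> \<le> c * (g x)\<^sup>2"
  shows "integrable unit_lborel f"
  by (rule Bochner_Integration.integrable_bound[OF integrable_mult_right[OF g_int, of c]])
    (use assms in \<open>auto intro!: AE_I2 order_trans[OF assms(2)]\<close>)

text \<open>Orthonormality picks the term \<open>k = j\<close> once sum and integral are exchanged.
  The exchange is justified by \<open>adm a\<close> together with integrability of the square of
  \<open>g\<close>.\<close>

lemma integral_\<phi>_kser:
  assumes a: "adm a" and z: "z \<in> {0<..<1}"
  shows "(LINT y|unit_lborel. \<phi> j y * kser a y z) = a j * \<phi> j z"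
    and "integrable unit_lborel (\<lambda>y. \<phi> j y * kser a y z)"
proof -
  have i: "integrable unit_lborel (\<lambda>y. \<phi> j y * kser a y z)"
  proof (rule integrable_if_dominated[where c = "B j * asum a * g z"])
    fix y :: real assume y: "y \<in> {0<..<1}"
    have "\<bar>\<phi> j y * kser a y z\<bar> \<le> (B j * g y) * (asum a * (g y * g z))"
      using y z a by (intro abs_mult_le \<phi>_bound abs_kser_le) auto
    then show "\<bar>\<phi> j y * kser a y z\<bar> \<le> B j * asum a * g z * (g y)\<^sup>2" by (simp add: power2_eq_square mult_ac)
  qed measurable
  then show "integrable unit_lborel (\<lambda>y. \<phi> j y * kser a y z)" .
  have \<phi>\<phi>: "integrable unit_lborel (\<lambda>y. \<phi> j y * \<phi> k y)" for k
  proof (rule integrable_if_dominated[where c = "B j * B k"])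
    fix y :: real assume y: "y \<in> {0<..<1}"
    have "\<bar>\<phi> j y * \<phi> k y\<bar> \<le> (B j * g y) * (B k * g y)"
      using y by (intro abs_mult_le \<phi>_bound) auto
    then show "\<bar>\<phi> j y * \<phi> k y\<bar> \<le> B j * B k * (g y)\<^sup>2" by (simp add: power2_eq_square mult_ac)
  qed measurable
  let ?f = "\<lambda>k y. (a k * \<phi> k z) * (\<phi> j y * \<phi> k y)"
  have norm_le: "\<bar>?f k y\<bar> \<le> (\<bar>a k\<bar> * (B k)\<^sup>2) * (B j * g z * (g y)\<^sup>2)" if y: "y \<in> {0<..<1}" for k y
  proof -
    have "\<bar>\<phi> j y * (a k * \<phi> k y * \<phi> k z)\<bar> \<le> (B j * g y) * ((\<bar>a k\<bar> * (B k)\<^sup>2) * (g y * g z))"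
      using y z by (intro abs_mult_le \<phi>_bound kser_term_bound) auto
    then show ?thesis by (simp add: power2_eq_square mult_ac)
  qed
  have "(LINT y|unit_lborel. \<phi> j y * kser a y z) = (LINT y|unit_lborel. (\<Sum>k. ?f k y))"
  proof (rule Bochner_Integration.integral_cong[OF refl])
    fix y assume "y \<in> space unit_lborel"
    then have "summable (\<lambda>k. a k * \<phi> k y * \<phi> k z)" using a z by (intro summable_kser) auto
    then show "\<phi> j y * kser a y z = (\<Sum>k. ?f k y)"
      unfolding kser_def by (subst suminf_mult[symmetric]) (auto simp: mult_ac)
  qed
  also have "\<dots> = (\<Sum>k. LINT y|unit_lborel. ?f k y)"
  proof (rule integral_suminf)
    show "integrable unit_lborel (?f k)" for k using \<phi>\<phi> by (rule integrable_mult_right)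
    show "AE y in unit_lborel. summable (\<lambda>k. norm (?f k y))"
    proof (rule AE_I2)
      fix y assume "y \<in> space unit_lborel"
      then have y: "y \<in> {0<..<1}" by simp
      have s: "summable (\<lambda>k. (\<bar>a k\<bar> * (B k)\<^sup>2) * (B j * g z * (g y)\<^sup>2))"
        using a unfolding adm_def by (rule summable_mult2)
      show "summable (\<lambda>k. norm (?f k y))"
        by (rule summable_comparison_test'[OF s, of 0]) (use norm_le[OF y] in auto)
    qed
    let ?I = "LINT y|unit_lborel. (g y)\<^sup>2"
    have s: "summable (\<lambda>k. (\<bar>a k\<bar> * (B k)\<^sup>2) * (B j * g z * ?I))"
      using a unfolding adm_def by (rule summable_mult2)
    have "norm (LINT y|unit_lborel. norm (?f k y)) \<le> (\<bar>a k\<bar> * (B k)\<^sup>2) * (B j * g z * ?I)" for k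
    proof -
      have "norm (LINT y|unit_lborel. norm (?f k y)) = (LINT y|unit_lborel. norm (?f k y))" by simp
      also have "\<dots> \<le> (LINT y|unit_lborel. (\<bar>a k\<bar> * (B k)\<^sup>2) * (B j * g z * (g y)\<^sup>2))"
        using \<phi>\<phi>[of k] g_int norm_le
        by (intro integral_mono integrable_norm integrable_mult_right) auto
      also have "\<dots> = (\<bar>a k\<bar> * (B k)\<^sup>2) * (B j * g z * ?I)" by simp
      finally show ?thesis .
    qed
    then show "summable (\<lambda>k. LINT y|unit_lborel. norm (?f k y))"
      by (intro summable_comparison_test'[OF s, of 0]) auto
  qed
  also have "\<dots> = (\<Sum>k. if k = j then a j * \<phi> j z else 0)"
    using \<phi>_ortho by (intro suminf_cong) auto
  also have "\<dots> = a j * \<phi> j z"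
    using suminf_finite[of "{j}" "\<lambda>k. if k = j then a j * \<phi> j z else 0"] by simp
  finally show "(LINT y|unit_lborel. \<phi> j y * kser a y z) = a j * \<phi> j z" .
qed

text \<open>Series kernels act as diagonal operators in the system \<open>\<phi>\<close>, so
  composing them multiplies the coefficients. Only the first kernel is expanded; each of its terms
  meets the second one through \<open>integral_\<phi>_kser\<close>.\<close>

lemma integral_kser_kser:
  assumes a: "adm a" and b: "adm b" and x: "x \<in> {0<..<1}" and z: "z \<in> {0<..<1}"
  shows "(LINT y|unit_lborel. kser a x y * kser b y z) = kser (\<lambda>k. a k * b k) x z"
    and "integrable unit_lborel (\<lambda>y. kser a x y * kser b y z)"
proof -
  show "integrable unit_lborel (\<lambda>y. kser a x y * kser b y z)"
  proof (rule integrable_if_dominated[where c = "asum a * g x * asum b * g z"])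
    fix y :: real assume y: "y \<in> {0<..<1}"
    have "\<bar>kser a x y * kser b y z\<bar> \<le> (asum a * (g x * g y)) * (asum b * (g y * g z))"
      using a b x y z by (intro abs_mult_le abs_kser_le) auto
    then show "\<bar>kser a x y * kser b y z\<bar> \<le> asum a * g x * asum b * g z * (g y)\<^sup>2" by (simp add: power2_eq_square mult_ac)
  qed measurable
  let ?f = "\<lambda>k y. (a k * \<phi> k x) * (\<phi> k y * kser b y z)"
  let ?c = "asum b * g x * g z"
  have norm_le: "\<bar>?f k y\<bar> \<le> (\<bar>a k\<bar> * (B k)\<^sup>2) * (?c * (g y)\<^sup>2)" if y: "y \<in> {0<..<1}" for k y
  proof -
    have "\<bar>a k * \<phi> k x * \<phi> k y * kser b y z\<bar> \<le> ((\<bar>a k\<bar> * (B k)\<^sup>2) * (g x * g y)) * (asum b * (g y * g z))"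
      using b x y z by (intro abs_mult_le abs_kser_le kser_term_bound) auto
    then show ?thesis by (simp add: power2_eq_square mult_ac)
  qed
  have s: "summable (\<lambda>k. (\<bar>a k\<bar> * (B k)\<^sup>2) * d)" for d
    using a unfolding adm_def by (rule summable_mult2)
  have "(LINT y|unit_lborel. kser a x y * kser b y z) = (LINT y|unit_lborel. (\<Sum>k. ?f k y))"
  proof (rule Bochner_Integration.integral_cong[OF refl])
    fix y assume "y \<in> space unit_lborel"
    then have "summable (\<lambda>k. a k * \<phi> k x * \<phi> k y)" using a x by (intro summable_kser) auto
    then show "kser a x y * kser b y z = (\<Sum>k. ?f k y)"
      unfolding kser_def[of a] by (subst suminf_mult2) (auto simp: mult_ac)
  qed
  also have "\<dots> = (\<Sum>k. LINT y|unit_lborel. ?f k y)"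
  proof (rule integral_suminf)
    show "integrable unit_lborel (?f k)" for k
      using integral_\<phi>_kser(2)[OF b z] by (rule integrable_mult_right)
    show "AE y in unit_lborel. summable (\<lambda>k. norm (?f k y))"
      by (rule AE_I2, rule summable_comparison_test'[OF s, of 0]) (use norm_le in auto)
    let ?I = "LINT y|unit_lborel. (g y)\<^sup>2"
    have "norm (LINT y|unit_lborel. norm (?f k y)) \<le> (\<bar>a k\<bar> * (B k)\<^sup>2) * (?c * ?I)" for k
    proof -
      have "norm (LINT y|unit_lborel. norm (?f k y)) = (LINT y|unit_lborel. norm (?f k y))" by simp
      also have "\<dots> \<le> (LINT y|unit_lborel. (\<bar>a k\<bar> * (B k)\<^sup>2) * (?c * (g y)\<^sup>2))"
        using integral_\<phi>_kser(2)[OF b z, of k] g_int norm_le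
        by (intro integral_mono integrable_norm integrable_mult_right) auto
      also have "\<dots> = (\<bar>a k\<bar> * (B k)\<^sup>2) * (?c * ?I)" by simp
      finally show ?thesis .
    qed
    then show "summable (\<lambda>k. LINT y|unit_lborel. norm (?f k y))"
      by (intro summable_comparison_test'[OF s, of 0]) auto
  qed
  also have "\<dots> = kser (\<lambda>k. a k * b k) x z"
    unfolding kser_def[of "\<lambda>k. a k * b k"]
    by (intro suminf_cong, subst integral_mult_right_zero)
      (simp add: integral_\<phi>_kser(1)[OF b z] mult_ac)
  finally show "(LINT y|unit_lborel. kser a x y * kser b y z) = kser (\<lambda>k. a k * b k) x z" .
qed

section \<open>The space-time kernel as a series kernel, and its composition rule\<close>

definition kcoef :: "real \<Rightarrow> real \<Rightarrow> nat \<Rightarrow> real" where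
  "kcoef t s k = (if s \<le> t then (if k < p then exp ((t - s) * E k) else 0)
                  else (if k < p then 0 else - exp ((t - s) * E k)))"

definition ker :: "real \<Rightarrow> real \<Rightarrow> real \<Rightarrow> real \<Rightarrow> real" where
  "ker t s = kser (kcoef t s)"

definition heat :: "real \<Rightarrow> real \<Rightarrow> real \<Rightarrow> real" where
  "heat \<tau> = kser (\<lambda>k. exp (- \<tau> * E k))"

lemma adm_heat: "\<tau> > 0 \<Longrightarrow> adm (\<lambda>k. exp (- \<tau> * E k))"
  using exp_summable[of \<tau>] by (simp add: adm_def)

lemma adm_finite: "finite {k. a k \<noteq> 0} \<Longrightarrow> adm a"
  unfolding adm_def by (rule summable_finite[of "{k. a k \<noteq> 0}"]) auto

lemma adm_kcoef: "adm (kcoef t s)"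
proof (cases "s \<le> t")
  case True
  then show ?thesis
    by (intro adm_finite) (rule finite_subset[of _ "{..<p}"], auto simp: kcoef_def split: if_splits)
next
  case False
  then have s: "summable (\<lambda>k. exp (- (s - t) * E k) * (B k)\<^sup>2)" by (intro exp_summable) simp
  show ?thesis unfolding adm_def
    by (rule summable_comparison_test'[OF s, of 0]) (use False in \<open>auto simp: kcoef_def\<close>)
qed

text \<open>Both signs are needed: for \<open>t < s < u\<close> the two minus signs of the tail kernels multiply to
  a plus sign, so the composition is minus the tail kernel.\<close>

lemma kcoef_mult: "kcoef t s k * kcoef s u k = (of_bool (s \<le> t) - of_bool (s < u)) * kcoef t u k"
proof -
  have "exp ((t - s) * E k) * exp ((s - u) * E k) = exp ((t - u) * E k)"
    unfolding exp_add[symmetric] by (rule arg_cong[of _ _ exp]) (simp add: algebra_simps)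
  then show ?thesis by (auto simp: kcoef_def)
qed

lemma kser_scale: "adm a \<Longrightarrow> x \<in> {0<..<1} \<Longrightarrow> y \<in> {0<..<1} \<Longrightarrow> kser (\<lambda>k. c * a k) x y = c * kser a x y"
  using suminf_mult[OF summable_kser(1), of a x y c] by (simp add: kser_def mult.assoc)

lemma integral_ker_ker:
  assumes x: "x \<in> {0<..<1}" and z: "z \<in> {0<..<1}"
  shows "(LINT y|unit_lborel. ker t s x y * ker s u y z) =
      (of_bool (s \<le> t) - of_bool (s < u)) * ker t u x z"
    and "integrable unit_lborel (\<lambda>y. ker t s x y * ker s u y z)"
  unfolding ker_def integral_kser_kser(1)[OF adm_kcoef adm_kcoef x z] kcoef_mult
  by (rule kser_scale[OF adm_kcoef x z], rule integral_kser_kser(2)[OF adm_kcoef adm_kcoef x z])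

lemma ker_eq_finite_sum:
  assumes "s \<le> t"
  shows "ker t s x y = (\<Sum>q<p. exp ((t - s) * E q) * \<phi> q x * \<phi> q y)"
  unfolding ker_def kser_def
  by (subst suminf_finite[of "{..<p}"]) (use assms in \<open>simp_all add: kcoef_def\<close>)

lemma integral_ker_diag:
  "(LINT y|unit_lborel. ker s s y y) = real p" "integrable unit_lborel (\<lambda>y. ker s s y y)"
proof -
  have i: "integrable unit_lborel (\<lambda>y. \<phi> q y * \<phi> q y)" for q
  proof (rule integrable_if_dominated[where c = "B q * B q"])
    fix y :: real assume y: "y \<in> {0<..<1}"
    have "\<bar>\<phi> q y * \<phi> q y\<bar> \<le> (B q * g y) * (B q * g y)"
      using y by (intro abs_mult_le \<phi>_bound) auto
    then show "\<bar>\<phi> q y * \<phi> q y\<bar> \<le> B q * B q * (g y)\<^sup>2" by (simp add: power2_eq_square mult_ac)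
  qed measurable
  show "(LINT y|unit_lborel. ker s s y y) = real p" "integrable unit_lborel (\<lambda>y. ker s s y y)"
    using i by (simp_all add: ker_eq_finite_sum Bochner_Integration.integral_sum \<phi>_ortho)
qed

lemma exp_diff_mult: "exp ((t - s) * e) = exp (t * e) * exp (- s * (e::real))"
  by (simp add: left_diff_distrib flip: exp_add)

text \<open>For \<open>t < s\<close>, minus the tail of the series is its head minus the whole
  series. This is the shape that the determinant lemmas expect: \<open>p\<close> products of a row
  function and a column function, minus a matrix supported where the row time precedes the column
  time.\<close>

lemma ker_eq_diff:
  assumes x: "x \<in> {0<..<1}" and y: "y \<in> {0<..<1}"
  shows "ker t s x y = (\<Sum>q<p. (exp (t * E q) * \<phi> q x) * (exp (- s * E q) * \<phi> q y)) -
     (if t < s then heat (s - t) x y else 0)"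
proof (cases "s \<le> t")
  case True
  then show ?thesis
    unfolding ker_eq_finite_sum[OF True] exp_diff_mult by (simp add: mult_ac)
next
  case False
  define a where "a k = (if k < p then exp ((t - s) * E k) else 0)" for k
  have a: "adm a" by (rule adm_finite, rule finite_subset[of _ "{..<p}"]) (auto simp: a_def)
  have eq: "kcoef t s k = a k - exp (- (s - t) * E k)" for k
    by (cases "k < p") (use False in \<open>simp_all add: kcoef_def a_def\<close>)
  have h: "adm (\<lambda>k. exp (- (s - t) * E k))" by (rule adm_heat) (use False in simp)
  have "ker t s x y = (\<Sum>k. a k * \<phi> k x * \<phi> k y - exp (- (s - t) * E k) * \<phi> k x * \<phi> k y)"
    unfolding ker_def kser_def eq by (simp only: left_diff_distrib)
  also have "\<dots> = kser a x y - heat (s - t) x y"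
    unfolding kser_def heat_def
    by (rule suminf_diff[OF summable_kser(1)[OF a x y] summable_kser(1)[OF h x y], symmetric])
  also have "kser a x y = (\<Sum>q<p. exp ((t - s) * E q) * \<phi> q x * \<phi> q y)"
    unfolding kser_def by (subst suminf_finite[of "{..<p}"]) (auto simp: a_def)
  also have "\<dots> = (\<Sum>q<p. (exp (t * E q) * \<phi> q x) * (exp (- s * E q) * \<phi> q y))"
    unfolding exp_diff_mult by (simp add: mult_ac)
  finally show ?thesis using False by simp
qed

section \<open>Determinants of the space-time kernel\<close>

definition rho :: "nat \<Rightarrow> (nat \<Rightarrow> real) \<Rightarrow> (nat \<Rightarrow> real) \<Rightarrow> real" where
  "rho n t x = pdet {..<n} (\<lambda>i j. ker (t i) (t j) (x i) (x j))"

lemma ker_measurable: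
  "u \<in> borel_measurable M \<Longrightarrow> v \<in> borel_measurable M \<Longrightarrow> (\<lambda>x. ker t s (u x) (v x)) \<in> borel_measurable M"
  unfolding ker_def by (rule kser_measurable)

lemma heat_measurable:
  "u \<in> borel_measurable M \<Longrightarrow> v \<in> borel_measurable M \<Longrightarrow> (\<lambda>x. heat t (u x) (v x)) \<in> borel_measurable M"
  unfolding heat_def by (rule kser_measurable)

lemma rho_measurable: "rho n t \<in> borel_measurable (cube_lborel n)"
  unfolding rho_def by (rule borel_measurable_pdet, rule ker_measurable; rule cube_component; simp)

text \<open>Every point serves once as a row and once as a column, so the determinant is dominated
  by a constant times the product of the squares of \<open>g (x i)\<close>.\<close>

lemma rho_integrable: "integrable (cube_lborel n) (rho n t)"
proof -
  interpret U: prob_space unit_lborel by (rule prob_space_unit_lborel)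
  interpret product_sigma_finite "\<lambda>_::nat. unit_lborel" by standard
  define c where "c = (\<Sum>i<n. \<Sum>j<n. asum (kcoef (t i) (t j)))"
  have c: "asum (kcoef (t i) (t j)) \<le> c" if "i < n" "j < n" for i j
  proof -
    have "asum (kcoef (t i) (t j)) \<le> (\<Sum>j<n. asum (kcoef (t i) (t j)))"
      using that by (intro member_le_sum) (auto intro: asum_nonneg adm_kcoef)
    also have "\<dots> \<le> c" unfolding c_def
      using that by (intro member_le_sum[of i _ "\<lambda>i. \<Sum>j<n. asum (kcoef (t i) (t j))"])
        (auto intro!: sum_nonneg asum_nonneg adm_kcoef)
    finally show ?thesis .
  qed
  have c0: "c \<ge> 0" unfolding c_def by (intro sum_nonneg asum_nonneg adm_kcoef)
  have i: "integrable (cube_lborel n) (\<lambda>x. \<Prod>i<n. (g (x i))\<^sup>2)"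
    using g_int by (intro product_integrable_prod) auto
  show ?thesis
  proof (rule Bochner_Integration.integrable_bound[OF integrable_mult_right[OF i, of "fact n * c ^ n"]])
    show "AE x in cube_lborel n. norm (rho n t x) \<le>
        norm (fact n * c ^ n * (\<Prod>i<n. (g (x i))\<^sup>2))"
    proof (rule AE_I2)
      fix x assume "x \<in> space (cube_lborel n)"
      then have x: "x i \<in> {0<..<1}" if "i < n" for i using that by (auto simp: space_PiM PiE_iff)
      have "\<bar>rho n t x\<bar> \<le> fact (card {..<n}) * c ^ card {..<n} * ((\<Prod>i<n. g (x i)) * (\<Prod>i<n. g (x i)))"
        unfolding rho_def
      proof (rule abs_pdet_le)
        fix i j assume ij: "i \<in> {..<n}" "j \<in> {..<n}"
        have "\<bar>ker (t i) (t j) (x i) (x j)\<bar> \<le> asum (kcoef (t i) (t j)) * (g (x i) * g (x j))"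
          unfolding ker_def using x ij by (intro abs_kser_le adm_kcoef) auto
        also have "\<dots> \<le> c * (g (x i) * g (x j))"
          using ij by (intro mult_right_mono c mult_nonneg_nonneg g_nonneg) auto
        finally show "\<bar>ker (t i) (t j) (x i) (x j)\<bar> \<le> c * (g (x i) * g (x j))" .
      qed (use c0 in auto)
      also have "\<dots> = fact n * c ^ n * (\<Prod>i<n. (g (x i))\<^sup>2)"
        by (simp add: power2_eq_square prod.distrib)
      also have "\<dots> \<le> norm \<dots>" by simp
      finally show "norm (rho n t x) \<le> norm (fact n * c ^ n * (\<Prod>i<n. (g (x i))\<^sup>2))" by simp
    qed
  qed (rule rho_measurable)
qed

lemma rho_too_many:
  assumes x: "x \<in> {..<n} \<rightarrow> {0<..<1}" and s: "card {i. i < n \<and> t i = s} > p"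
  shows "rho n t x = 0"
proof -
  have "rho n t x = pdet {..<n} (\<lambda>i j. (\<Sum>q<p. (exp (t i * E q) * \<phi> q (x i)) * (exp (- t j * E q) * \<phi> q (x j))) -
     (if t i < t j then heat (t j - t i) (x i) (x j) else 0))"
    unfolding rho_def by (intro pdet_cong ker_eq_diff) (use x in auto)
  also have "\<dots> = 0"
    by (rule pdet_too_many_points[where t = t and s = s]) (use s in auto)
  finally show ?thesis .
qed

lemma rho_coincidence:
  assumes "i < n" "j < n" "i \<noteq> j" "t i = t j" "x i = x j"
  shows "rho n t x = 0"
  unfolding rho_def by (rule pdet_identical_columns[of i n j]) (use assms in auto)

text \<open>In the composition rule the row contributes \<open>of_bool (s \<le> t i)\<close> and the
  column \<open>of_bool (s < t j)\<close>. Summed over the remaining points, these differ by the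
  number of points at time \<open>s\<close>, which is subtracted from the trace \<open>p\<close> of
  the equal-time kernel.\<close>

lemma integral_rho_Suc:
  assumes x: "x \<in> {..<n} \<rightarrow> {0<..<1}"
  shows "(LINT y|unit_lborel. rho (Suc n) (t(n := s)) (x(n := y))) =
    (real p - real (card {i. i < n \<and> t i = s})) * rho n t x"
proof -
  let ?A = "\<lambda>y i j. ker ((t(n := s)) i) ((t(n := s)) j) ((x(n := y)) i) ((x(n := y)) j)"
  have "(LINT y|unit_lborel. pdet (insert n {..<n}) (?A y)) =
    (real p - (\<Sum>i<n. of_bool (s \<le> t i) - of_bool (s < t i))) * pdet {..<n} (\<lambda>i j. ker (t i) (t j) (x i) (x j))"
  proof (rule integral_pdet_insert)
    show "integrable unit_lborel (\<lambda>y. ?A y n n)" "(LINT y|unit_lborel. ?A y n n) = real p"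
      using integral_ker_diag by simp_all
    fix i j assume ij: "i \<in> {..<n}" "j \<in> {..<n}"
    show "integrable unit_lborel (\<lambda>y. ?A y n j * ?A y i n)"
      "(LINT y|unit_lborel. ?A y n j * ?A y i n) = (of_bool (s \<le> t i) - of_bool (s < t j)) * ker (t i) (t j) (x i) (x j)"
      using integral_ker_ker[of "x i" "x j" "t i" s "t j"] x ij by (auto simp: mult.commute Pi_iff)
  qed auto
  also have "(\<Sum>i<n. of_bool (s \<le> t i) - of_bool (s < t i)) = (\<Sum>i<n. of_bool (t i = s) :: real)"
    by (intro sum.cong) auto
  also have "\<dots> = real (card {i. i < n \<and> t i = s})"
    by (simp add: Int_def of_bool_def sum.If_cases)
  finally show ?thesis unfolding rho_def lessThan_Suc .
qed

end

section \<open>Configurations\<close>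

lemma unit_sigma_finite: "product_sigma_finite (\<lambda>_::'i. unit_lborel)"
proof -
  interpret U: prob_space unit_lborel by (rule prob_space_unit_lborel)
  show ?thesis by standard
qed

lemma lborel_on_cube: "lborel_on n (cube n) = PiM {..<n} (\<lambda>_. unit_lborel)"
proof -
  have "PiM {..<n} (\<lambda>_. unit_lborel) = restrict_space (PiM {..<n} (\<lambda>_. lborel)) (\<Pi>\<^sub>E i\<in>{..<n}. {0<..<1})"
    unfolding unit_lborel_def
  proof (rule PiM_restrict_space)
    show "product_sigma_finite (\<lambda>_::nat. lborel :: real measure)"
      by (simp add: product_sigma_finite_def sigma_finite_lborel)
    show "product_sigma_finite (\<lambda>_::nat. restrict_space (lborel :: real measure) {0<..<1})"
      using unit_sigma_finite unfolding unit_lborel_def .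
  qed auto
  then show ?thesis by (simp add: lborel_on_def cube_def)
qed

lemma chamber_iff:
  "X \<in> chamber p \<longleftrightarrow> X \<in> {..<p} \<rightarrow>\<^sub>E {0<..<1} \<and> (\<forall>i<p. \<forall>j<p. i < j \<longrightarrow> X i < X j)"
  by (auto simp: chamber_def strict_mono_on_def)

lemma chamber_unit: "X \<in> chamber p \<Longrightarrow> a < p \<Longrightarrow> X a \<in> {0<..<1}"
  by (auto simp: chamber_iff PiE_iff)

lemma chamber_inj_on: "X \<in> chamber p \<Longrightarrow> inj_on X {..<p}"
  unfolding chamber_iff inj_on_def by (metis lessThan_iff less_irrefl linorder_neqE_nat)

abbreviation chamber_lborel :: "nat \<Rightarrow> (nat \<Rightarrow> real) measure" where
  "chamber_lborel p \<equiv> lborel_on p (chamber p)"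

lemma prob_space_cube: "prob_space (cube_lborel n)"
  by (rule prob_space_PiM) (rule prob_space_unit_lborel)

lemma space_cube_lborel: "space (cube_lborel n) = cube n"
  by (simp add: space_PiM cube_def)

lemma chamber_sets: "chamber p \<in> sets (cube_lborel p)"
proof -
  have [measurable]: "i \<in> {..<p} \<Longrightarrow> (\<lambda>x. x i) \<in> borel_measurable (cube_lborel p)" for i
    by (rule cube_component) simp
  have "chamber p = {x \<in> space (cube_lborel p). \<forall>i\<in>{..<p}. \<forall>j\<in>{..<p}. i < j \<longrightarrow> x i < x j}"
    by (auto simp: chamber_iff space_cube_lborel cube_def PiE_iff)
  also have "\<dots> \<in> sets (cube_lborel p)" by measurable
  finally show ?thesis .
qed

lemma chamber_lborel_eq: "chamber_lborel p = restrict_space (cube_lborel p) (chamber p)"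
proof -
  have c: "cube p \<inter> space (PiM {..<p} (\<lambda>_. lborel)) \<in> sets (PiM {..<p} (\<lambda>_. lborel :: real measure))"
    unfolding cube_def by (rule sets.Int[OF sets_PiM_I_finite sets.top]) simp_all
  have "chamber p \<in> sets (restrict_space (PiM {..<p} (\<lambda>_. lborel)) (cube p))"
    using chamber_sets[of p] lborel_on_cube[of p] by (simp add: lborel_on_def)
  moreover have "chamber p \<subseteq> cube p" by (auto simp: chamber_def cube_def)
  ultimately have "chamber p \<in> sets (PiM {..<p} (\<lambda>_. lborel :: real measure))"
    using c by (subst (asm) sets_restrict_space_iff) auto
  then have "restrict_space (restrict_space (PiM {..<p} (\<lambda>_. lborel)) (cube p)) (chamber p) =
      restrict_space (PiM {..<p} (\<lambda>_. lborel)) (cube p \<inter> chamber p)"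
    using c by (intro restrict_restrict_space) auto
  also have "cube p \<inter> chamber p = chamber p" using \<open>chamber p \<subseteq> cube p\<close> by auto
  finally show ?thesis using lborel_on_cube[of p] by (simp add: lborel_on_def)
qed

lemma space_chamber_lborel [simp]: "space (chamber_lborel p) = chamber p"
  using sets.sets_into_space[OF chamber_sets] by (auto simp: chamber_lborel_eq space_restrict_space)

lemma finite_measure_chamber: "finite_measure (chamber_lborel p)"
  unfolding chamber_lborel_eq
  by (rule finite_measure_restrict_space[OF _ chamber_sets]) (rule prob_space.finite_measure[OF prob_space_cube])

lemma chamber_sigma_finite: "product_sigma_finite (\<lambda>_::'i. chamber_lborel p)"
proof -
  interpret finite_measure "chamber_lborel p" by (rule finite_measure_chamber)
  show ?thesis by standard
qed

lemma cube_sigma_finite: "product_sigma_finite (\<lambda>_::'i. cube_lborel p)"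
proof -
  interpret prob_space "cube_lborel p" by (rule prob_space_cube)
  show ?thesis by standard
qed

lemma chamber_component: "i < p \<Longrightarrow> (\<lambda>x. x i) \<in> borel_measurable (chamber_lborel p)"
  unfolding chamber_lborel_eq by (intro measurable_restrict_space1 cube_component)

abbreviation path_lborel :: "nat \<Rightarrow> nat \<Rightarrow> (nat \<Rightarrow> nat \<Rightarrow> real) measure" where
  "path_lborel p m \<equiv> PiM {..<m} (\<lambda>_. chamber_lborel p)"

lemma path_lborel_eq:
  "path_lborel p m = restrict_space (PiM {..<m} (\<lambda>_. cube_lborel p)) (\<Pi>\<^sub>E k\<in>{..<m}. chamber p)"
  unfolding chamber_lborel_eq
  by (rule PiM_restrict_space)
    (use chamber_sets cube_sigma_finite chamber_sigma_finite in \<open>auto simp: chamber_lborel_eq\<close>)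

lemma pdet_scale_columns: "pdet S (\<lambda>i j. d j * A i j) = (\<Prod>j\<in>S. d j) * pdet S A"
  unfolding pdet_def sum_distrib_left
proof (rule sum.cong[OF refl])
  fix \<sigma> assume "\<sigma> \<in> {\<sigma>. \<sigma> permutes S}"
  then have "(\<Prod>i\<in>S. d (\<sigma> i)) = (\<Prod>i\<in>S. d i)"
    using prod.permute[of \<sigma> S d] by (simp add: o_def)
  then show "of_int (sign \<sigma>) * (\<Prod>i\<in>S. d (\<sigma> i) * A i (\<sigma> i)) =
      (\<Prod>j\<in>S. d j) * (of_int (sign \<sigma>) * (\<Prod>i\<in>S. A i (\<sigma> i)))"
    by (simp add: prod.distrib)
qed

lemma bij_betw_div_mod:
  fixes p :: nat
  shows "bij_betw (\<lambda>(k, a). k * p + a) ({..<m} \<times> {..<p}) {..<m * p}"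
    and "bij_betw (\<lambda>j. (j div p, j mod p)) {..<m * p} ({..<m} \<times> {..<p})"
proof -
  have 1: "(\<lambda>(k, a). k * p + a) ` ({..<m} \<times> {..<p}) \<subseteq> {..<m * p}"
  proof clarsimp
    fix k a assume k: "k < m" and a: "a < p"
    then have "Suc k * p \<le> m * p" by (intro mult_le_mono1) simp
    then show "k * p + a < m * p" using a by simp
  qed
  have 2: "(\<lambda>j. (j div p, j mod p)) ` {..<m * p} \<subseteq> {..<m} \<times> {..<p}"
  proof clarsimp
    fix j assume j: "j < m * p"
    then have "p > 0" by (cases p) auto
    then show "j div p < m \<and> j mod p < p" using j by (simp add: less_mult_imp_div_less)
  qed
  show "bij_betw (\<lambda>(k, a). k * p + a) ({..<m} \<times> {..<p}) {..<m * p}"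
    by (rule bij_betw_byWitness[OF _ _ 1 2]) auto
  show "bij_betw (\<lambda>j. (j div p, j mod p)) {..<m * p} ({..<m} \<times> {..<p})"
    by (rule bij_betw_byWitness[OF _ _ 2 1]) auto
qed

text \<open>The pairs \<open>(\<tau> i, c i)\<close> label the \<open>n\<close> points by the coordinates of \<open>m\<close> configurations:
  the \<open>i\<close>-th point is coordinate \<open>c i\<close> of the \<open>\<tau> i\<close>-th configuration.\<close>

lemma distr_relabel:
  fixes \<tau> c :: "nat \<Rightarrow> nat"
  assumes bij: "bij_betw (\<lambda>i. (\<tau> i, c i)) {..<n} ({..<m} \<times> {..<p})"
  shows "distr (PiM {..<m} (\<lambda>_. cube_lborel p)) (cube_lborel n) (\<lambda>x. \<lambda>i\<in>{..<n}. x (\<tau> i) (c i)) = cube_lborel n"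
    and "(\<lambda>x. \<lambda>i\<in>{..<n}. x (\<tau> i) (c i)) \<in> measurable (PiM {..<m} (\<lambda>_. cube_lborel p)) (cube_lborel n)"
proof -
  let ?h = "\<lambda>x. \<lambda>i\<in>{..<n}. x (\<tau> i) (c i)"
  let ?N = "PiM {..<m} (\<lambda>_. cube_lborel p)"
  define r where "r = inv_into {..<n} (\<lambda>i. (\<tau> i, c i))"
  have lt: "\<tau> i < m" "c i < p" if "i < n" for i using bij_betwE[OF bij] that by auto
  have r1: "r (\<tau> i, c i) = i" if "i < n" for i
    unfolding r_def using bij_betw_inv_into_left[OF bij] that by simp
  have r2: "r (k, a) < n" "\<tau> (r (k, a)) = k" "c (r (k, a)) = a" if "k < m" "a < p" for k a
    using bij_betwE[OF bij_betw_inv_into[OF bij]] bij_betw_inv_into_right[OF bij, of "(k, a)"] that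
    unfolding r_def by auto
  interpret U: product_sigma_finite "\<lambda>_::nat. unit_lborel" by (rule unit_sigma_finite)
  interpret C: product_sigma_finite "\<lambda>_::nat. cube_lborel p" by (rule cube_sigma_finite)
  show h: "?h \<in> measurable ?N (cube_lborel n)"
  proof (rule measurable_restrict)
    fix i assume "i \<in> {..<n}"
    then show "(\<lambda>x. x (\<tau> i) (c i)) \<in> measurable ?N unit_lborel"
      using lt by (intro measurable_compose[OF measurable_component_singleton[of "\<tau> i" "{..<m}" "\<lambda>_. cube_lborel p"]
            measurable_component_singleton[of "c i" "{..<p}" "\<lambda>_. unit_lborel"]]) auto
  qed
  show "distr ?N (cube_lborel n) ?h = cube_lborel n"
  proof (rule U.PiM_eqI)
    fix A :: "nat \<Rightarrow> real set" assume A: "\<And>i. i \<in> {..<n} \<Longrightarrow> A i \<in> sets unit_lborel"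
    have PA: "Pi\<^sub>E {..<n} A \<in> sets (cube_lborel n)" using A by (intro sets_PiM_I_finite) auto
    have AS: "A i \<subseteq> {0<..<1}" if "i < n" for i using sets.sets_into_space[OF A] that by auto
    have "?h -` Pi\<^sub>E {..<n} A \<inter> space ?N = (\<Pi>\<^sub>E k\<in>{..<m}. \<Pi>\<^sub>E a\<in>{..<p}. A (r (k, a)))" (is "?l = ?r")
    proof (intro equalityI subsetI)
      fix x assume x: "x \<in> ?l"
      then have "x k a \<in> A (r (k, a))" if "k < m" "a < p" for k a
        using r2[OF that] by (auto simp: PiE_iff dest: bspec[of _ _ "r (k, a)"])
      then show "x \<in> ?r" using x by (auto simp: space_PiM PiE_iff)
    next
      fix x assume x: "x \<in> ?r"
      have "x (\<tau> i) (c i) \<in> A i" if "i < n" for i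
      proof -
        have "x (\<tau> i) (c i) \<in> A (r (\<tau> i, c i))" using x lt[OF that] by (auto simp: PiE_iff)
        then show ?thesis by (simp only: r1[OF that])
      qed
      moreover have "x \<in> space ?N"
      proof -
        have "x k a \<in> {0<..<1}" if "k < m" "a < p" for k a
        proof -
          have "x k a \<in> A (r (k, a))" using x that by (auto simp: PiE_iff)
          then show ?thesis using AS[OF r2(1)[OF that]] by blast
        qed
        then show ?thesis using x by (auto simp: space_PiM PiE_iff)
      qed
      ultimately show "x \<in> ?l" by (auto simp: PiE_iff)
    qed
    then have "emeasure (distr ?N (cube_lborel n) ?h) (Pi\<^sub>E {..<n} A) =
        emeasure ?N (\<Pi>\<^sub>E k\<in>{..<m}. \<Pi>\<^sub>E a\<in>{..<p}. A (r (k, a)))"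
      using h PA by (simp add: emeasure_distr)
    also have "\<dots> = (\<Prod>k<m. emeasure (cube_lborel p) (\<Pi>\<^sub>E a\<in>{..<p}. A (r (k, a))))"
      using A r2(1)
      by (intro C.emeasure_PiM[of "{..<m}" "\<lambda>k. \<Pi>\<^sub>E a\<in>{..<p}. A (r (k, a))"] sets_PiM_I_finite) auto
    also have "\<dots> = (\<Prod>k<m. \<Prod>a<p. emeasure unit_lborel (A (r (k, a))))"
      using A r2(1)
      by (intro prod.cong refl U.emeasure_PiM[of "{..<p}" "\<lambda>a. A (r (_, a))"]) auto
    also have "\<dots> = (\<Prod>(k, a)\<in>{..<m} \<times> {..<p}. emeasure unit_lborel (A (r (k, a))))"
      by (rule prod.cartesian_product)
    also have "\<dots> = (\<Prod>i<n. emeasure unit_lborel (A (r (\<tau> i, c i))))"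
      using prod.reindex_bij_betw[OF bij, of "\<lambda>(k, a). emeasure unit_lborel (A (r (k, a)))"] by simp
    also have "\<dots> = (\<Prod>i<n. emeasure unit_lborel (A i))" using r1 by simp
    finally show "emeasure (distr ?N (cube_lborel n) ?h) (Pi\<^sub>E {..<n} A) = (\<Prod>i<n. emeasure unit_lborel (A i))" .
  qed simp_all
qed

lemma path_mem_iff:
  fixes \<tau> c :: "nat \<Rightarrow> nat"
  assumes bij: "bij_betw (\<lambda>i. (\<tau> i, c i)) {..<n} ({..<m} \<times> {..<p})"
    and x: "x \<in> space (PiM {..<m} (\<lambda>_. cube_lborel p))"
  shows "x \<in> (\<Pi>\<^sub>E k\<in>{..<m}. chamber p) \<longleftrightarrow>
    (\<forall>i<n. \<forall>j<n. \<tau> i = \<tau> j \<and> c i < c j \<longrightarrow> x (\<tau> i) (c i) < x (\<tau> j) (c j))" (is "?l \<longleftrightarrow> ?r")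
proof
  have lt: "\<tau> i < m" "c i < p" if "i < n" for i using bij_betwE[OF bij] that by auto
  show ?r if ?l
  proof clarify
    fix i j assume ij: "i < n" "j < n" "\<tau> i = \<tau> j" "c i < c j"
    have "x (\<tau> i) \<in> chamber p" using that lt[OF ij(1)] by (auto simp: PiE_iff)
    then show "x (\<tau> i) (c i) < x (\<tau> j) (c j)" using ij lt by (auto simp: chamber_iff)
  qed
  show ?l if r: ?r
  proof (rule PiE_I)
    fix k assume k: "k \<in> {..<m}"
    have "x k a < x k b" if ab: "a < p" "b < p" "a < b" for a b
    proof -
      have "(k, a) \<in> (\<lambda>i. (\<tau> i, c i)) ` {..<n}" "(k, b) \<in> (\<lambda>i. (\<tau> i, c i)) ` {..<n}"
        using bij k ab by (auto simp: bij_betw_def)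
      then obtain i j where ij: "i < n" "\<tau> i = k" "c i = a" "j < n" "\<tau> j = k" "c j = b" by auto
      then have "\<tau> i = \<tau> j \<and> c i < c j" using ab(3) by simp
      then have "x (\<tau> i) (c i) < x (\<tau> j) (c j)" using r ij(1,4) by blast
      then show ?thesis by (simp only: ij)
    qed
    then show "x k \<in> chamber p" using x k by (auto simp: chamber_iff space_PiM PiE_iff)
  next
    fix k assume "k \<notin> {..<m}"
    then show "x k = undefined" using x by (auto simp: space_PiM PiE_iff extensional_def)
  qed
qed

text \<open>Relabelling preserves the product measure on cubes by \<open>distr_relabel\<close>, and
  it turns the chamber conditions on the configurations into the order conditions \<open>G\<close>
  on the points.\<close>

lemma integral_path_relabel:
  fixes \<tau> c :: "nat \<Rightarrow> nat" and F :: "(nat \<Rightarrow> real) \<Rightarrow> real"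
  assumes bij: "bij_betw (\<lambda>i. (\<tau> i, c i)) {..<n} ({..<m} \<times> {..<p})"
    and F: "F \<in> borel_measurable (cube_lborel n)"
  defines "G \<equiv> {y. \<forall>i<n. \<forall>j<n. \<tau> i = \<tau> j \<and> c i < c j \<longrightarrow> y i < y j}"
  shows "(LINT x|path_lborel p m. F (\<lambda>i\<in>{..<n}. x (\<tau> i) (c i))) = (LINT y|cube_lborel n. indicator G y * F y)"
    and "integrable (cube_lborel n) F \<Longrightarrow> integrable (path_lborel p m) (\<lambda>x. F (\<lambda>i\<in>{..<n}. x (\<tau> i) (c i)))"
    and "integrable (cube_lborel n) F \<Longrightarrow> integrable (cube_lborel n) (\<lambda>y. indicator G y * F y)"
proof -
  let ?h = "\<lambda>x. \<lambda>i\<in>{..<n}. x (\<tau> i) (c i)"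
  let ?N = "PiM {..<m} (\<lambda>_. cube_lborel p)"
  let ?GS = "{y \<in> space (cube_lborel n). \<forall>i\<in>{..<n}. \<forall>j\<in>{..<n}. \<tau> i = \<tau> j \<and> c i < c j \<longrightarrow> y i < y j}"
  let ?\<Omega> = "\<Pi>\<^sub>E k\<in>{..<m}. chamber p"
  have [measurable]: "i \<in> {..<n} \<Longrightarrow> (\<lambda>x. x i) \<in> borel_measurable (cube_lborel n)" for i
    by (rule cube_component) simp
  note [measurable] = F
  note h = distr_relabel(2)[OF bij]
  have Gset: "?GS \<in> sets (cube_lborel n)"
    by measurable
  have Gi: "indicator G y = (indicator ?GS y :: real)"
    if "y \<in> space (cube_lborel n)" for y
    using that by (auto simp: G_def indicator_def)
  have GF: "(\<lambda>y. indicator G y * F y) \<in> borel_measurable (cube_lborel n)"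
    using borel_measurable_times[OF borel_measurable_indicator[OF Gset] F] Gi
    by (simp cong: measurable_cong)
  have \<Omega>: "?\<Omega> \<inter> space ?N \<in> sets ?N"
    using chamber_sets[of p] by (intro sets.Int sets_PiM_I_finite) auto
  have eq: "indicator ?\<Omega> x *\<^sub>R F (?h x) = indicator G (?h x) * F (?h x)" if "x \<in> space ?N" for x
  proof -
    have "x \<in> ?\<Omega> \<longleftrightarrow> ?h x \<in> G"
      unfolding path_mem_iff[OF bij that] G_def by auto
    then show ?thesis by (simp add: indicator_def)
  qed
  have "(LINT x|path_lborel p m. F (?h x)) = (LINT x|?N. indicator ?\<Omega> x *\<^sub>R F (?h x))"
    unfolding path_lborel_eq by (rule integral_restrict_space[OF \<Omega>])
  also have "\<dots> = (LINT x|?N. indicator G (?h x) * F (?h x))"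
    by (rule Bochner_Integration.integral_cong[OF refl eq])
  also have "\<dots> = (LINT y|distr ?N (cube_lborel n) ?h. indicator G y * F y)"
    by (rule integral_distr[OF h GF, symmetric])
  finally show "(LINT x|path_lborel p m. F (?h x)) = (LINT y|cube_lborel n. indicator G y * F y)"
    by (simp only: distr_relabel(1)[OF bij])
  assume int: "integrable (cube_lborel n) F"
  have "integrable (cube_lborel n) (\<lambda>y. indicator ?GS y *\<^sub>R F y)"
    by (rule integrable_mult_indicator[OF Gset int])
  then show "integrable (cube_lborel n) (\<lambda>y. indicator G y * F y)"
    using Gi by (simp cong: Bochner_Integration.integrable_cong)
  have "integrable (distr ?N (cube_lborel n) ?h) F" using int by (simp only: distr_relabel(1)[OF bij])
  then have "integrable ?N (\<lambda>x. F (?h x))" by (rule integrable_distr[OF h])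
  then have "integrable ?N (\<lambda>x. indicator (?\<Omega> \<inter> space ?N) x *\<^sub>R F (?h x))"
    by (rule integrable_mult_indicator[OF \<Omega>])
  then have "integrable ?N (\<lambda>x. indicator ?\<Omega> x *\<^sub>R F (?h x))"
    by (rule Bochner_Integration.integrable_cong[THEN iffD1, OF refl, rotated]) (auto simp: indicator_def)
  then show "integrable (path_lborel p m) (\<lambda>x. F (?h x))"
    unfolding path_lborel_eq by (subst integrable_restrict_space[OF \<Omega>])
qed

text \<open>\<open>c i\<close> is the coordinate that the \<open>i\<close>-th point occupies in its
  configuration. Coordinates of a configuration being distinct, injectivity expresses that the pairs
  of point and time are distinct. The type of the values of \<open>\<tau>\<close> is open because
  they are sometimes real times and sometimes indices of times.\<close>

definition labellings :: "nat \<Rightarrow> nat \<Rightarrow> (nat \<Rightarrow> 'b) \<Rightarrow> (nat \<Rightarrow> nat) set" where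
  "labellings p n \<tau> = {c \<in> {..<n} \<rightarrow>\<^sub>E {..<p}. inj_on (\<lambda>i. (c i, \<tau> i)) {..<n}}"

lemma finite_labellings: "finite (labellings p n \<tau>)"
  unfolding labellings_def by (rule finite_subset[of _ "{..<n} \<rightarrow>\<^sub>E {..<p}"]) (auto intro!: finite_PiE)

lemma card_fibres:
  fixes \<tau> :: "nat \<Rightarrow> nat"
  assumes "\<And>i. i < n \<Longrightarrow> \<tau> i < m" "\<And>k. k < m \<Longrightarrow> card {i. i < n \<and> \<tau> i = k} = p"
  shows "n = m * p"
proof -
  have "{..<n} = (\<Union>k\<in>{..<m}. {i. i < n \<and> \<tau> i = k})" using assms(1) by auto
  then have "card {..<n} = card (\<Union>k\<in>{..<m}. {i. i < n \<and> \<tau> i = k})" by (rule arg_cong)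
  also have "\<dots> = (\<Sum>k<m. card {i. i < n \<and> \<tau> i = k})"
    by (rule card_UN_disjoint) auto
  also have "\<dots> = m * p" using assms(2) by simp
  finally show ?thesis by simp
qed

lemma labelling_bij:
  fixes \<tau> :: "nat \<Rightarrow> nat"
  assumes "\<And>i. i < n \<Longrightarrow> \<tau> i < m" "\<And>k. k < m \<Longrightarrow> card {i. i < n \<and> \<tau> i = k} = p"
    and c: "c \<in> labellings p n \<tau>"
  shows "bij_betw (\<lambda>i. (\<tau> i, c i)) {..<n} ({..<m} \<times> {..<p})"
proof -
  have inj: "inj_on (\<lambda>i. (\<tau> i, c i)) {..<n}" using c by (auto simp: labellings_def inj_on_def)
  have "(\<lambda>i. (\<tau> i, c i)) ` {..<n} = {..<m} \<times> {..<p}"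
  proof (rule card_subset_eq)
    show "(\<lambda>i. (\<tau> i, c i)) ` {..<n} \<subseteq> {..<m} \<times> {..<p}"
      using assms(1) c by (auto simp: labellings_def PiE_iff)
    show "card ((\<lambda>i. (\<tau> i, c i)) ` {..<n}) = card ({..<m} \<times> {..<p})"
      unfolding card_image[OF inj] using card_fibres[OF assms(1,2)] by (simp add: card_cartesian_product)
  qed simp
  then show ?thesis using inj by (simp add: bij_betw_def)
qed

text \<open>The only labelling compatible with the order of distinct points is by their rank.\<close>

lemma card_ordered_labellings:
  fixes \<tau> :: "nat \<Rightarrow> nat"
  assumes \<tau>: "\<And>i. i < n \<Longrightarrow> \<tau> i < m" and fib: "\<And>k. k < m \<Longrightarrow> card {i. i < n \<and> \<tau> i = k} = p"
    and y: "\<And>i j. i < n \<Longrightarrow> j < n \<Longrightarrow> \<tau> i = \<tau> j \<Longrightarrow> y i = (y j :: real) \<Longrightarrow> i = j"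
  shows "card {c \<in> labellings p n \<tau>. \<forall>i<n. \<forall>j<n. \<tau> i = \<tau> j \<and> c i < c j \<longrightarrow> y i < y j} = 1"
proof -
  define r where "r = (\<lambda>i\<in>{..<n}. card {j. j < n \<and> \<tau> j = \<tau> i \<and> y j < y i})"
  have r_less: "r i < r j" if "i < n" "j < n" "\<tau> i = \<tau> j" "y i < y j" for i j
  proof -
    have "{l. l < n \<and> \<tau> l = \<tau> i \<and> y l < y i} \<subset> {l. l < n \<and> \<tau> l = \<tau> j \<and> y l < y j}"
      using that by auto
    then show ?thesis using that by (simp add: r_def psubset_card_mono)
  qed
  have r: "r \<in> labellings p n \<tau>"
    unfolding labellings_def
  proof (intro CollectI conjI)
    show "r \<in> {..<n} \<rightarrow>\<^sub>E {..<p}"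
    proof (rule PiE_I)
      fix i assume i: "i \<in> {..<n}"
      have "{j. j < n \<and> \<tau> j = \<tau> i \<and> y j < y i} \<subset> {j. j < n \<and> \<tau> j = \<tau> i}" using i by auto
      then have "r i < card {j. j < n \<and> \<tau> j = \<tau> i}" using i by (simp add: r_def psubset_card_mono)
      then show "r i \<in> {..<p}" using fib[OF \<tau>] i by simp
    qed (simp add: r_def)
    show "inj_on (\<lambda>i. (r i, \<tau> i)) {..<n}"
    proof (rule inj_onI)
      fix i j assume ij: "i \<in> {..<n}" "j \<in> {..<n}" "(r i, \<tau> i) = (r j, \<tau> j)"
      then have "\<not> y i < y j" "\<not> y j < y i" using r_less[of i j] r_less[of j i] by auto
      then show "i = j" using y[of i j] ij by auto
    qed
  qed
  have uniq: "c = r" if c: "c \<in> labellings p n \<tau>"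
    and ord: "\<forall>i<n. \<forall>j<n. \<tau> i = \<tau> j \<and> c i < c j \<longrightarrow> y i < y j" for c
  proof (rule extensionalityI[of _ "{..<n}"])
    show "c \<in> extensional {..<n}" "r \<in> extensional {..<n}"
      using c r by (auto simp: labellings_def PiE_iff)
    fix i assume i: "i \<in> {..<n}"
    let ?F = "{j. j < n \<and> \<tau> j = \<tau> i}"
    have inj: "inj_on c ?F" using c by (auto simp: labellings_def inj_on_def)
    have "c ` ?F = {..<p}"
    proof (rule card_subset_eq)
      show "c ` ?F \<subseteq> {..<p}" using c by (auto simp: labellings_def PiE_iff)
      show "card (c ` ?F) = card {..<p}" using fib[OF \<tau>] i by (simp add: card_image[OF inj])
    qed simp
    moreover have ci: "c i < p" using c i by (auto simp: labellings_def PiE_iff)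
    ultimately have "c ` {j \<in> ?F. c j < c i} = {..<c i}" by (auto simp: image_iff set_eq_iff) (metis less_trans)
    moreover have "inj_on c {j \<in> ?F. c j < c i}" by (rule inj_on_subset[OF inj]) auto
    ultimately have "c i = card {j \<in> ?F. c j < c i}" using card_image by fastforce
    also have "{j \<in> ?F. c j < c i} = {j. j < n \<and> \<tau> j = \<tau> i \<and> y j < y i}"
    proof (intro Collect_cong)
      fix j
      have "c j < c i \<longleftrightarrow> y j < y i" if j: "j < n" "\<tau> j = \<tau> i"
      proof
        show "y j < y i" if "c j < c i" using ord j i that by auto
        show "c j < c i" if "y j < y i"
        proof (rule ccontr)
          assume "\<not> c j < c i"
          then consider "c i < c j" | "c i = c j" by linarith
          then show False
          proof cases
            case 1
            then have "y i < y j" using ord i j by simp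
            then show False using that by simp
          next
            case 2
            then have "i = j" by (intro inj_onD[OF inj 2]) (use i j in simp_all)
            then show False using that by simp
          qed
        qed
      qed
      then show "(j \<in> ?F \<and> c j < c i) = (j < n \<and> \<tau> j = \<tau> i \<and> y j < y i)" by auto
    qed
    finally show "c i = r i" using i by (simp add: r_def)
  qed
  have r_ord: "\<forall>i<n. \<forall>j<n. \<tau> i = \<tau> j \<and> r i < r j \<longrightarrow> y i < y j"
  proof clarify
    fix i j assume ij: "i < n" "j < n" "\<tau> i = \<tau> j" "r i < r j"
    show "y i < y j"
    proof (rule ccontr)
      assume "\<not> y i < y j"
      then consider "y j < y i" | "y i = y j" by linarith
      then show False
      proof cases
        case 1
        then show False using r_less[of j i] ij by simp
      next
        case 2
        then show False using y[of i j] ij by simp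
      qed
    qed
  qed
  have "{c \<in> labellings p n \<tau>. \<forall>i<n. \<forall>j<n. \<tau> i = \<tau> j \<and> c i < c j \<longrightarrow> y i < y j} = {r}"
    using r r_ord uniq by blast
  then show ?thesis by simp
qed

text \<open>Away from coincidences exactly one labelling respects the order of the points, so the
  indicators of the ordered regions add up to 1; at coincidences \<open>F\<close> is zero by
  \<open>F0\<close>. The sum over labellings thus removes the ordering inside each
  configuration.\<close>

lemma sum_labellings_integral:
  fixes \<tau> :: "nat \<Rightarrow> nat" and F :: "(nat \<Rightarrow> real) \<Rightarrow> real"
  assumes \<tau>: "\<And>i. i < n \<Longrightarrow> \<tau> i < m" and fib: "\<And>k. k < m \<Longrightarrow> card {i. i < n \<and> \<tau> i = k} = p"
    and F: "integrable (cube_lborel n) F"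
    and F0: "\<And>y i j. i < n \<Longrightarrow> j < n \<Longrightarrow> i \<noteq> j \<Longrightarrow> \<tau> i = \<tau> j \<Longrightarrow> y i = y j \<Longrightarrow> F y = 0"
  shows "(\<Sum>c\<in>labellings p n \<tau>. LINT x|path_lborel p m. F (\<lambda>i\<in>{..<n}. x (\<tau> i) (c i))) = (LINT y|cube_lborel n. F y)"
proof -
  let ?G = "\<lambda>c. {y. \<forall>i<n. \<forall>j<n. \<tau> i = \<tau> j \<and> c i < c j \<longrightarrow> (y i :: real) < y j}"
  have Fm: "F \<in> borel_measurable (cube_lborel n)" using F by simp
  have bij: "bij_betw (\<lambda>i. (\<tau> i, c i)) {..<n} ({..<m} \<times> {..<p})" if "c \<in> labellings p n \<tau>" for c
    using labelling_bij[OF \<tau> fib that] .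
  have "(\<Sum>c\<in>labellings p n \<tau>. LINT x|path_lborel p m. F (\<lambda>i\<in>{..<n}. x (\<tau> i) (c i))) =
      (\<Sum>c\<in>labellings p n \<tau>. LINT y|cube_lborel n. indicator (?G c) y * F y)"
    using integral_path_relabel(1)[OF bij Fm] by (intro sum.cong) auto
  also have "\<dots> = (LINT y|cube_lborel n. (\<Sum>c\<in>labellings p n \<tau>. indicator (?G c) y * F y))"
    using integral_path_relabel(3)[OF bij Fm F] by (intro Bochner_Integration.integral_sum[symmetric]) auto
  also have "\<dots> = (LINT y|cube_lborel n. F y)"
  proof (rule Bochner_Integration.integral_cong[OF refl])
    fix y
    show "(\<Sum>c\<in>labellings p n \<tau>. indicator (?G c) y * F y) = F y"
    proof (cases "\<forall>i<n. \<forall>j<n. \<tau> i = \<tau> j \<longrightarrow> y i = y j \<longrightarrow> i = j")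
      case True
      have "(\<Sum>c\<in>labellings p n \<tau>. indicator (?G c) y) =
          (\<Sum>c\<in>labellings p n \<tau>. of_bool (\<forall>i<n. \<forall>j<n. \<tau> i = \<tau> j \<and> c i < c j \<longrightarrow> y i < y j))"
        by (intro sum.cong) (auto simp: indicator_def)
      also have "\<dots> = real (card {c \<in> labellings p n \<tau>. \<forall>i<n. \<forall>j<n. \<tau> i = \<tau> j \<and> c i < c j \<longrightarrow> y i < y j})"
        using finite_labellings[of p n \<tau>] by (simp add: of_bool_def sum.If_cases Int_def)
      also have "\<dots> = 1" using card_ordered_labellings[OF \<tau> fib, of y] True by simp
      finally show ?thesis by (simp add: sum_distrib_right[symmetric])
    next
      case False
      then have "F y = 0" using F0 by blast
      then show ?thesis by simp
    qed
  qed
  finally show ?thesis .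
qed

context spectral_kernel
begin

definition \<phi>det :: "(nat \<Rightarrow> real) \<Rightarrow> real" where
  "\<phi>det X = pdet {..<p} (\<lambda>a q. \<phi> q (X a))"

definition hdet :: "real \<Rightarrow> (nat \<Rightarrow> real) \<Rightarrow> (nat \<Rightarrow> real) \<Rightarrow> real" where
  "hdet \<tau> X Y = pdet {..<p} (\<lambda>a b. heat \<tau> (X a) (Y b))"

definition Etot :: real where
  "Etot = (\<Sum>q<p. E q)"

text \<open>Up to the constant \<open>Z\<close>, the joint density at the times \<open>s 0\<close>,
  ..., \<open>s (m - 1)\<close>. The stationary density contributes the square of
  \<open>\<phi>det (x 0)\<close>, and the quotients of \<open>\<phi>det\<close> in the transition
  densities telescope to \<open>\<phi>det (x (m - 1)) / \<phi>det (x 0)\<close>. For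
  \<open>m = 1\<close> the product is empty and the square remains.\<close>

definition path_density :: "(nat \<Rightarrow> real) \<Rightarrow> nat \<Rightarrow> (nat \<Rightarrow> nat \<Rightarrow> real) \<Rightarrow> real" where
  "path_density s m x = \<phi>det (x 0) *
     (\<Prod>k<m - 1. exp ((s (Suc k) - s k) * Etot) * hdet (s (Suc k) - s k) (x k) (x (Suc k))) * \<phi>det (x (m - 1))"

text \<open>The index \<open>\<tau> i * p + c i\<close> lists the points time by time, which makes
  \<open>det_time_ordered\<close> applicable. The exponentials from splitting \<open>ker\<close>
  factor out of the columns of the two outer determinants and combine to the exponential of
  \<open>Etot\<close> times the total time span, the same as the telescoping product in
  \<open>path_density\<close>.\<close>

lemma rho_eq_path_density:
  assumes bij: "bij_betw (\<lambda>i. (\<tau> i, c i)) {..<n} ({..<m} \<times> {..<p})"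
    and t: "\<And>i. i < n \<Longrightarrow> t i = s (\<tau> i)" and m: "m > 0"
    and s: "\<And>k l. l < m \<Longrightarrow> k < l \<Longrightarrow> s k < s l"
    and x: "\<And>k. k < m \<Longrightarrow> x k \<in> chamber p"
  shows "rho n t (\<lambda>i\<in>{..<n}. x (\<tau> i) (c i)) = path_density s m x"
proof -
  define X where "X i = x (i div p) (i mod p)" for i
  define S where "S i = s (i div p)" for i
  let ?e = "\<lambda>i. \<tau> i * p + c i"
  have lt: "\<tau> i < m" "c i < p" if "i < n" for i using bij_betwE[OF bij] that by auto
  have e: "bij_betw ?e {..<n} {..<m * p}"
    using bij_betw_trans[OF bij bij_betw_div_mod(1)] by (simp add: o_def)
  have edm: "?e i div p = \<tau> i" "?e i mod p = c i" if "i < n" for i using lt[OF that] by auto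
  have kdm: "(k * p + a) div p = k" "(k * p + a) mod p = a" if "a < p" for k a using that by auto
  have Xu: "X i \<in> {0<..<1}" if "i < m * p" for i
  proof -
    have "p > 0" using that by (cases p) auto
    then show ?thesis
      unfolding X_def using that by (intro chamber_unit[OF x]) (auto simp: less_mult_imp_div_less)
  qed
  let ?U = "\<lambda>i q. exp (S i * E q) * \<phi> q (X i)" and ?V = "\<lambda>j q. exp (- S j * E q) * \<phi> q (X j)"
  let ?R = "\<lambda>i j. if S i < S j then heat (S j - S i) (X i) (X j) else 0"
  have "rho n t (\<lambda>i\<in>{..<n}. x (\<tau> i) (c i)) =
      pdet {..<n} (\<lambda>i j. ker (S (?e i)) (S (?e j)) (X (?e i)) (X (?e j)))"
    unfolding rho_def by (rule pdet_cong) (simp add: S_def X_def lt edm t)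
  also have "\<dots> = pdet {..<m * p} (\<lambda>i j. ker (S i) (S j) (X i) (X j))"
    by (rule pdet_reindex[OF e finite_lessThan, symmetric])
  also have "\<dots> = pdet {..<m * p} (\<lambda>i j. (\<Sum>q<p. ?U i q * ?V j q) - ?R i j)"
    by (intro pdet_cong ker_eq_diff) (use Xu in auto)
  also have "\<dots> = det (mat p p (\<lambda>(a, q). ?U ((m - 1) * p + a) q)) *
    (\<Prod>k<m - 1. det (mat p p (\<lambda>(a, b). ?R (k * p + a) (Suc k * p + b)))) *
    det (mat p p (\<lambda>(b, q). ?V b q))"
    unfolding det_eq_pdet[symmetric, of "m * p"]
  proof (rule det_time_ordered[OF _ m])
    fix i j assume i: "i < m * p" and ji: "j div p \<le> i div p"
    have "i div p < m" using i by (simp add: less_mult_imp_div_less)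
    then have "S j \<le> S i" unfolding S_def using s[of "i div p" "j div p"] ji by (cases "i div p = j div p") auto
    then show "?R i j = 0" by simp
  qed
  also have "det (mat p p (\<lambda>(a, q). ?U ((m - 1) * p + a) q)) = exp (s (m - 1) * Etot) * \<phi>det (x (m - 1))"
  proof -
    have "det (mat p p (\<lambda>(a, q). ?U ((m - 1) * p + a) q)) =
        pdet {..<p} (\<lambda>a q. exp (s (m - 1) * E q) * \<phi> q (x (m - 1) a))"
      unfolding det_eq_pdet by (rule pdet_cong) (simp add: S_def X_def kdm)
    then show ?thesis
      by (simp only: pdet_scale_columns \<phi>det_def Etot_def sum_distrib_left exp_sum[OF finite_lessThan])
  qed
  also have "det (mat p p (\<lambda>(b, q). ?V b q)) = exp (- s 0 * Etot) * \<phi>det (x 0)"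
  proof -
    have "det (mat p p (\<lambda>(b, q). ?V b q)) = pdet {..<p} (\<lambda>a q. exp (- s 0 * E q) * \<phi> q (x 0 a))"
      unfolding det_eq_pdet by (rule pdet_cong) (simp add: S_def X_def)
    then show ?thesis
      by (simp only: pdet_scale_columns \<phi>det_def Etot_def sum_distrib_left exp_sum[OF finite_lessThan])
  qed
  also have "(\<Prod>k<m - 1. det (mat p p (\<lambda>(a, b). ?R (k * p + a) (Suc k * p + b)))) =
      (\<Prod>k<m - 1. hdet (s (Suc k) - s k) (x k) (x (Suc k)))"
  proof (rule prod.cong[OF refl])
    fix k assume "k \<in> {..<m - 1}"
    then have sk: "s k < s (Suc k)" by (intro s) auto
    show "det (mat p p (\<lambda>(a, b). ?R (k * p + a) (Suc k * p + b))) = hdet (s (Suc k) - s k) (x k) (x (Suc k))"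
      unfolding det_eq_pdet hdet_def by (rule pdet_cong) (simp only: lessThan_iff S_def X_def kdm sk if_True)
  qed
  also have "exp (s (m - 1) * Etot) * \<phi>det (x (m - 1)) *
      (\<Prod>k<m - 1. hdet (s (Suc k) - s k) (x k) (x (Suc k))) * (exp (- s 0 * Etot) * \<phi>det (x 0)) =
      path_density s m x"
  proof -
    have "(\<Prod>k<m - 1. exp ((s (Suc k) - s k) * Etot)) = exp ((\<Sum>k<m - 1. s (Suc k) - s k) * Etot)"
      by (simp only: sum_distrib_right exp_sum[OF finite_lessThan])
    also have "\<dots> = exp (s (m - 1) * Etot) * exp (- s 0 * Etot)"
      unfolding sum_lessThan_telescope exp_add[symmetric] by (simp add: algebra_simps)
    finally have "(\<Prod>k<m - 1. exp ((s (Suc k) - s k) * Etot)) = exp (s (m - 1) * Etot) * exp (- s 0 * Etot)" .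
    then show ?thesis unfolding path_density_def prod.distrib by (simp only: mult_ac)
  qed
  finally show ?thesis .
qed

end

section \<open>Correlation functions of the process\<close>

text \<open>Forgetting the last label is a map whose fibres all have the same size: the new point
  may take any coordinate that the old points at time \<open>s\<close> leave free. The hypothesis
  \<open>r\<close> makes the natural number difference agree with the real one.\<close>

lemma sum_labellings_Suc:
  fixes h :: "(nat \<Rightarrow> nat) \<Rightarrow> real"
  assumes r: "card {i. i < n \<and> t i = s} \<le> p"
  shows "(\<Sum>c\<in>labellings p (Suc n) (t(n := s)). h (restrict c {..<n})) =
    (real p - real (card {i. i < n \<and> t i = s})) * (\<Sum>c\<in>labellings p n t. h c)"
proof -
  let ?R = "{i. i < n \<and> t i = s}"
  let ?B = "\<lambda>c. {..<p} - c ` ?R"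
  have cardB: "card (?B c) = p - card ?R" if c: "c \<in> labellings p n t" for c
  proof -
    have "inj_on c ?R" using c by (auto simp: labellings_def inj_on_def)
    moreover have "c ` ?R \<subseteq> {..<p}" using c by (auto simp: labellings_def PiE_iff)
    ultimately show ?thesis by (simp add: card_Diff_subset card_image)
  qed
  have "(\<Sum>c\<in>labellings p (Suc n) (t(n := s)). h (restrict c {..<n})) =
      (\<Sum>(c, b)\<in>Sigma (labellings p n t) ?B. h c)"
  proof (rule sum.reindex_bij_witness[of _ "\<lambda>(c, b). c(n := b)" "\<lambda>c. (restrict c {..<n}, c n)"])
    fix c assume c: "c \<in> labellings p (Suc n) (t(n := s))"
    then have ext: "c \<in> {..<Suc n} \<rightarrow>\<^sub>E {..<p}"
      and inj_c: "inj_on (\<lambda>i. (c i, (t(n := s)) i)) {..<Suc n}"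
      by (simp_all add: labellings_def)
    have inj: "i = j" if "i < Suc n" "j < Suc n" "c i = c j" "(t(n := s)) i = (t(n := s)) j" for i j
      by (rule inj_onD[OF inj_c]) (use that in simp_all)
    show "(case (restrict c {..<n}, c n) of (c, b) \<Rightarrow> c(n := b)) = c"
      using ext by (auto simp: fun_eq_iff PiE_iff extensional_def)
    have "c n \<notin> restrict c {..<n} ` ?R"
    proof
      assume "c n \<in> restrict c {..<n} ` ?R"
      then obtain i where i: "i < n" "t i = s" "c n = c i" by auto
      have "n = i" by (rule inj) (use i in simp_all)
      then show False using i by simp
    qed
    moreover have "restrict c {..<n} \<in> labellings p n t"
      unfolding labellings_def
    proof (intro CollectI conjI)
      show "restrict c {..<n} \<in> {..<n} \<rightarrow>\<^sub>E {..<p}" using ext by (auto simp: PiE_iff)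
      show "inj_on (\<lambda>i. (restrict c {..<n} i, t i)) {..<n}"
        by (rule inj_onI, rule inj) simp_all
    qed
    moreover have "c n < p" using ext by (auto simp: PiE_iff)
    ultimately show "(restrict c {..<n}, c n) \<in> Sigma (labellings p n t) ?B" by auto
    show "(case (restrict c {..<n}, c n) of (c, b) \<Rightarrow> h c) = h (restrict c {..<n})" by simp
  next
    fix cb assume "cb \<in> Sigma (labellings p n t) ?B"
    then obtain c b where cb: "cb = (c, b)" "c \<in> labellings p n t" "b < p" "b \<notin> c ` ?R" by auto
    then have ext: "c \<in> {..<n} \<rightarrow>\<^sub>E {..<p}"
      and inj_c: "inj_on (\<lambda>i. (c i, t i)) {..<n}"
      by (simp_all add: labellings_def)
    have inj: "i = j" if "i < n" "j < n" "c i = c j" "t i = t j" for i j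
      by (rule inj_onD[OF inj_c]) (use that in simp_all)
    show "(restrict (case cb of (c, b) \<Rightarrow> c(n := b)) {..<n}, (case cb of (c, b) \<Rightarrow> c(n := b)) n) = cb"
      using ext cb(1) by (auto simp: fun_eq_iff PiE_iff extensional_def)
    have "inj_on (\<lambda>i. ((c(n := b)) i, (t(n := s)) i)) {..<Suc n}"
    proof (rule inj_onI)
      fix i j assume "i \<in> {..<Suc n}" "j \<in> {..<Suc n}"
        and eq: "((c(n := b)) i, (t(n := s)) i) = ((c(n := b)) j, (t(n := s)) j)"
      then consider "i = n" "j = n" | "i = n" "j < n" | "i < n" "j = n" | "i < n" "j < n"
        by (auto simp: less_Suc_eq)
      then show "i = j"
      proof cases
        case 2
        then have "j \<in> ?R" "b = c j" using eq by auto
        then show ?thesis using cb(4) by blast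
      next
        case 3
        then have "i \<in> ?R" "b = c i" using eq by auto
        then show ?thesis using cb(4) by blast
      next
        case 4
        show ?thesis by (rule inj) (use 4 eq in simp_all)
      qed simp
    qed
    moreover have "c(n := b) \<in> {..<Suc n} \<rightarrow>\<^sub>E {..<p}"
      using ext cb(3) by (auto simp: PiE_iff extensional_def less_Suc_eq)
    ultimately show "(case cb of (c, b) \<Rightarrow> c(n := b)) \<in> labellings p (Suc n) (t(n := s))"
      by (simp add: labellings_def cb(1))
  qed
  also have "\<dots> = (\<Sum>c\<in>labellings p n t. \<Sum>b\<in>?B c. h c)"
    by (rule sum.Sigma[symmetric]) (auto simp: finite_labellings)
  also have "\<dots> = (real p - real (card ?R)) * (\<Sum>c\<in>labellings p n t. h c)"
    using cardB r by (simp add: sum_distrib_left of_nat_diff)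
  finally show ?thesis .
qed

text \<open>A configuration in the chamber has distinct coordinates, so choosing elements of its
  point set amounts to choosing their indices.\<close>

lemma correlation_sum_eq:
  assumes J: "\<And>i. i < n \<Longrightarrow> J (t i) \<omega> \<in> chamber p"
  shows "correlation_sum p J n t f \<omega> = (\<Sum>c\<in>labellings p n t. f (\<lambda>i\<in>{..<n}. J (t i) \<omega> (c i)))"
  unfolding correlation_sum_def
proof (rule sum.reindex_bij_betw[symmetric])
  let ?g = "\<lambda>c. \<lambda>i\<in>{..<n}. J (t i) \<omega> (c i)"
  let ?A = "{a. a \<in> (\<Pi>\<^sub>E i\<in>{..<n}. point_set p (J (t i) \<omega>)) \<and> inj_on (\<lambda>i. (a i, t i)) {..<n}}"
  have inj: "a = b" if "i < n" "J (t i) \<omega> a = J (t i) \<omega> b" "a < p" "b < p" for i a b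
    using chamber_inj_on[OF J[OF that(1)]] that by (auto simp: inj_on_def)
  show "bij_betw ?g (labellings p n t) ?A"
    unfolding bij_betw_def
  proof
    show "inj_on ?g (labellings p n t)"
    proof (rule inj_onI)
      fix c d assume c: "c \<in> labellings p n t" and d: "d \<in> labellings p n t" and eq: "?g c = ?g d"
      show "c = d"
      proof (rule extensionalityI[of _ "{..<n}"])
        show "c \<in> extensional {..<n}" "d \<in> extensional {..<n}"
          using c d by (auto simp: labellings_def PiE_iff)
        fix i assume i: "i \<in> {..<n}"
        then show "c i = d i"
          using fun_cong[OF eq, of i] c d by (intro inj[of i]) (auto simp: labellings_def PiE_iff)
      qed
    qed
    show "?g ` labellings p n t = ?A"
    proof (intro equalityI subsetI)
      fix a assume "a \<in> ?g ` labellings p n t"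
      then obtain c where c: "c \<in> labellings p n t" and a: "a = ?g c" by auto
      have cp: "c i < p" if "i < n" for i using c that by (auto simp: labellings_def PiE_iff)
      have "inj_on (\<lambda>i. (a i, t i)) {..<n}"
      proof (rule inj_onI)
        fix i j assume ij: "i \<in> {..<n}" "j \<in> {..<n}" "(a i, t i) = (a j, t j)"
        then have "c i = c j" using cp by (intro inj[of i]) (auto simp: a)
        moreover have "inj_on (\<lambda>i. (c i, t i)) {..<n}" using c by (simp add: labellings_def)
        ultimately show "i = j" using ij by (auto dest: inj_onD)
      qed
      then show "a \<in> ?A" using cp by (auto simp: a point_set_def)
    next
      fix a assume a: "a \<in> ?A"
      define c where "c = (\<lambda>i\<in>{..<n}. SOME b. b < p \<and> J (t i) \<omega> b = a i)"
      have c: "c i < p \<and> J (t i) \<omega> (c i) = a i" if "i < n" for i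
      proof -
        have "\<exists>b. b < p \<and> J (t i) \<omega> b = a i"
        proof -
          have "a i \<in> point_set p (J (t i) \<omega>)" using a that by (auto simp: PiE_iff)
          then show ?thesis unfolding point_set_def by auto
        qed
        then show ?thesis using that someI_ex[of "\<lambda>b. b < p \<and> J (t i) \<omega> b = a i"] by (simp add: c_def)
      qed
      have "inj_on (\<lambda>i. (c i, t i)) {..<n}"
      proof (rule inj_onI)
        fix i j assume ij: "i \<in> {..<n}" "j \<in> {..<n}" "(c i, t i) = (c j, t j)"
        then have "J (t i) \<omega> (c i) = a i" "J (t j) \<omega> (c j) = a j"
          using c[of i] c[of j] by simp_all
        then have "a i = a j" using ij(3) by simp
        moreover have "inj_on (\<lambda>i. (a i, t i)) {..<n}" using a by simp
        ultimately show "i = j" using ij by (auto dest: inj_onD)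
      qed
      then have "c \<in> labellings p n t" using c by (auto simp: labellings_def c_def)
      moreover have "a = ?g c"
        by (rule extensionalityI[of _ "{..<n}"]) (use a c in \<open>auto simp: PiE_iff\<close>)
      ultimately show "a \<in> ?g ` labellings p n t" by blast
    qed
  qed
qed

lemma labellings_empty:
  assumes "card {i. i < n \<and> t i = s} > p"
  shows "labellings p n t = {}"
proof (rule ccontr)
  assume "labellings p n t \<noteq> {}"
  then obtain c where c: "c \<in> labellings p n t" by auto
  let ?R = "{i. i < n \<and> t i = s}"
  have "inj_on c ?R" using c by (auto simp: labellings_def inj_on_def)
  moreover have "c ` ?R \<subseteq> {..<p}" using c by (auto simp: labellings_def PiE_iff)
  ultimately have "card ?R \<le> card {..<p}" by (intro card_inj_on_le) auto
  then show False using assms by simp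
qed

text \<open>The process with its square roots resolved: the stationary density is the square of
  \<open>\<phi>det\<close> up to an unknown constant \<open>Z\<close>, and the prefactor of the
  transition density is a quotient of values of \<open>\<phi>det\<close>. Nothing specific to Jacobi
  polynomials remains.\<close>

locale spectral_process = spectral_kernel p \<phi> B g E
  for p \<phi> B g E +
  fixes M :: "'a measure" and J :: "real \<Rightarrow> 'a \<Rightarrow> nat \<Rightarrow> real" and Z :: real
  assumes prob: "prob_space M"
    and Z_pos: "Z > 0"
    and law: "\<And>t. t \<ge> 0 \<Longrightarrow> distributed M (chamber_lborel p) (J t) (\<lambda>X. ennreal ((\<phi>det X)\<^sup>2 / Z))"
    and markov: "\<And>s t A. s \<ge> 0 \<Longrightarrow> t > 0 \<Longrightarrow> A \<in> sets (chamber_lborel p) \<Longrightarrow>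
      AE \<omega> in M. real_cond_exp M (past M (chamber_lborel p) J s) (\<lambda>\<omega>'. indicator A (J (s + t) \<omega>')) \<omega> =
        (LINT Y:A|chamber_lborel p. \<phi>det Y / \<phi>det (J s \<omega>) * (exp (t * Etot) * hdet t (J s \<omega>) Y))"
    and \<phi>det_nz: "\<And>X. X \<in> chamber p \<Longrightarrow> \<phi>det X \<noteq> 0"
begin

lemma J_measurable: "t \<ge> 0 \<Longrightarrow> J t \<in> measurable M (chamber_lborel p)"
  by (rule distributed_measurable[OF law])

lemma J_chamber: "t \<ge> 0 \<Longrightarrow> \<omega> \<in> space M \<Longrightarrow> J t \<omega> \<in> chamber p"
  using measurable_space[OF J_measurable, of t \<omega>] by simp

lemma \<phi>det_measurable: "\<phi>det \<in> borel_measurable (chamber_lborel p)"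
proof -
  have "(\<lambda>X. \<phi> q (X a)) \<in> borel_measurable (chamber_lborel p)" if "a \<in> {..<p}" for a q
    by (rule measurable_compose[OF chamber_component \<phi>_borel]) (use that in simp)
  then show ?thesis unfolding \<phi>det_def by (rule borel_measurable_pdet)
qed

lemma hdet_measurable:
  assumes u: "u \<in> measurable N (chamber_lborel p)" and v: "v \<in> measurable N (chamber_lborel p)"
  shows "(\<lambda>x. hdet \<tau> (u x) (v x)) \<in> borel_measurable N"
  unfolding hdet_def
  by (intro borel_measurable_pdet heat_measurable measurable_compose[OF u chamber_component]
      measurable_compose[OF v chamber_component]) auto

text \<open>Integrability is pulled back from the cube: on configurations the density equals
  \<open>rho\<close> for the enumeration by quotient and remainder, and \<open>rho\<close> is
  integrable there.\<close>

lemma path_density_integrable: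
  assumes m: "m > 0" and s: "\<And>k l. l < m \<Longrightarrow> k < l \<Longrightarrow> s k < s l"
  shows "integrable (path_lborel p m) (path_density s m)"
proof -
  let ?\<tau> = "\<lambda>i. i div p" and ?c = "\<lambda>i. i mod p"
  note bij = bij_betw_div_mod(2)[of p m]
  let ?t = "\<lambda>i. s (i div p)"
  have "integrable (path_lborel p m) (\<lambda>x. rho (m * p) ?t (\<lambda>i\<in>{..<m * p}. x (?\<tau> i) (?c i)))"
    by (rule integral_path_relabel(2)[OF bij rho_measurable rho_integrable])
  then show ?thesis
  proof (rule Bochner_Integration.integrable_cong[THEN iffD1, OF refl, rotated])
    fix x assume "x \<in> space (path_lborel p m)"
    then have "x k \<in> chamber p" if "k < m" for k using that by (auto simp: space_PiM PiE_iff)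
    then show "rho (m * p) ?t (\<lambda>i\<in>{..<m * p}. x (?\<tau> i) (?c i)) = path_density s m x"
      by (intro rho_eq_path_density[OF bij _ m s]) auto
  qed
qed

lemma path_density_Suc:
  assumes m: "m > 0" and nz: "\<phi>det (x (m - 1)) \<noteq> 0"
  shows "path_density s (Suc m) (x(m := Y)) = path_density s m x *
    (\<phi>det Y / \<phi>det (x (m - 1)) * (exp ((s m - s (m - 1)) * Etot) * hdet (s m - s (m - 1)) (x (m - 1)) Y))"
proof -
  obtain l where l: "m = Suc l" using m by (cases m) auto
  have "(\<Prod>k<l. exp ((s (Suc k) - s k) * Etot) * hdet (s (Suc k) - s k) ((x(Suc l := Y)) k) ((x(Suc l := Y)) (Suc k))) =
      (\<Prod>k<l. exp ((s (Suc k) - s k) * Etot) * hdet (s (Suc k) - s k) (x k) (x (Suc k)))"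
    by (rule prod.cong) auto
  then show ?thesis using nz unfolding path_density_def l by simp
qed

section \<open>Finite-dimensional distributions from the Markov property\<close>

definition trajectory :: "(nat \<Rightarrow> real) \<Rightarrow> nat \<Rightarrow> 'a \<Rightarrow> nat \<Rightarrow> nat \<Rightarrow> real" where
  "trajectory s m \<omega> = (\<lambda>k\<in>{..<m}. J (s k) \<omega>)"

lemma trajectory_measurable:
  assumes "\<And>k. k < m \<Longrightarrow> s k \<ge> 0"
  shows "trajectory s m \<in> measurable M (path_lborel p m)"
  unfolding trajectory_def by (rule measurable_restrict) (use assms J_measurable in auto)

text \<open>Boxes form a generator stable under intersection, so they determine the joint law. The
  formulation with an integral makes sense before \<open>path_density\<close> is known to be
  nonnegative.\<close>

definition box_law :: "(nat \<Rightarrow> real) \<Rightarrow> nat \<Rightarrow> bool" where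
  "box_law s m \<longleftrightarrow> (\<forall>A. (\<forall>k<m. A k \<in> sets (chamber_lborel p)) \<longrightarrow>
     measure M {\<omega> \<in> space M. \<forall>k<m. J (s k) \<omega> \<in> A k} =
     (LINT x|path_lborel p m. indicator (\<Pi>\<^sub>E k\<in>{..<m}. A k) x * (path_density s m x / Z)))"

lemma joint_law_if_box_law:
  assumes m: "m > 0" and s: "\<And>k l. l < m \<Longrightarrow> k < l \<Longrightarrow> s k < s l"
    and s0: "\<And>k. k < m \<Longrightarrow> s k \<ge> 0" and box: "box_law s m"
  shows "distr M (path_lborel p m) (trajectory s m) = density (path_lborel p m) (\<lambda>x. ennreal (path_density s m x / Z))"
    and "AE x in path_lborel p m. 0 \<le> path_density s m x / Z"
proof -
  interpret prob_space M by (rule prob)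
  let ?L = "\<lambda>_::nat. chamber_lborel p"
  let ?N = "path_lborel p m"
  have X: "trajectory s m \<in> measurable M ?N" by (rule trajectory_measurable) (rule s0)
  have h: "integrable ?N (\<lambda>x. path_density s m x / Z)"
    using path_density_integrable[OF m s] by simp
  have fin: "finite_measure (distr M ?N (trajectory s m))"
    by (rule prob_space.finite_measure[OF prob_space_distr[OF X]])
  have G: "prod_algebra {..<m} ?L \<subseteq> Pow (space ?N)"
    using prod_algebra_sets_into_space[of "{..<m}" ?L] by (simp add: space_PiM)
  have Gs: "sets ?N = sigma_sets (space ?N) (prod_algebra {..<m} ?L)"
    by (simp only: sets_PiM space_PiM)
  have sp: "space ?N \<in> prod_algebra {..<m} ?L"
    unfolding prod_algebra_eq_finite[OF finite_lessThan] space_PiM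
    by (intro CollectI exI[of _ "\<lambda>_. space (chamber_lborel p)"]) (auto simp del: space_chamber_lborel)
  have eq: "measure (distr M ?N (trajectory s m)) A = (LINT x|?N. indicator A x * (path_density s m x / Z))"
    if "A \<in> prod_algebra {..<m} ?L" for A
  proof -
    from that obtain A' where A': "\<forall>k<m. A' k \<in> sets (chamber_lborel p)" and A: "A = (\<Pi>\<^sub>E k\<in>{..<m}. A' k)"
      unfolding prod_algebra_eq_finite[OF finite_lessThan] by auto
    have "A \<in> sets ?N" unfolding A using A' by (intro sets_PiM_I_finite) auto
    then have "measure (distr M ?N (trajectory s m)) A = measure M (trajectory s m -` A \<inter> space M)"
      by (rule measure_distr[OF X])
    also have "trajectory s m -` A \<inter> space M = {\<omega> \<in> space M. \<forall>k<m. J (s k) \<omega> \<in> A' k}"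
      unfolding A trajectory_def using restrict_PiE_iff[of _ "{..<m}" A'] by (simp add: vimage_def Int_def Ball_def conj_commute)
    finally show ?thesis using box A' unfolding box_law_def A by simp
  qed
  note * = density_eqI_generator[OF fin _ h Int_stable_prod_algebra G Gs sp eq]
  show "distr M ?N (trajectory s m) = density ?N (\<lambda>x. ennreal (path_density s m x / Z))"
    by (rule *(1)) simp
  show "AE x in ?N. 0 \<le> path_density s m x / Z"
    by (rule *(2)) simp
qed

lemma past_subalgebra:
  assumes "u \<ge> 0"
  shows "subalgebra M (past M (chamber_lborel p) J u)"
    and "\<And>v A. 0 \<le> v \<Longrightarrow> v \<le> u \<Longrightarrow> A \<in> sets (chamber_lborel p) \<Longrightarrow>
      J v -` A \<inter> space M \<in> sets (past M (chamber_lborel p) J u)"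
proof -
  let ?G = "\<Union>v\<in>{0..u}. {J v -` A \<inter> space M |A. A \<in> sets (chamber_lborel p)}"
  have G: "?G \<subseteq> Pow (space M)" by auto
  have GM: "?G \<subseteq> sets M" using measurable_sets[OF J_measurable] by auto
  have sets: "sets (past M (chamber_lborel p) J u) = sigma_sets (space M) ?G"
    unfolding past_def by (rule sets_measure_of[OF G])
  have space: "space (past M (chamber_lborel p) J u) = space M"
    unfolding past_def by (rule space_measure_of[OF G])
  show "subalgebra M (past M (chamber_lborel p) J u)"
    unfolding subalgebra_def sets space using sets.sigma_sets_subset[OF GM] by simp
  show "J v -` A \<inter> space M \<in> sets (past M (chamber_lborel p) J u)"
    if "0 \<le> v" "v \<le> u" "A \<in> sets (chamber_lborel p)" for v A
    unfolding sets by (rule sigma_sets.Basic, rule UN_I[of v]) (use that in auto)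
qed

lemma box_law_one:
  assumes "s 0 \<ge> 0"
  shows "box_law s 1"
  unfolding box_law_def
proof (intro allI impI)
  interpret prob_space M by (rule prob)
  interpret P: product_sigma_finite "\<lambda>_::nat. chamber_lborel p" by (rule chamber_sigma_finite)
  fix A :: "nat \<Rightarrow> (nat \<Rightarrow> real) set" assume "\<forall>k<1. A k \<in> sets (chamber_lborel p)"
  then have A: "A 0 \<in> sets (chamber_lborel p)" by simp
  note J0 = J_measurable[OF assms]
  have d: "(\<lambda>X. (\<phi>det X)\<^sup>2 / Z) \<in> borel_measurable (chamber_lborel p)"
    by (intro borel_measurable_divide borel_measurable_power \<phi>det_measurable borel_measurable_const)
  have "measure M {\<omega> \<in> space M. \<forall>k<1. J (s k) \<omega> \<in> A k} = measure M (J (s 0) -` A 0 \<inter> space M)"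
    by (rule arg_cong[of _ _ "measure M"]) auto
  also have "\<dots> = measure (distr M (chamber_lborel p) (J (s 0))) (A 0)"
    by (rule measure_distr[OF J0 A, symmetric])
  also have "\<dots> = (LINT X|distr M (chamber_lborel p) (J (s 0)). indicator (A 0) X)"
    using sets.sets_into_space[OF A] by (simp add: Int_absorb2)
  also have "\<dots> = (LINT X|density (chamber_lborel p) (\<lambda>X. ennreal ((\<phi>det X)\<^sup>2 / Z)). indicator (A 0) X)"
    unfolding distributed_distr_eq_density[OF law[OF assms]] ..
  also have "\<dots> = (LINT X|chamber_lborel p. ((\<phi>det X)\<^sup>2 / Z) *\<^sub>R indicator (A 0) X)"
    by (rule integral_density[OF borel_measurable_indicator[OF A] d]) (use Z_pos in simp)
  also have "\<dots> = (LINT x|PiM {0::nat} (\<lambda>_. chamber_lborel p). ((\<phi>det (x 0))\<^sup>2 / Z) *\<^sub>R indicator (A 0) (x 0))"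
    by (rule P.product_integral_singleton[of "\<lambda>X. ((\<phi>det X)\<^sup>2 / Z) *\<^sub>R indicator (A 0) X" 0, symmetric])
      (intro borel_measurable_scaleR d borel_measurable_indicator A)
  also have "\<dots> = (LINT x|path_lborel p 1. indicator (\<Pi>\<^sub>E k\<in>{..<1}. A k) x * (path_density s 1 x / Z))"
  proof -
    have 1: "{..<1} = {0::nat}" by auto
    show ?thesis unfolding 1
      by (rule Bochner_Integration.integral_cong)
        (auto simp: path_density_def power2_eq_square indicator_def space_PiM PiE_iff extensional_def)
  qed
  finally show "measure M {\<omega> \<in> space M. \<forall>k<1. J (s k) \<omega> \<in> A k} =
     (LINT x|path_lborel p 1. indicator (\<Pi>\<^sub>E k\<in>{..<1}. A k) x * (path_density s 1 x / Z))" .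
qed

text \<open>Conditioning on the past of \<open>s (m - 1)\<close> replaces the event at the last time
  by an integral of the transition density. Integrating this against the joint density of the first
  \<open>m\<close> configurations appends one factor to \<open>path_density\<close>.\<close>

lemma box_law_Suc:
  assumes m: "m > 0" and s: "\<And>k l. l < Suc m \<Longrightarrow> k < l \<Longrightarrow> s k < s l"
    and s0: "\<And>k. k < Suc m \<Longrightarrow> s k \<ge> 0" and box: "box_law s m"
  shows "box_law s (Suc m)"
  unfolding box_law_def
proof (intro allI impI)
  interpret prob_space M by (rule prob)
  interpret P: product_sigma_finite "\<lambda>_::nat. chamber_lborel p" by (rule chamber_sigma_finite)
  fix A :: "nat \<Rightarrow> (nat \<Rightarrow> real) set" assume A0: "\<forall>k<Suc m. A k \<in> sets (chamber_lborel p)"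
  then have A: "A k \<in> sets (chamber_lborel p)" if "k \<le> m" for k using that by simp
  let ?L = "chamber_lborel p"
  let ?N = "path_lborel p m"
  let ?box = "\<Pi>\<^sub>E k\<in>{..<m}. A k" and ?box' = "\<Pi>\<^sub>E k\<in>{..<Suc m}. A k"
  let ?I = "\<lambda>x. LINT Y|?L. indicator ?box' (x(m := Y)) * (path_density s (Suc m) (x(m := Y)) / Z)"
  define u where "u = s (m - 1)"
  define \<tau> where "\<tau> = s m - u"
  have \<tau>: "\<tau> > 0" using s[of m "m - 1"] m by (simp add: \<tau>_def u_def)
  have u: "u \<ge> 0" using s0[of "m - 1"] by (simp add: u_def)
  let ?F = "past M ?L J u"
  let ?T = "\<lambda>X Y. \<phi>det Y / \<phi>det X * (exp (\<tau> * Etot) * hdet \<tau> X Y)"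
  define Gf where "Gf X = (LINT Y:A m|?L. ?T X Y)" for X
  interpret F: finite_measure_subalgebra M ?F
    by unfold_locales (rule past_subalgebra(1)[OF u])
  have Xm: "trajectory s m \<in> measurable M ?N" by (rule trajectory_measurable) (use s0 in simp)
  have law_m: "distr M ?N (trajectory s m) = density ?N (\<lambda>x. ennreal (path_density s m x / Z))"
    "AE x in ?N. 0 \<le> path_density s m x / Z"
    by (rule joint_law_if_box_law[OF m _ _ box]; use s s0 in simp)+
  have d_m: "integrable ?N (path_density s m)"
    by (rule path_density_integrable[OF m]) (use s in simp)
  have J_m: "J (s m) \<in> measurable M ?L" by (rule J_measurable[OF s0]) simp
  let ?H = "{\<omega> \<in> space M. \<forall>k<m. J (s k) \<omega> \<in> A k}"
  \<comment> \<open>All of the first \<open>m\<close> times are at most \<open>u\<close>, so this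
    event belongs to the past of \<open>u\<close> and the defining identity of the conditional
    expectation applies to it.\<close>
  have H: "?H \<in> sets ?F"
  proof -
    have "?H = (\<Inter>k\<in>{..<m}. J (s k) -` A k \<inter> space M)" using m by auto
    also have "\<dots> \<in> sets ?F"
    proof (rule sets.finite_INT)
      fix k assume "k \<in> {..<m}"
      then have "s k \<le> u" unfolding u_def using s[of "m - 1" k] m by (cases "k = m - 1") (auto simp: less_imp_le)
      then show "J (s k) -` A k \<inter> space M \<in> sets ?F"
        using \<open>k \<in> {..<m}\<close> by (intro past_subalgebra(2)[OF u] s0 A) auto
    qed (use m in auto)
    finally show ?thesis .
  qed
  have HM: "?H \<in> sets M"
    by (rule subsetD[OF _ H]) (use past_subalgebra(1)[OF u] in \<open>simp add: subalgebra_def\<close>)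
  have Am: "J (s m) -` A m \<inter> space M \<in> sets M" by (rule measurable_sets[OF J_m A]) simp
  have ind: "(\<lambda>\<omega>. indicator (A m) (J (s m) \<omega>) :: real) \<in> borel_measurable M"
    by (rule measurable_compose[OF J_m borel_measurable_indicator]) (rule A, simp)
  have T: "(\<lambda>(X, Y). indicator (A m) Y *\<^sub>R ?T X Y) \<in> borel_measurable (?L \<Otimes>\<^sub>M ?L)"
  proof -
    have [measurable]: "\<phi>det \<in> borel_measurable ?L" by (rule \<phi>det_measurable)
    have [measurable]: "(\<lambda>z. hdet \<tau> (fst z) (snd z)) \<in> borel_measurable (?L \<Otimes>\<^sub>M ?L)"
      by (rule hdet_measurable) auto
    have [measurable]: "A m \<in> sets ?L" by (rule A) simp
    show ?thesis unfolding case_prod_beta by measurable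
  qed
  have Gf: "Gf \<in> borel_measurable ?L"
    unfolding Gf_def set_lebesgue_integral_def
    by (rule sigma_finite_measure.borel_measurable_lebesgue_integral[OF finite_measure.axioms(1)[OF finite_measure_chamber] T])
  have box_set: "?box \<in> sets ?N" using A by (intro sets_PiM_I_finite) auto
  have comp: "(\<lambda>x. Gf (x (m - 1))) \<in> borel_measurable ?N"
    using m by (intro measurable_compose[OF measurable_component_singleton[of _ _ "\<lambda>_. chamber_lborel p"] Gf]) auto
  have "measure M {\<omega> \<in> space M. \<forall>k<Suc m. J (s k) \<omega> \<in> A k} = measure M (?H \<inter> (J (s m) -` A m \<inter> space M))"
    by (rule arg_cong[of _ _ "measure M"]) (auto simp: less_Suc_eq)
  also have "\<dots> = (LINT \<omega>|M. indicator (?H \<inter> (J (s m) -` A m \<inter> space M)) \<omega>)"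
    using sets.sets_into_space[OF HM] by (simp add: Int_absorb2 le_infI1)
  also have "\<dots> = (LINT \<omega>:?H|M. indicator (A m) (J (s m) \<omega>))"
    unfolding set_lebesgue_integral_def
    by (rule Bochner_Integration.integral_cong) (auto simp: indicator_def)
  also have "\<dots> = (LINT \<omega>:?H|M. real_cond_exp M ?F (\<lambda>\<omega>. indicator (A m) (J (s m) \<omega>)) \<omega>)"
    by (rule F.real_cond_exp_intA[OF _ H], rule integrable_const_bound[of _ 1]) (use ind in auto)
  also have "\<dots> = (LINT \<omega>:?H|M. Gf (J u \<omega>))"
    unfolding set_lebesgue_integral_def
  proof (rule integral_cong_AE)
    have "AE \<omega> in M. real_cond_exp M ?F (\<lambda>\<omega>. indicator (A m) (J (u + \<tau>) \<omega>)) \<omega> = Gf (J u \<omega>)"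
      unfolding Gf_def by (rule markov[OF u \<tau>]) (rule A, simp)
    then show "AE \<omega> in M. indicator ?H \<omega> *\<^sub>R real_cond_exp M ?F (\<lambda>\<omega>. indicator (A m) (J (s m) \<omega>)) \<omega> =
        indicator ?H \<omega> *\<^sub>R Gf (J u \<omega>)"
      by (auto simp: \<tau>_def)
    show "(\<lambda>\<omega>. indicator ?H \<omega> *\<^sub>R real_cond_exp M ?F (\<lambda>\<omega>. indicator (A m) (J (s m) \<omega>)) \<omega>) \<in> borel_measurable M"
      by (intro borel_measurable_scaleR borel_measurable_indicator HM borel_measurable_cond_exp2)
    show "(\<lambda>\<omega>. indicator ?H \<omega> *\<^sub>R Gf (J u \<omega>)) \<in> borel_measurable M"
      by (intro borel_measurable_scaleR borel_measurable_indicator HM measurable_compose[OF J_measurable[OF u] Gf])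
  qed
  also have "\<dots> = (LINT \<omega>|M. indicator ?box (trajectory s m \<omega>) * Gf (trajectory s m \<omega> (m - 1)))"
    unfolding set_lebesgue_integral_def
  proof (rule Bochner_Integration.integral_cong[OF refl])
    fix \<omega> assume "\<omega> \<in> space M"
    then have "\<omega> \<in> ?H \<longleftrightarrow> trajectory s m \<omega> \<in> ?box"
      unfolding trajectory_def restrict_PiE_iff by (simp add: Ball_def)
    moreover have "trajectory s m \<omega> (m - 1) = J u \<omega>" using m by (simp add: trajectory_def u_def)
    ultimately show "indicator ?H \<omega> *\<^sub>R Gf (J u \<omega>) =
        indicator ?box (trajectory s m \<omega>) * Gf (trajectory s m \<omega> (m - 1))"
      by (simp only: indicator_def real_scaleR_def)
  qed
  \<comment> \<open>The integrand depends only on the first \<open>m\<close> configurations, whose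
    joint law is known from the assumption \<open>box\<close>.\<close>
  also have "\<dots> = (LINT x|distr M ?N (trajectory s m). indicator ?box x * Gf (x (m - 1)))"
    by (rule integral_distr[OF Xm, symmetric])
      (intro borel_measurable_times borel_measurable_indicator box_set comp)
  also have "\<dots> = (LINT x|?N. (path_density s m x / Z) *\<^sub>R (indicator ?box x * Gf (x (m - 1))))"
    unfolding law_m(1)
    by (intro integral_density law_m(2) borel_measurable_times borel_measurable_indicator box_set comp
        borel_measurable_divide borel_measurable_integrable[OF d_m] borel_measurable_const)
  also have "\<dots> = (LINT x|?N. ?I x)"
  proof (rule Bochner_Integration.integral_cong[OF refl])
    fix x assume x: "x \<in> space ?N"
    then have xc: "x (m - 1) \<in> chamber p" using m by (auto simp: space_PiM PiE_iff)
    have i: "(indicator ?box' (x(m := Y)) :: real) =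
        indicator ?box x * indicator (A m) Y" for Y
    proof -
      have "x(m := Y) \<in> ?box' \<longleftrightarrow> x \<in> ?box \<and> Y \<in> A m"
        using x by (simp add: space_PiM PiE_iff extensional_def less_Suc_eq all_conj_distrib Ball_def)
      then show ?thesis by (simp add: indicator_def)
    qed
    have "?I x =
      (LINT Y|?L. (path_density s m x / Z * indicator ?box x) * (indicator (A m) Y *\<^sub>R ?T (x (m - 1)) Y))"
      unfolding i path_density_Suc[where x = x and s = s, OF m \<phi>det_nz[OF xc]]
      by (rule Bochner_Integration.integral_cong[OF refl]) (simp add: \<tau>_def u_def mult_ac)
    also have "\<dots> = (path_density s m x / Z * indicator ?box x) * Gf (x (m - 1))"
      unfolding Gf_def set_lebesgue_integral_def by (rule integral_mult_right_zero)
    finally have e: "?I x =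
      (path_density s m x / Z * indicator ?box x) * Gf (x (m - 1))" .
    show "(path_density s m x / Z) *\<^sub>R (indicator ?box x * Gf (x (m - 1))) =
        ?I x"
      unfolding e by simp
  qed
  \<comment> \<open>Fubini in reverse: the iterated integral becomes one over paths with
    \<open>Suc m\<close> configurations, where \<open>path_density s (Suc m)\<close> is
    integrable.\<close>
  also have "\<dots> = (LINT x|path_lborel p (Suc m). indicator ?box' x * (path_density s (Suc m) x / Z))"
    unfolding lessThan_Suc
  proof (rule P.product_integral_insert[symmetric])
    have "integrable (path_lborel p (Suc m)) (\<lambda>x. path_density s (Suc m) x / Z)"
      by (intro integrable_divide path_density_integrable[OF zero_less_Suc] s)
    moreover have "?box' \<in> sets (path_lborel p (Suc m))"
      using A by (intro sets_PiM_I_finite) auto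
    ultimately have "integrable (path_lborel p (Suc m))
        (\<lambda>x. indicator ?box' x *\<^sub>R (path_density s (Suc m) x / Z))"
      by (intro integrable_mult_indicator)
    then show "integrable (PiM (insert m {..<m}) (\<lambda>_. ?L))
        (\<lambda>x. indicator (\<Pi>\<^sub>E k\<in>insert m {..<m}. A k) x * (path_density s (Suc m) x / Z))"
      unfolding lessThan_Suc real_scaleR_def .
  qed auto
  finally show "measure M {\<omega> \<in> space M. \<forall>k<Suc m. J (s k) \<omega> \<in> A k} =
     (LINT x|path_lborel p (Suc m). indicator ?box' x * (path_density s (Suc m) x / Z))" .
qed

lemma box_law_all:
  assumes "m > 0" "\<And>k l. l < m \<Longrightarrow> k < l \<Longrightarrow> s k < s l" "\<And>k. k < m \<Longrightarrow> s k \<ge> 0"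
  shows "box_law s m"
  using assms
proof (induction m)
  case (Suc m)
  show ?case
  proof (cases "m = 0")
    case True
    then show ?thesis using box_law_one[of s] Suc.prems(3)[of 0] by simp
  next
    case False
    show ?thesis
      by (rule box_law_Suc) (use False Suc in auto)
  qed
qed simp

section \<open>Expectations of correlation sums\<close>

lemma points_measurable:
  assumes c: "c \<in> labellings p n t" and t: "\<And>i. i < n \<Longrightarrow> t i \<ge> 0"
  shows "(\<lambda>\<omega>. \<lambda>i\<in>{..<n}. J (t i) \<omega> (c i)) \<in> measurable M (cube_lborel n)"
proof (rule measurable_restrict)
  fix i assume i: "i \<in> {..<n}"
  then have ci: "c i \<in> {..<p}" using c by (auto simp: labellings_def PiE_iff)
  have "(\<lambda>X. X (c i)) \<in> measurable (chamber_lborel p) unit_lborel"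
    unfolding chamber_lborel_eq
    by (intro measurable_restrict_space1 measurable_component_singleton[of _ _ "\<lambda>_. unit_lborel"] ci)
  then show "(\<lambda>\<omega>. J (t i) \<omega> (c i)) \<in> measurable M unit_lborel"
    using i by (intro measurable_compose[OF J_measurable]) (auto intro: t)
qed

lemma correlation_term_integrable:
  fixes f :: "(nat \<Rightarrow> real) \<Rightarrow> real" and K :: real
  assumes c: "c \<in> labellings p n t" and t: "\<And>i. i < n \<Longrightarrow> t i \<ge> 0"
    and f: "f \<in> borel_measurable (cube_lborel n)" and K: "\<And>x. x \<in> cube n \<Longrightarrow> \<bar>f x\<bar> \<le> K"
  shows "integrable M (\<lambda>\<omega>. f (\<lambda>i\<in>{..<n}. J (t i) \<omega> (c i)))"
proof -
  interpret prob_space M by (rule prob)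
  note X = points_measurable[OF c t]
  have "(\<lambda>\<omega>. f (\<lambda>i\<in>{..<n}. J (t i) \<omega> (c i))) \<in> borel_measurable M"
    by (rule measurable_compose[OF X f])
  moreover have "AE \<omega> in M. norm (f (\<lambda>i\<in>{..<n}. J (t i) \<omega> (c i))) \<le> K"
  proof (rule AE_I2)
    fix \<omega> assume "\<omega> \<in> space M"
    then show "norm (f (\<lambda>i\<in>{..<n}. J (t i) \<omega> (c i))) \<le> K"
      using measurable_space[OF X] K by (simp add: space_cube_lborel)
  qed
  ultimately show ?thesis by (intro integrable_const_bound[of _ K])
qed

lemma correlation_sum_integral:
  fixes f :: "(nat \<Rightarrow> real) \<Rightarrow> real" and K :: real
  assumes t: "\<And>i. i < n \<Longrightarrow> t i \<ge> 0"
    and f: "f \<in> borel_measurable (cube_lborel n)" and K: "\<And>x. x \<in> cube n \<Longrightarrow> \<bar>f x\<bar> \<le> K"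
  shows "integrable M (correlation_sum p J n t f)"
    and "(LINT \<omega>|M. correlation_sum p J n t f \<omega>) =
      (\<Sum>c\<in>labellings p n t. LINT \<omega>|M. f (\<lambda>i\<in>{..<n}. J (t i) \<omega> (c i)))"
proof -
  have eq: "correlation_sum p J n t f \<omega> = (\<Sum>c\<in>labellings p n t. f (\<lambda>i\<in>{..<n}. J (t i) \<omega> (c i)))"
    if "\<omega> \<in> space M" for \<omega>
    using that t by (intro correlation_sum_eq J_chamber) auto
  have int: "integrable M (\<lambda>\<omega>. f (\<lambda>i\<in>{..<n}. J (t i) \<omega> (c i)))" if "c \<in> labellings p n t" for c
    by (rule correlation_term_integrable[OF that t f K])
  show "integrable M (correlation_sum p J n t f)"
    using int by (subst Bochner_Integration.integrable_cong[OF refl eq]) auto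
  show "(LINT \<omega>|M. correlation_sum p J n t f \<omega>) =
      (\<Sum>c\<in>labellings p n t. LINT \<omega>|M. f (\<lambda>i\<in>{..<n}. J (t i) \<omega> (c i)))"
    using int by (subst Bochner_Integration.integral_cong[OF refl eq]) auto
qed

lemma integrable_bounded_rho:
  fixes f :: "(nat \<Rightarrow> real) \<Rightarrow> real" and K :: real
  assumes f: "f \<in> borel_measurable (cube_lborel n)" and K: "\<And>x. x \<in> cube n \<Longrightarrow> \<bar>f x\<bar> \<le> K"
  shows "integrable (cube_lborel n) (\<lambda>x. f x * rho n t x)"
proof (rule Bochner_Integration.integrable_bound)
  show "integrable (cube_lborel n) (\<lambda>x. K * rho n t x)"
    by (intro integrable_mult_right rho_integrable)
  show "(\<lambda>x. f x * rho n t x) \<in> borel_measurable (cube_lborel n)"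
    by (intro borel_measurable_times f rho_measurable)
  show "AE x in cube_lborel n. norm (f x * rho n t x) \<le> norm (K * rho n t x)"
  proof (rule AE_I2)
    fix x assume "x \<in> space (cube_lborel n)"
    then have "\<bar>f x\<bar> \<le> \<bar>K\<bar>" using K[of x] by (simp add: space_cube_lborel)
    then show "norm (f x * rho n t x) \<le> norm (K * rho n t x)"
      by (simp add: abs_mult mult_right_mono)
  qed
qed

text \<open>With \<open>p\<close> points at every time in \<open>S\<close>, a labelling is a
  bijection onto all coordinates of all configurations. Each term of the correlation sum is
  therefore an integral against the full joint density, which equals \<open>rho\<close> there, and
  summing over labellings yields the integral over the cube.\<close>

lemma expectation_full_slices:
  fixes f :: "(nat \<Rightarrow> real) \<Rightarrow> real" and K :: real
  assumes S: "finite S" "S \<noteq> {}" "\<And>u. u \<in> S \<Longrightarrow> u \<ge> 0" and t: "\<And>i. i < n \<Longrightarrow> t i \<in> S"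
    and full: "\<And>u. u \<in> S \<Longrightarrow> card {i. i < n \<and> t i = u} = p"
    and f: "f \<in> borel_measurable (cube_lborel n)" and K: "\<And>x. x \<in> cube n \<Longrightarrow> \<bar>f x\<bar> \<le> K"
  shows "(LINT \<omega>|M. correlation_sum p J n t f \<omega>) = (LINT x|cube_lborel n. f x * rho n t x) / Z"
proof -
  define m where "m = card S"
  \<comment> \<open>The times of the points come unordered and repeated; listing \<open>S\<close> in
    increasing order provides the time-ordered setting of the joint law.\<close>
  define s where "s k = sorted_list_of_set S ! k" for k
  have m: "m > 0" using S by (simp add: m_def card_gt_0_iff)
  have s: "s k < s l" if "l < m" "k < l" for k l
    using that sorted_list_of_set.strict_sorted_key_list_of_set[of S] unfolding s_def m_def
    by (intro sorted_wrt_nth_less[of "(<)"]) (auto simp: length_sorted_list_of_set)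
  have s_S: "s k \<in> S" if "k < m" for k
    using that nth_mem[of k "sorted_list_of_set S"] S(1) unfolding s_def m_def by simp
  have s_inj: "s k = s l \<longleftrightarrow> k = l" if "k < m" "l < m" for k l
    using s[of l k] s[of k l] that by (metis less_irrefl linorder_neqE_nat)
  have "\<exists>k<m. s k = t i" if "i < n" for i
    using t[OF that] S(1) unfolding s_def m_def
    by (metis in_set_conv_nth length_sorted_list_of_set set_sorted_list_of_set)
  then obtain \<tau> where \<tau>: "\<tau> i < m" "s (\<tau> i) = t i" if "i < n" for i by metis
  have fib: "card {i. i < n \<and> \<tau> i = k} = p" if k: "k < m" for k
  proof -
    have "{i. i < n \<and> \<tau> i = k} = {i. i < n \<and> t i = s k}"
    proof (intro Collect_cong conj_cong refl)
      fix i assume i: "i < n"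
      show "(\<tau> i = k) = (t i = s k)" using s_inj[OF \<tau>(1)[OF i] k] \<tau>(2)[OF i] by simp
    qed
    then show ?thesis using full[OF s_S[OF k]] by simp
  qed
  have t0: "t i \<ge> 0" if "i < n" for i using S(3) t[OF that] .
  have s0: "s k \<ge> 0" if "k < m" for k using S(3) s_S[OF that] .
  have box: "box_law s m" by (rule box_law_all[OF m]) (use s s0 in auto)
  have X: "trajectory s m \<in> measurable M (path_lborel p m)" by (rule trajectory_measurable) (rule s0)
  have law_m: "distr M (path_lborel p m) (trajectory s m) = density (path_lborel p m) (\<lambda>x. ennreal (path_density s m x / Z))"
    "AE x in path_lborel p m. 0 \<le> path_density s m x / Z"
    by (rule joint_law_if_box_law[OF m _ _ box]; use s s0 in simp)+
  \<comment> \<open>Only the information which points share a time enters, so times may be replaced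
    by their indices.\<close>
  have lab: "labellings p n t = labellings p n \<tau>"
  proof -
    have "t i = t j \<longleftrightarrow> \<tau> i = \<tau> j" if "i < n" "j < n" for i j
      using s_inj[OF \<tau>(1)[OF that(1)] \<tau>(1)[OF that(2)]] \<tau>(2)[OF that(1)] \<tau>(2)[OF that(2)] by simp
    then show ?thesis by (auto simp: labellings_def inj_on_def)
  qed
  let ?F = "\<lambda>x. f x * rho n t x / Z"
  have F: "integrable (cube_lborel n) ?F"
    using integrable_bounded_rho[OF f K] by simp
  have term_eq: "(LINT \<omega>|M. f (\<lambda>i\<in>{..<n}. J (t i) \<omega> (c i))) =
      (LINT x|path_lborel p m. ?F (\<lambda>i\<in>{..<n}. x (\<tau> i) (c i)))" if c: "c \<in> labellings p n \<tau>" for c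
  proof -
    note bij = labelling_bij[OF \<tau>(1) fib c]
    have meas: "(\<lambda>x. f (\<lambda>i\<in>{..<n}. x (\<tau> i) (c i))) \<in> borel_measurable (path_lborel p m)"
      unfolding path_lborel_eq
      by (rule measurable_compose[OF measurable_restrict_space1[OF distr_relabel(2)[OF bij]] f])
    have "(LINT \<omega>|M. f (\<lambda>i\<in>{..<n}. J (t i) \<omega> (c i))) =
        (LINT \<omega>|M. f (\<lambda>i\<in>{..<n}. trajectory s m \<omega> (\<tau> i) (c i)))"
    proof (rule Bochner_Integration.integral_cong[OF refl], rule arg_cong[of _ _ f], rule restrict_ext)
      fix \<omega> i assume "i \<in> {..<n}"
      then show "J (t i) \<omega> (c i) = trajectory s m \<omega> (\<tau> i) (c i)" using \<tau>[of i] by (simp add: trajectory_def)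
    qed
    also have "\<dots> = (LINT x|distr M (path_lborel p m) (trajectory s m). f (\<lambda>i\<in>{..<n}. x (\<tau> i) (c i)))"
      by (rule integral_distr[OF X meas, symmetric])
    also have "\<dots> = (LINT x|path_lborel p m. (path_density s m x / Z) *\<^sub>R f (\<lambda>i\<in>{..<n}. x (\<tau> i) (c i)))"
      unfolding law_m(1) using path_density_integrable[OF m s]
      by (intro integral_density law_m(2) meas) auto
    also have "\<dots> = (LINT x|path_lborel p m. ?F (\<lambda>i\<in>{..<n}. x (\<tau> i) (c i)))"
    proof (rule Bochner_Integration.integral_cong[OF refl])
      fix x assume "x \<in> space (path_lborel p m)"
      then have "x k \<in> chamber p" if "k < m" for k using that by (auto simp: space_PiM PiE_iff)
      then have "rho n t (\<lambda>i\<in>{..<n}. x (\<tau> i) (c i)) = path_density s m x"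
        using \<tau>(2) by (intro rho_eq_path_density[OF bij _ m s]) auto
      then show "(path_density s m x / Z) *\<^sub>R f (\<lambda>i\<in>{..<n}. x (\<tau> i) (c i)) = ?F (\<lambda>i\<in>{..<n}. x (\<tau> i) (c i))"
        by simp
    qed
    finally show ?thesis .
  qed
  have "(LINT \<omega>|M. correlation_sum p J n t f \<omega>) =
      (\<Sum>c\<in>labellings p n \<tau>. LINT x|path_lborel p m. ?F (\<lambda>i\<in>{..<n}. x (\<tau> i) (c i)))"
  proof -
    have "(LINT \<omega>|M. correlation_sum p J n t f \<omega>) =
        (\<Sum>c\<in>labellings p n t. LINT \<omega>|M. f (\<lambda>i\<in>{..<n}. J (t i) \<omega> (c i)))"
      by (rule correlation_sum_integral(2)[OF t0 f K])
    then show ?thesis unfolding lab by (simp only: sum.cong[OF refl term_eq])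
  qed
  also have "\<dots> = (LINT x|cube_lborel n. ?F x)"
  proof (rule sum_labellings_integral[OF \<tau>(1) fib F])
    fix y :: "nat \<Rightarrow> real" and i j
    assume ij: "i < n" "j < n" "i \<noteq> j" "\<tau> i = \<tau> j" "y i = y j"
    then have "t i = t j" using \<tau>(2)[of i] \<tau>(2)[of j] by simp
    then have "rho n t y = 0" using ij by (intro rho_coincidence[of i n j]) auto
    then show "f y * rho n t y / Z = 0" by simp
  qed
  finally show ?thesis by simp
qed

text \<open>Descending induction on the number of points: a time with fewer than \<open>p\<close> points gets one more
  point, which multiplies both sides by the number of free points at that time.\<close>

lemma expectation_correlation_sum:
  fixes f :: "(nat \<Rightarrow> real) \<Rightarrow> real" and K :: real
  assumes S: "finite S" "S \<noteq> {}" "\<And>u. u \<in> S \<Longrightarrow> u \<ge> 0" and t: "\<And>i. i < n \<Longrightarrow> t i \<in> S"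
    and f: "f \<in> borel_measurable (cube_lborel n)" and K: "\<And>x. x \<in> cube n \<Longrightarrow> \<bar>f x\<bar> \<le> K"
  shows "(LINT \<omega>|M. correlation_sum p J n t f \<omega>) = (LINT x|cube_lborel n. f x * rho n t x) / Z"
  using t f K
proof (induction "card S * p - n" arbitrary: n t f rule: less_induct)
  case less
  interpret U: product_sigma_finite "\<lambda>_::nat. unit_lborel" by (rule unit_sigma_finite)
  have t0: "t i \<ge> 0" if "i < n" for i using S(3) less.prems(1)[OF that] .
  \<comment> \<open>With more than \<open>p\<close> points at one time both sides vanish. Otherwise
    all times in \<open>S\<close>, including those that carry no point so far, are filled up one
    point at a time.\<close>
  consider (many) u where "card {i. i < n \<and> t i = u} > p"
    | (few) u where "u \<in> S" "card {i. i < n \<and> t i = u} < p" "\<And>v. card {i. i < n \<and> t i = v} \<le> p"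
    | (full) "\<And>u. u \<in> S \<Longrightarrow> card {i. i < n \<and> t i = u} = p"
    by (meson le_neq_implies_less not_less)
  then show ?case
  proof cases
    case many
    have "(LINT x|cube_lborel n. f x * rho n t x) = (LINT x|cube_lborel n. 0)"
    proof (rule Bochner_Integration.integral_cong[OF refl])
      fix x assume "x \<in> space (cube_lborel n)"
      then have "rho n t x = 0" by (intro rho_too_many[OF _ many]) (auto simp: space_PiM PiE_iff)
      then show "f x * rho n t x = 0" by simp
    qed
    then show ?thesis
      using correlation_sum_integral(2)[OF t0 less.prems(2,3)] labellings_empty[OF many] by simp
  next
    case few
    let ?r = "card {i. i < n \<and> t i = u}"
    \<comment> \<open>The function \<open>?f\<close> ignores the new point, so the larger
      correlation sum repeats each old term once for every free coordinate at time
      \<open>u\<close>.\<close>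
    let ?t = "t(n := u)" and ?f = "\<lambda>x. f (restrict x {..<n})"
    let ?E = "LINT \<omega>|M. correlation_sum p J n t f \<omega>" and ?R = "LINT x|cube_lborel n. f x * rho n t x"
    let ?E' = "LINT \<omega>|M. correlation_sum p J (Suc n) ?t ?f \<omega>"
    let ?R' = "LINT x|cube_lborel (Suc n). ?f x * rho (Suc n) ?t x"
    \<comment> \<open>Counting the points time by time gives \<open>n < card S * p\<close>, so the
      induction measure drops when a point is added.\<close>
    have "n = card (\<Union>v\<in>S. {i. i < n \<and> t i = v})"
    proof -
      have "(\<Union>v\<in>S. {i. i < n \<and> t i = v}) = {..<n}" using less.prems(1) by auto
      then show ?thesis by simp
    qed
    also have "\<dots> = (\<Sum>v\<in>S. card {i. i < n \<and> t i = v})"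
      using S(1) by (intro card_UN_disjoint) auto
    also have "\<dots> < (\<Sum>v\<in>S. p)"
      using S(1) few by (intro sum_strict_mono_ex1) auto
    finally have n: "n < card S * p" by simp
    have restr: "(\<lambda>x. restrict x {..<n}) \<in> measurable (cube_lborel (Suc n)) (cube_lborel n)"
      by (rule measurable_restrict_subset) auto
    have f': "?f \<in> borel_measurable (cube_lborel (Suc n))"
      by (rule measurable_compose[OF restr less.prems(2)])
    have K': "\<bar>?f x\<bar> \<le> K" if "x \<in> cube (Suc n)" for x
      using that by (intro less.prems(3)) (auto simp: cube_def PiE_iff)
    have t': "?t i \<in> S" if "i < Suc n" for i using that less.prems(1) few(1) by (auto simp: less_Suc_eq)
    have t0': "?t i \<ge> 0" if "i < Suc n" for i using S(3) t'[OF that] .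
    have "?E' =
        (\<Sum>c\<in>labellings p (Suc n) ?t. LINT \<omega>|M. ?f (\<lambda>i\<in>{..<Suc n}. J (?t i) \<omega> (c i)))"
      by (rule correlation_sum_integral(2)[OF t0' f' K'])
    also have "\<dots> = (\<Sum>c\<in>labellings p (Suc n) ?t. LINT \<omega>|M. f (\<lambda>i\<in>{..<n}. J (t i) \<omega> (restrict c {..<n} i)))"
    proof (intro sum.cong refl Bochner_Integration.integral_cong arg_cong[of _ _ f])
      fix c \<omega>
      show "restrict (\<lambda>i\<in>{..<Suc n}. J (?t i) \<omega> (c i)) {..<n} = (\<lambda>i\<in>{..<n}. J (t i) \<omega> (restrict c {..<n} i))"
        by (auto simp: fun_eq_iff)
    qed
    also have "\<dots> = (real p - real ?r) * ?E"
    proof -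
      have "?E =
          (\<Sum>c\<in>labellings p n t. LINT \<omega>|M. f (\<lambda>i\<in>{..<n}. J (t i) \<omega> (c i)))"
        by (rule correlation_sum_integral(2)[OF t0 less.prems(2,3)])
      then show ?thesis
        using sum_labellings_Suc[OF less_imp_le[OF few(2)],
            of "\<lambda>c. LINT \<omega>|M. f (\<lambda>i\<in>{..<n}. J (t i) \<omega> (c i))"] by (simp only:)
    qed
    finally have lhs: "?E' =
        (real p - real ?r) * ?E" .
    have "?R' =
        (LINT x|cube_lborel n. LINT y|unit_lborel. ?f (x(n := y)) * rho (Suc n) ?t (x(n := y)))"
      using integrable_bounded_rho[OF f' K'] unfolding lessThan_Suc
      by (intro U.product_integral_insert) auto
    also have "\<dots> = (LINT x|cube_lborel n. (real p - real ?r) * (f x * rho n t x))"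
    proof (rule Bochner_Integration.integral_cong[OF refl])
      fix x assume x: "x \<in> space (cube_lborel n)"
      then have "restrict (x(n := y)) {..<n} = x" for y
        by (auto simp: fun_eq_iff space_PiM PiE_iff extensional_def)
      moreover have "x \<in> {..<n} \<rightarrow> {0<..<1}" using x by (auto simp: space_PiM PiE_iff)
      ultimately show "(LINT y|unit_lborel. ?f (x(n := y)) * rho (Suc n) ?t (x(n := y))) =
          (real p - real ?r) * (f x * rho n t x)"
        using integral_rho_Suc[of x n t u] by simp
    qed
    also have "\<dots> = (real p - real ?r) * ?R" by simp
    finally have rhs: "?R' =
        (real p - real ?r) * ?R" .
    have "?E' = ?R' / Z"
      by (rule less.hyps[OF _ t' f' K']) (use n in auto)
    then have "(real p - real ?r) * ?E =
        (real p - real ?r) * (?R / Z)"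
      unfolding lhs rhs by simp
    moreover have "real p - real ?r \<noteq> 0" using few(2) by simp
    ultimately show ?thesis using mult_left_cancel by blast
  next
    case full
    show ?thesis by (rule expectation_full_slices[OF S less.prems(1) full less.prems(2,3)])
  qed
qed

text \<open>With zero points, the correlation sum of the constant 1 and the empty determinant are
  both 1. The identity behind this fills time 0 with \<open>p\<close> points and integrates them out
  again, which evaluates the normalizing integral.\<close>

lemma Z_eq_1: "Z = 1"
proof -
  interpret prob_space M by (rule prob)
  interpret C: prob_space "cube_lborel 0" by (rule prob_space_cube)
  have "(LINT \<omega>|M. correlation_sum p J 0 (\<lambda>_. 0) (\<lambda>_. 1) \<omega>) =
      (LINT x|cube_lborel 0. 1 * rho 0 (\<lambda>_. 0) x) / Z"
    by (rule expectation_correlation_sum[of "{0}" _ _ _ 1]) auto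
  moreover have "correlation_sum p J 0 (\<lambda>_. 0) (\<lambda>_. 1) \<omega> = 1" for \<omega>
    by (simp add: correlation_sum_def)
  moreover have "rho 0 (\<lambda>_. 0) x = 1" for x
    by (simp add: rho_def pdet_def)
  ultimately have "1 = 1 / Z"
    using prob_space C.prob_space by simp
  then show ?thesis using Z_pos by (simp add: field_simps)
qed

theorem rho_is_correlation_function:
  assumes t: "\<And>i. i < n \<Longrightarrow> t i \<ge> 0"
  shows "is_correlation_function p M J n t (rho n t)"
  unfolding is_correlation_function_def lborel_on_cube
proof (intro conjI ballI impI)
  show "rho n t \<in> borel_measurable (cube_lborel n)" by (rule rho_measurable)
  fix f :: "(nat \<Rightarrow> real) \<Rightarrow> real"
  assume f: "f \<in> borel_measurable (cube_lborel n)" and bdd: "bounded (f ` cube n)"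
  obtain K where K: "\<And>x. x \<in> cube n \<Longrightarrow> \<bar>f x\<bar> \<le> K"
    using bdd by (auto simp: bounded_iff)
  show "integrable M (correlation_sum p J n t f)"
    by (rule correlation_sum_integral(1)[OF t f K])
  show "integrable (cube_lborel n) (\<lambda>x. f x * rho n t x)"
    by (rule integrable_bounded_rho[OF f K])
  show "(LINT \<omega>|M. correlation_sum p J n t f \<omega>) = (LINT x|cube_lborel n. f x * rho n t x)"
    \<comment> \<open>Time 0 is inserted to keep the set of times nonempty for every
      \<open>n\<close>.\<close>
    using expectation_correlation_sum[of "insert 0 (t ` {..<n})" n t f K] t f K by (auto simp: Z_eq_1)
qed

end

section \<open>The Jacobi process\<close>

lemma pdet_transpose: "pdet {..<n} (\<lambda>i j. A j i) = pdet {..<n::nat} A"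
proof -
  have "mat n n (\<lambda>(i, j). A j i) = transpose_mat (mat n n (\<lambda>(i, j). A i j))"
    by (rule eq_matI) auto
  then show ?thesis
    unfolding det_eq_pdet[symmetric] by (simp only: det_transpose[OF mat_carrier])
qed

lemma is_correlation_function_cong:
  assumes eq: "\<And>x. x \<in> cube n \<Longrightarrow> \<rho> x = \<rho>' x" and \<rho>: "is_correlation_function p M J n t \<rho>"
  shows "is_correlation_function p M J n t \<rho>'"
proof -
  have eq': "\<rho> x = \<rho>' x" if "x \<in> space (lborel_on n (cube n))" for x
    using that eq by (simp add: lborel_on_cube space_cube_lborel)
  have m: "\<rho> \<in> borel_measurable (lborel_on n (cube n)) \<longleftrightarrow> \<rho>' \<in> borel_measurable (lborel_on n (cube n))"
    by (rule measurable_cong[OF eq'])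
  have i: "integrable (lborel_on n (cube n)) (\<lambda>x. f x * \<rho> x) \<longleftrightarrow> integrable (lborel_on n (cube n)) (\<lambda>x. f x * \<rho>' x)" for f
    by (rule Bochner_Integration.integrable_cong[OF refl]) (simp only: eq')
  have l: "(LINT x|lborel_on n (cube n). f x * \<rho> x) = (LINT x|lborel_on n (cube n). f x * \<rho>' x)" for f
    by (rule Bochner_Integration.integral_cong[OF refl]) (simp only: eq')
  show ?thesis using \<rho> unfolding is_correlation_function_def m i l .
qed

locale jacobi_params =
  fixes p :: nat and z' w' :: real
  assumes z': "z' > real p - 1" and w': "w' > -1"
begin

sublocale jacobi_weight "z' - real p" w'
  by unfold_locales (use z' w' in auto)

definition root_weight :: "real \<Rightarrow> real" where
  "root_weight x = sqrt (jac_weight p z' w' x)"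

lemma jac_weight_nonneg: "jac_weight p z' w' x \<ge> 0"
  by (simp add: jac_weight_def)

lemma root_weight_sq: "root_weight x * root_weight x = jac_weight p z' w' x"
  using jac_weight_nonneg[of x] by (simp add: root_weight_def)

lemma Jac_borel: "Jac \<alpha> \<beta> k \<in> borel_measurable borel"
  unfolding poly_jac_poly[symmetric, abs_def]
  by (intro borel_measurable_continuous_onI continuous_on_poly continuous_on_id)

lemma jac_weight_borel: "jac_weight p z' w' \<in> borel_measurable borel"
  unfolding jac_weight_def by measurable

lemma jac_inner_Jac: "jac_inner p z' w' (Jac (z' - real p) w' k) (Jac (z' - real p) w' k) = jac_norm2 k"
proof -
  have "jac_inner p z' w' (Jac (z' - real p) w' k) (Jac (z' - real p) w' k) =
      (LINT x|unit_lborel. Jac (z' - real p) w' k x * Jac (z' - real p) w' k x * jac_weight p z' w' x)"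
    unfolding jac_inner_def
    by (rule unit_lborel_eq_Icc(1)[symmetric]) (intro borel_measurable_times Jac_borel jac_weight_borel)
  then show ?thesis
    using integral_Jac_Jac[of k k] by (simp add: jac_weight_def)
qed

lemma jac_fun_eq: "jac_fun p z' w' k x = Jac (z' - real p) w' k x * root_weight x / sqrt (jac_norm2 k)"
  by (simp add: jac_fun_def jac_inner_Jac root_weight_def)

lemma jac_eig_eq: "jac_eig p z' w' k = real k * (real k + (z' - real p) + w' + 1)"
  by (simp add: jac_eig_def algebra_simps)

lemma jac_fun_ortho: "(LINT x|unit_lborel. jac_fun p z' w' i x * jac_fun p z' w' k x) = of_bool (i = k)"
proof -
  have "jac_fun p z' w' i x * jac_fun p z' w' k x =
      Jac (z' - real p) w' i x * Jac (z' - real p) w' k x * (x powr w' * (1 - x) powr (z' - real p)) /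
        (sqrt (jac_norm2 i) * sqrt (jac_norm2 k))" for x
  proof -
    have "jac_fun p z' w' i x * jac_fun p z' w' k x =
      Jac (z' - real p) w' i x * Jac (z' - real p) w' k x * (root_weight x * root_weight x) /
        (sqrt (jac_norm2 i) * sqrt (jac_norm2 k))"
      by (simp add: jac_fun_eq)
    then show ?thesis by (simp only: root_weight_sq jac_weight_def)
  qed
  then have "(LINT x|unit_lborel. jac_fun p z' w' i x * jac_fun p z' w' k x) =
      (if i = k then jac_norm2 k else 0) / (sqrt (jac_norm2 i) * sqrt (jac_norm2 k))"
    by (simp only: integral_divide_zero integral_Jac_Jac)
  then show ?thesis using jac_norm2_pos[of k] by auto
qed

sublocale spectral_kernel p "jac_fun p z' w'" jac_bound root_weight "jac_eig p z' w'"
proof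
  have rw: "root_weight \<in> borel_measurable borel"
    unfolding root_weight_def
    by (rule measurable_compose[OF jac_weight_borel])
      (intro borel_measurable_continuous_onI continuous_on_real_sqrt continuous_on_id)
  then show "root_weight \<in> borel_measurable borel" .
  show "jac_fun p z' w' k \<in> borel_measurable borel" for k
    unfolding jac_fun_eq[abs_def]
    by (intro borel_measurable_divide borel_measurable_times Jac_borel rw borel_measurable_const)
  show "0 \<le> root_weight x" for x
    unfolding root_weight_def using jac_weight_nonneg by (rule real_sqrt_ge_zero)
  show "integrable unit_lborel (\<lambda>x. (root_weight x)\<^sup>2)"
    unfolding power2_eq_square root_weight_sq jac_weight_def
    using integral_unit_Beta(2)[of w' "z' - real p"] z' w' by simp
  show "\<bar>jac_fun p z' w' k x\<bar> \<le> jac_bound k * root_weight x" if "x \<in> {0<..<1}" for k x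
  proof -
    have s: "sqrt (jac_norm2 k) > 0" using jac_norm2_pos by simp
    have r: "root_weight x \<ge> 0" unfolding root_weight_def using jac_weight_nonneg by (rule real_sqrt_ge_zero)
    have "\<bar>jac_fun p z' w' k x\<bar> = \<bar>Jac (z' - real p) w' k x\<bar> * root_weight x / sqrt (jac_norm2 k)"
      using s r by (simp add: jac_fun_eq abs_mult)
    also have "\<dots> \<le> (jac_size k ^ (3 * k + 1) / min (z' - real p + 1) 1) * root_weight x / sqrt (jac_norm2 k)"
      using Jac_bound[OF that, of k] s r by (intro divide_right_mono mult_right_mono) auto
    also have "\<dots> = jac_bound k * root_weight x" by (simp add: jac_bound_def)
    finally show ?thesis .
  qed
  show "0 \<le> jac_bound k" for k by (rule jac_bound_nonneg)
  show "(LINT x|unit_lborel. jac_fun p z' w' i x * jac_fun p z' w' k x) = of_bool (i = k)" for i k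
    by (rule jac_fun_ortho)
  show "summable (\<lambda>k. exp (- \<tau> * jac_eig p z' w' k) * (jac_bound k)\<^sup>2)" if "\<tau> > 0" for \<tau>
    unfolding jac_eig_eq by (rule summable_jac_bound[OF that])
qed

section \<open>Vandermonde form of the stationary and transition densities\<close>

definition lead_prod :: real where
  "lead_prod = (\<Prod>q<p. jac_lead q / sqrt (jac_norm2 q))"

lemma lead_prod_pos: "lead_prod > 0"
  unfolding lead_prod_def using jac_lead_pos jac_norm2_pos by (intro prod_pos) auto

text \<open>A Jacobi function is a polynomial of exact degree \<open>q\<close> times
  \<open>root_weight\<close>. After transposition the points index the columns, so the weights
  factor out and \<open>pdet_poly\<close> evaluates the rest.\<close>

lemma \<phi>det_eq:
  assumes X: "X \<in> chamber p"
  shows "\<phi>det X = lead_prod * (\<Prod>j<p. \<Prod>i<j. X j - X i) * (\<Prod>a<p. root_weight (X a))"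
proof -
  define Q where "Q q = Polynomial.smult (1 / sqrt (jac_norm2 q)) (jac_poly (z' - real p) w' q)" for q
  have nz: "sqrt (jac_norm2 q) \<noteq> 0" for q using jac_norm2_pos[of q] by simp
  have deg: "degree (Q q) = q" for q using nz[of q] by (simp add: Q_def degree_jac_poly)
  have lead: "lead_coeff (Q q) = jac_lead q / sqrt (jac_norm2 q)" for q
    unfolding deg by (simp add: Q_def coeff_jac_poly)
  have "\<phi>det X = pdet {..<p} (\<lambda>q a. jac_fun p z' w' q (X a))"
    unfolding \<phi>det_def by (rule pdet_transpose)
  also have "\<dots> = pdet {..<p} (\<lambda>q a. root_weight (X a) * poly (Q q) (X a))"
    by (intro pdet_cong) (simp add: jac_fun_eq Q_def poly_jac_poly)
  also have "\<dots> = (\<Prod>a<p. root_weight (X a)) * pdet {..<p} (\<lambda>q a. poly (Q q) (X a))"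
    by (rule pdet_scale_columns)
  also have "pdet {..<p} (\<lambda>q a. poly (Q q) (X a)) = (\<Prod>q<p. lead_coeff (Q q)) * (\<Prod>j<p. \<Prod>i<j. X j - X i)"
    by (rule pdet_poly[OF deg chamber_inj_on[OF X]])
  also have "(\<Prod>q<p. lead_coeff (Q q)) = lead_prod"
    unfolding lead_prod_def lead ..
  finally show ?thesis by simp
qed

text \<open>Leading coefficients are positive and the coordinates increase. The sign matters: it
  makes the square root of the stationary density a multiple of \<open>\<phi>det\<close> itself
  rather than of its absolute value, so that the quotients in the transition densities
  telescope.\<close>

lemma \<phi>det_pos:
  assumes X: "X \<in> chamber p"
  shows "\<phi>det X > 0"
proof -
  have "(\<Prod>j<p. \<Prod>i<j. X j - X i) > 0"
    using X by (intro prod_pos ballI) (auto simp: chamber_iff)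
  moreover have "(\<Prod>a<p. root_weight (X a)) > 0"
  proof (intro prod_pos ballI)
    fix a assume "a \<in> {..<p}"
    then have "0 < X a" "X a < 1" using chamber_unit[OF X, of a] by auto
    then have "jac_weight p z' w' (X a) > 0" unfolding jac_weight_def by (intro mult_pos_pos) auto
    then show "root_weight (X a) > 0" unfolding root_weight_def by (rule real_sqrt_gt_zero)
  qed
  ultimately show ?thesis unfolding \<phi>det_eq[OF X] using lead_prod_pos by (intro mult_pos_pos)
qed

lemma \<phi>det_sq:
  assumes X: "X \<in> chamber p"
  shows "(\<phi>det X)\<^sup>2 = lead_prod\<^sup>2 * unnormalized_density p z' w' X"
proof -
  have "(\<Prod>a<p. root_weight (X a))\<^sup>2 = (\<Prod>a<p. jac_weight p z' w' (X a))"
    unfolding prod_power_distrib[symmetric] power2_eq_square root_weight_sq prod.distrib[symmetric] ..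
  moreover have "(\<Prod>j<p. \<Prod>i<j. X j - X i)\<^sup>2 = (\<Prod>j<p. \<Prod>i<j. (X i - X j)\<^sup>2)"
    unfolding prod_power_distrib by (intro prod.cong refl power2_commute)
  ultimately show ?thesis
    unfolding \<phi>det_eq[OF X] unnormalized_density_def power_mult_distrib by (simp only: mult.assoc)
qed

definition norm_const :: real where
  "norm_const = (LINT X|chamber_lborel p. (\<phi>det X)\<^sup>2)"

lemma stationary_density_eq:
  assumes X: "X \<in> chamber p"
  shows "stationary_density p z' w' X = (\<phi>det X)\<^sup>2 / norm_const"
proof -
  have "norm_const = (LINT X|chamber_lborel p. lead_prod\<^sup>2 * unnormalized_density p z' w' X)"
    unfolding norm_const_def by (rule Bochner_Integration.integral_cong[OF refl]) (simp add: \<phi>det_sq)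
  then show ?thesis
    using lead_prod_pos by (simp add: stationary_density_def \<phi>det_sq[OF X])
qed

lemma transition_density_eq:
  assumes X: "X \<in> chamber p" and Y: "Y \<in> chamber p" and Z: "norm_const > 0"
  shows "transition_density p z' w' t Y X =
    \<phi>det Y / \<phi>det X * (exp (t * Etot) * hdet t X Y)"
proof -
  have "sqrt (stationary_density p z' w' Y) / sqrt (stationary_density p z' w' X) = \<phi>det Y / \<phi>det X"
    unfolding stationary_density_eq[OF X] stationary_density_eq[OF Y]
    using \<phi>det_pos[OF X] \<phi>det_pos[OF Y] Z by (simp add: real_sqrt_divide)
  moreover have "Determinant.det (Matrix.mat p p (\<lambda>(i, j).
       \<Sum>k. exp (- t * jac_eig p z' w' k) * jac_fun p z' w' k (X i) * jac_fun p z' w' k (Y j))) = hdet t X Y"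
    unfolding det_eq_pdet hdet_def heat_def kser_def ..
  ultimately show ?thesis
    unfolding transition_density_def Etot_def jac_eig_total_def by (simp only: mult.assoc)
qed

text \<open>For \<open>t < s\<close> the first \<open>p\<close> coefficients of \<open>kcoef\<close>
  vanish, so the shifted series in \<open>jac_Ker\<close> is the whole series of
  \<open>ker\<close>.\<close>

lemma jac_Ker_eq:
  assumes x: "x \<in> {0<..<1}" and y: "y \<in> {0<..<1}"
  shows "jac_Ker p z' w' x t y s = ker t s x y"
proof (cases "s \<le> t")
  case True
  then show ?thesis by (simp add: jac_Ker_def ker_eq_finite_sum)
next
  case False
  let ?f = "\<lambda>k. kcoef t s k * jac_fun p z' w' k x * jac_fun p z' w' k y"
  let ?g = "\<lambda>k. exp ((t - s) * jac_eig p z' w' (k + p)) * jac_fun p z' w' (k + p) x * jac_fun p z' w' (k + p) y"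
  have f: "summable ?f" by (rule summable_kser(1)[OF adm_kcoef x y])
  have fg: "?f (k + p) = - ?g k" for k using False by (simp add: kcoef_def)
  have "ker t s x y = (\<Sum>k. ?f (k + p)) + (\<Sum>k<p. ?f k)"
    unfolding ker_def kser_def by (rule suminf_split_initial_segment[OF f])
  also have "(\<Sum>k<p. ?f k) = 0" using False by (intro sum.neutral) (simp add: kcoef_def)
  also have "(\<Sum>k. ?f (k + p)) = - (\<Sum>k. ?g k)"
  proof -
    have "summable (\<lambda>k. ?f (k + p))" using f by (rule summable_ignore_initial_segment)
    then have "summable (\<lambda>k. - ?f (k + p))" by (rule summable_minus)
    then have "summable ?g" unfolding fg by simp
    then show ?thesis unfolding fg by (rule suminf_minus)
  qed
  finally show ?thesis using False by (simp add: jac_Ker_def)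
qed

lemma spectral_process_jacobi:
  fixes M :: "'a measure"
  assumes J: "jacobi_process p z' w' M J"
  shows "spectral_process p (jac_fun p z' w') jac_bound root_weight (jac_eig p z' w') M J norm_const"
proof -
  have prob: "prob_space M"
    and law: "\<And>t. t \<ge> 0 \<Longrightarrow> distributed M (chamber_lborel p) (J t) (\<lambda>X. ennreal (stationary_density p z' w' X))"
    and markov: "\<And>s t A. s \<ge> 0 \<Longrightarrow> t > 0 \<Longrightarrow> A \<in> sets (chamber_lborel p) \<Longrightarrow>
        AE \<omega> in M. real_cond_exp M (past M (chamber_lborel p) J s) (\<lambda>\<omega>'. indicator A (J (s + t) \<omega>')) \<omega> =
          (LINT Y:A|chamber_lborel p. transition_density p z' w' t Y (J s \<omega>))"
    using J unfolding jacobi_process_def by blast+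
  have J_chamber: "J t \<omega> \<in> chamber p" if "t \<ge> 0" "\<omega> \<in> space M" for t \<omega>
    using measurable_space[OF distributed_measurable[OF law[OF that(1)]] that(2)] by simp
  let ?f = "\<lambda>X. ennreal (stationary_density p z' w' X)" and ?g = "\<lambda>X. ennreal ((\<phi>det X)\<^sup>2 / norm_const)"
  have fg: "?f X = ?g X" if "X \<in> space (chamber_lborel p)" for X
    using that stationary_density_eq[of X] by simp
  have f: "?f \<in> borel_measurable (chamber_lborel p)"
    by (rule distributed_borel_measurable[OF law[OF order_refl]])
  have g: "?g \<in> borel_measurable (chamber_lborel p)"
  proof -
    have "?f \<in> borel_measurable (chamber_lborel p) \<longleftrightarrow> ?g \<in> borel_measurable (chamber_lborel p)"
      by (rule measurable_cong) (rule fg)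
    then show ?thesis using f by (simp only:)
  qed
  \<comment> \<open>Division by zero yields zero, so \<open>norm_const = 0\<close> would make the
    stationary density vanish on the chamber, against its total mass 1. This also excludes the
    default value 0 of a divergent normalizing integral.\<close>
  have Z: "norm_const > 0"
  proof (rule ccontr)
    assume "\<not> norm_const > 0"
    moreover have "norm_const \<ge> 0" unfolding norm_const_def by (rule integral_nonneg_AE) simp
    ultimately have 0: "norm_const = 0" by simp
    have D: "prob_space (distr M (chamber_lborel p) (J 0))"
      by (rule prob_space.prob_space_distr[OF prob distributed_measurable[OF law[OF order_refl]]])
    have "emeasure (density (chamber_lborel p) ?f) (space (chamber_lborel p)) =
        (\<integral>\<^sup>+X. ?f X * indicator (space (chamber_lborel p)) X \<partial>chamber_lborel p)"
      by (rule emeasure_density[OF f sets.top])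
    also have "\<dots> = (\<integral>\<^sup>+X. 0 \<partial>chamber_lborel p)"
      by (rule nn_integral_cong) (simp only: fg 0 div_by_0 ennreal_0 mult_zero_left)
    also have "\<dots> = 0" by simp
    finally show False
      using prob_space.emeasure_space_1[OF D] distributed_distr_eq_density[OF law[OF order_refl]] by simp
  qed
  show ?thesis
  proof (rule spectral_process.intro[OF spectral_kernel_axioms], rule spectral_process_axioms.intro)
    show "prob_space M" by (rule prob)
    show "norm_const > 0" by (rule Z)
    show "distributed M (chamber_lborel p) (J t) ?g" if "t \<ge> 0" for t
      using law[OF that] g density_cong[OF f g AE_I2[OF fg]] unfolding distributed_def by simp
    show "\<phi>det X \<noteq> 0" if "X \<in> chamber p" for X
      using \<phi>det_pos[OF that] by simp
    fix s t A assume *: "s \<ge> (0::real)" "t > (0::real)" "A \<in> sets (chamber_lborel p)"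
    show "AE \<omega> in M. real_cond_exp M (past M (chamber_lborel p) J s) (\<lambda>\<omega>'. indicator A (J (s + t) \<omega>')) \<omega> =
        (LINT Y:A|chamber_lborel p. \<phi>det Y / \<phi>det (J s \<omega>) * (exp (t * Etot) * hdet t (J s \<omega>) Y))"
      using markov[OF *] AE_space
    proof eventually_elim
      fix \<omega>
      assume 1: "real_cond_exp M (past M (chamber_lborel p) J s) (\<lambda>\<omega>'. indicator A (J (s + t) \<omega>')) \<omega> =
          (LINT Y:A|chamber_lborel p. transition_density p z' w' t Y (J s \<omega>))" and \<omega>: "\<omega> \<in> space M"
      have "(LINT Y:A|chamber_lborel p. transition_density p z' w' t Y (J s \<omega>)) =
          (LINT Y:A|chamber_lborel p. \<phi>det Y / \<phi>det (J s \<omega>) * (exp (t * Etot) * hdet t (J s \<omega>) Y))"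
        unfolding set_lebesgue_integral_def
      proof (rule Bochner_Integration.integral_cong[OF refl])
        fix Y assume "Y \<in> space (chamber_lborel p)"
        then have "Y \<in> chamber p" by simp
        then show "indicator A Y *\<^sub>R transition_density p z' w' t Y (J s \<omega>) =
            indicator A Y *\<^sub>R (\<phi>det Y / \<phi>det (J s \<omega>) * (exp (t * Etot) * hdet t (J s \<omega>) Y))"
          by (simp only: transition_density_eq[OF J_chamber[OF *(1) \<omega>] _ Z])
      qed
      with 1 show "real_cond_exp M (past M (chamber_lborel p) J s) (\<lambda>\<omega>'. indicator A (J (s + t) \<omega>')) \<omega> =
        (LINT Y:A|chamber_lborel p. \<phi>det Y / \<phi>det (J s \<omega>) * (exp (t * Etot) * hdet t (J s \<omega>) Y))"
        by simp
    qed
  qed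
qed

end

theorem proposition5p5:
  fixes p n :: nat and z' w' :: real
    and M :: "'a measure" and J :: "real \<Rightarrow> 'a \<Rightarrow> nat \<Rightarrow> real" and t :: "nat \<Rightarrow> real"
  assumes "z' > real p - 1" and "w' > -1"
    and "jacobi_process p z' w' M J"
    and "n \<ge> 1" and "\<And>i. i < n \<Longrightarrow> t i \<ge> 0"
  shows "is_correlation_function p M J n t
           (\<lambda>x. Determinant.det (Matrix.mat n n (\<lambda>(i, j).
                  jac_Ker p z' w' (x i) (t i) (x j) (t j))))"
proof -
  interpret jacobi_params p z' w'
    by unfold_locales (use assms(1,2) in auto)
  have "is_correlation_function p M J n t (rho n t)"
    by (rule spectral_process.rho_is_correlation_function[OF spectral_process_jacobi[OF assms(3)] assms(5)])
  then show ?thesis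
  proof (rule is_correlation_function_cong[rotated])
    fix x assume "x \<in> cube n"
    then have "x i \<in> {0<..<1}" if "i < n" for i using that by (auto simp: cube_def PiE_iff)
    then show "rho n t x = Determinant.det (Matrix.mat n n (\<lambda>(i, j).
        jac_Ker p z' w' (x i) (t i) (x j) (t j)))"
      unfolding det_eq_pdet rho_def by (intro pdet_cong) (auto simp: jac_Ker_eq)
  qed
qed

end
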